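(* Let $n\ge1$. Let $P_n$ be the proper part of the Segre product poset $B_n\circ_{\rho}B_n=\{(S,T): S,T\subseteq[n],\ |S|=|T|\}$ (ordered componentwise by inclusion, minimum and maximum removed), with the action of $\mathcal{S}_n\times\mathcal{S}_n$ given by $(\sigma,\tau)\cdot(S,T)=(\sigma(S),\tau(T))$, inducing a representation on the reduced top homology $\widetilde{H}_{n-2}(P_n)$. Let $$W_n(q)=\sum_{(\sigma,\omega)\in\mathcal{D}_n}q^{\mathrm{inv}(\sigma)+\mathrm{inv}(\omega)},$$ where $\mathcal{D}_n$ is the set of pairs $(\sigma,\omega)\in\mathcal{S}_n\times\mathcal{S}_n$ having no common ascent. Then $$ps\big(ch(\widetilde{H}_{n-2}(P_n))\big)=\frac{W_n(q)}{\prod_{i=1}^{n}(1-q^i)^2}.$$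
   Context: An ascent of $\sigma\in\mathcal{S}_n$ is $i\in[n-1]$ with $\sigma(i)<\sigma(i+1)$; $\mathrm{inv}(\sigma)=|\{(i,j):1\le i<j\le n,\ \sigma(i)>\sigma(j)\}|$. For a class function $\chi$ on $\mathcal{S}_m\times\mathcal{S}_n$, its product Frobenius characteristic is $ch(\chi)=\sum_{\mu\vdash m,\lambda\vdash n}z_\mu^{-1}z_\lambda^{-1}\chi(\mu,\lambda)p_\mu(x)p_\lambda(y)$, a symmetric function in variables $x=(x_1,x_2,\dots)$ and $y=(y_1,y_2,\dots)$ ($p_\mu$ power sums, $z_\mu$ centralizer sizes, $\chi(\mu,\lambda)$ the value on cycle type $(\mu,\lambda)$); for a representation it is that of its character. When $n=1$, $P_1=\emptyset$ and $\widetilde H_{-1}(\emptyset)$ is the trivial representation. The stable principal specialization $ps$ of such a symmetric function substitutes $x_i=y_i=q^{i-1}$ for all $i\ge1$. *)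

theory Defs
  imports
    Complex_Main
    "HOL-Library.FuncSet"
    "HOL-Library.Multiset"
    "HOL-Library.Product_Order"
    "HOL-Combinatorics.Orbits"
    "HOL-Algebra.Module"
    "HOL-Algebra.AbelCoset"
    "HOL-Computational_Algebra.Formal_Power_Series"
begin

section \<open>Traces on finite-dimensional complex vector spaces\<close>

text \<open>
  Vector spaces are \<open>module\<close> records over the complex numbers; the ring multiplication and unit
  of the record are irrelevant and left undefined.
\<close>

definition quotient_module ::
    "(complex, 'b) module \<Rightarrow> 'b set \<Rightarrow> (complex, 'b set) module" where
  "quotient_module M N =
     \<lparr>carrier = a_rcosets\<^bsub>M\<^esub> N, monoid.mult = undefined, one = undefined,
      zero = N, add = set_add M,
      smult = (\<lambda>a C. \<Union>v\<in>C. N +>\<^bsub>M\<^esub> (a \<odot>\<^bsub>M\<^esub> v))\<rparr>"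

definition is_coords ::
    "(complex, 'b) module \<Rightarrow> 'b set \<Rightarrow> 'b \<Rightarrow> ('b \<Rightarrow> complex) \<Rightarrow> bool" where
  "is_coords M E v a \<longleftrightarrow>
     a \<in> extensional E \<and> v = finsum M (\<lambda>e. a e \<odot>\<^bsub>M\<^esub> e) E"

definition is_basis :: "(complex, 'b) module \<Rightarrow> 'b set \<Rightarrow> bool" where
  "is_basis M E \<longleftrightarrow>
     finite E \<and> E \<subseteq> carrier M \<and> (\<forall>v\<in>carrier M. \<exists>!a. is_coords M E v a)"

definition coords :: "(complex, 'b) module \<Rightarrow> 'b set \<Rightarrow> 'b \<Rightarrow> 'b \<Rightarrow> complex" where
  "coords M E v = (THE a. is_coords M E v a)"

definition linear_trace :: "(complex, 'b) module \<Rightarrow> ('b \<Rightarrow> 'b) \<Rightarrow> complex" where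
  "linear_trace M f = (let E = (SOME E. is_basis M E) in \<Sum>e\<in>E. coords M E (f e) e)"

section \<open>Reduced homology of posets\<close>

text \<open>
  A \<open>k\<close>-simplex of the order complex is a strictly increasing list of \<open>k + 1\<close> elements; the empty
  list is the unique simplex of dimension \<open>-1\<close>, which makes the homology below the reduced one.
\<close>

definition order_simplices :: "'a::order set \<Rightarrow> int \<Rightarrow> 'a list set" where
  "order_simplices P k = {xs. sorted_wrt (<) xs \<and> set xs \<subseteq> P \<and> int (length xs) = k + 1}"

definition poset_chains :: "'a::order set \<Rightarrow> int \<Rightarrow> ('a list \<Rightarrow> complex) set" where
  "poset_chains P k = {c. finite {xs. c xs \<noteq> 0} \<and> {xs. c xs \<noteq> 0} \<subseteq> order_simplices P k}"

definition boundary :: "('a list \<Rightarrow> complex) \<Rightarrow> 'a list \<Rightarrow> complex" where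
  "boundary c = (\<lambda>ys. \<Sum>xs | c xs \<noteq> 0. \<Sum>i<length xs.
      if take i xs @ drop (Suc i) xs = ys then (-1) ^ i * c xs else 0)"

definition cycle_module :: "'a::order set \<Rightarrow> int \<Rightarrow> (complex, 'a list \<Rightarrow> complex) module" where
  "cycle_module P k =
     \<lparr>carrier = {c \<in> poset_chains P k. boundary c = (\<lambda>_. 0)},
      monoid.mult = undefined, one = undefined,
      zero = (\<lambda>_. 0), add = (\<lambda>c d xs. c xs + d xs), smult = (\<lambda>a c xs. a * c xs)\<rparr>"

definition reduced_homology ::
    "'a::order set \<Rightarrow> int \<Rightarrow> (complex, ('a list \<Rightarrow> complex) set) module" where
  "reduced_homology P k = quotient_module (cycle_module P k) (boundary ` poset_chains P (k + 1))"

definition chain_map :: "('a \<Rightarrow> 'b) \<Rightarrow> ('a list \<Rightarrow> complex) \<Rightarrow> 'b list \<Rightarrow> complex" where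
  "chain_map f c = (\<lambda>ys. \<Sum>xs | c xs \<noteq> 0 \<and> map f xs = ys. c xs)"

text \<open>
  An automorphism of the poset maps the space of boundaries onto itself, so the class of a cycle
  \<open>z\<close>, which is a coset, is mapped onto the class of \<open>chain_map f z\<close>.
\<close>

definition homology_map ::
    "('a \<Rightarrow> 'a) \<Rightarrow> ('a list \<Rightarrow> complex) set \<Rightarrow> ('a list \<Rightarrow> complex) set" where
  "homology_map f C = chain_map f ` C"

section \<open>The Segre product of two Boolean lattices\<close>

definition segre_poset :: "nat \<Rightarrow> (nat set \<times> nat set) set" where
  "segre_poset n = {(S, T). S \<subseteq> {1..n} \<and> T \<subseteq> {1..n} \<and> card S = card T}"

definition segre_proper_part :: "nat \<Rightarrow> (nat set \<times> nat set) set" where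
  "segre_proper_part n = segre_poset n - {({}, {}), ({1..n}, {1..n})}"

definition segre_action ::
    "(nat \<Rightarrow> nat) \<Rightarrow> (nat \<Rightarrow> nat) \<Rightarrow> nat set \<times> nat set \<Rightarrow> nat set \<times> nat set" where
  "segre_action \<sigma> \<tau> = (\<lambda>(S, T). (\<sigma> ` S, \<tau> ` T))"

definition top_homology_character :: "nat \<Rightarrow> (nat \<Rightarrow> nat) \<Rightarrow> (nat \<Rightarrow> nat) \<Rightarrow> complex" where
  "top_homology_character n \<sigma> \<tau> =
     linear_trace (reduced_homology (segre_proper_part n) (int n - 2))
       (homology_map (segre_action \<sigma> \<tau>))"

section \<open>Power series in two sets of variables\<close>

text \<open>
  The variables \<open>XVar i\<close> and \<open>YVar i\<close> with \<open>i \<ge> 1\<close> stand for $x_i$ and $y_i$ (index 0 is never used).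
  A monomial is a multiset of variables, and a power series in infinitely many variables is given
  by its coefficient function on monomials.
\<close>

datatype var = XVar nat | YVar nat

type_synonym series = "var multiset \<Rightarrow> complex"

definition series_one :: series where
  "series_one M = (if M = {#} then 1 else 0)"

definition series_mult :: "series \<Rightarrow> series \<Rightarrow> series" where
  "series_mult f g M = (\<Sum>A | A \<subseteq># M. f A * g (M - A))"

definition power_sum :: "(nat \<Rightarrow> var) \<Rightarrow> nat \<Rightarrow> series" where
  "power_sum v k M = (if \<exists>i\<ge>1. M = replicate_mset k (v i) then 1 else 0)"

definition power_sum_partition :: "(nat \<Rightarrow> var) \<Rightarrow> nat list \<Rightarrow> series" where
  "power_sum_partition v \<mu> = foldr (\<lambda>k. series_mult (power_sum v k)) \<mu> series_one"

section \<open>The product Frobenius characteristic\<close>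

definition partitions :: "nat \<Rightarrow> nat list set" where
  "partitions n = {\<mu>. sorted_wrt (\<ge>) \<mu> \<and> 0 \<notin> set \<mu> \<and> sum_list \<mu> = n}"

definition z_partition :: "nat list \<Rightarrow> nat" where
  "z_partition \<mu> = (\<Prod>i\<in>set \<mu>. i ^ count_list \<mu> i * fact (count_list \<mu> i))"

definition cycle_type :: "nat \<Rightarrow> (nat \<Rightarrow> nat) \<Rightarrow> nat list" where
  "cycle_type n \<sigma> =
     rev (sorted_list_of_multiset (image_mset card (mset_set (orbit \<sigma> ` {1..n}))))"

definition perm_of_type :: "nat \<Rightarrow> nat list \<Rightarrow> nat \<Rightarrow> nat" where
  "perm_of_type n \<mu> = (SOME \<sigma>. \<sigma> permutes {1..n} \<and> cycle_type n \<sigma> = \<mu>)"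

definition frobenius_char ::
    "nat \<Rightarrow> nat \<Rightarrow> ((nat \<Rightarrow> nat) \<Rightarrow> (nat \<Rightarrow> nat) \<Rightarrow> complex) \<Rightarrow> series" where
  "frobenius_char m n \<chi> = (\<lambda>M. \<Sum>\<mu>\<in>partitions m. \<Sum>\<nu>\<in>partitions n.
      \<chi> (perm_of_type m \<mu>) (perm_of_type n \<nu>)
        / (of_nat (z_partition \<mu>) * of_nat (z_partition \<nu>))
        * series_mult (power_sum_partition XVar \<mu>) (power_sum_partition YVar \<nu>) M)"

section \<open>Stable principal specialization\<close>

fun principal_value :: "var \<Rightarrow> complex fps" where
  "principal_value (XVar i) = fps_X ^ (i - 1)"
| "principal_value (YVar i) = fps_X ^ (i - 1)"

definition specialize_monomial :: "series \<Rightarrow> var multiset \<Rightarrow> complex fps" where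
  "specialize_monomial f M = fps_const (f M) * (\<Prod>v\<in>#M. principal_value v)"

text \<open>
  The coefficientwise sum of all specialized monomials. For a series of bounded degree, only
  finitely many monomials contribute to a given power of \<open>q\<close>.
\<close>

definition principal_specialization :: "series \<Rightarrow> complex fps" where
  "principal_specialization f = Abs_fps (\<lambda>d.
     \<Sum>M | fps_nth (specialize_monomial f M) d \<noteq> 0. fps_nth (specialize_monomial f M) d)"

section \<open>Pairs of permutations without common ascent\<close>

definition ascents :: "nat \<Rightarrow> (nat \<Rightarrow> nat) \<Rightarrow> nat set" where
  "ascents n \<sigma> = {i \<in> {1..<n}. \<sigma> i < \<sigma> (i + 1)}"

definition inversions :: "nat \<Rightarrow> (nat \<Rightarrow> nat) \<Rightarrow> nat" where
  "inversions n \<sigma> = card {(i, j). 1 \<le> i \<and> i < j \<and> j \<le> n \<and> \<sigma> i > \<sigma> j}"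

definition no_common_ascent :: "nat \<Rightarrow> ((nat \<Rightarrow> nat) \<times> (nat \<Rightarrow> nat)) set" where
  "no_common_ascent n = {(\<sigma>, \<omega>). \<sigma> permutes {1..n} \<and> \<omega> permutes {1..n} \<and>
     ascents n \<sigma> \<inter> ascents n \<omega> = {}}"

definition W_poly :: "nat \<Rightarrow> complex fps" where
  "W_poly n = (\<Sum>(\<sigma>, \<omega>)\<in>no_common_ascent n. fps_X ^ (inversions n \<sigma> + inversions n \<omega>))"

end

theory Submission
  imports Defs
begin

text \<open>
  For a chain \<open>c\<close> of pairs \<open>(S, T)\<close> let \<open>I(c)\<close> be the set of pairs \<open>x > y\<close> that some member of \<open>c\<close>
  separates (\<open>x\<close> inside, \<open>y\<close> outside), recorded for both coordinates. An element is free for \<open>c\<close> if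
  it is comparable to \<open>c\<close> and inserting or deleting it does not change \<open>I(c)\<close>. Toggling a free element
  does not change the set of free elements, so toggling a chosen one matches chains of different parity
  with the same \<open>I(c)\<close>; every chain that is not maximal has a free element, and the unmatched maximal
  chains are the pairs of permutations without common ascent, with \<open>|I(c)|\<close> their number of inversions.

  This matching is used twice. It is acyclic with respect to \<open>|I(c)|\<close>, hence the homology is
  concentrated in the top degree and the character is a signed count of fixed chains (Hopf trace).
  It is also a sign-reversing involution, which turns \<open>W_n(q)\<close> into the signed sum of \<open>q^|I(c)|\<close> over
  all chains. Splitting off the last element of a chain, both signed sums satisfy the recursion
  of \<open>\<Sum> (-1)^(n - k) h_{a_1}^2 \<dots> h_{a_k}^2\<close> over compositions of \<open>n\<close>, with \<open>h_a = 1 / (q; q)_a\<close>.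
\<close>

section \<open>Inversions separated by a chain and free elements\<close>

text \<open>The matching depends on the order of the integers, so it is not equivariant and cannot
  describe the representation itself. It supplies exactness only; the trace is then read off from
  projections onto the cycle spaces, which do not commute with the action in general either.

  Toggling rests on one exchange property: two members of a chain that are redundant one at a time
  are also redundant together (\<open>redundant_pair\<close>). Here the total order of the integers
  enters, through an element that is compared with both ends of an inversion.

  Both recursions split at the last element because the part of the poset below
  \<open>(S, T)\<close> is again a Segre product, of the Boolean lattices on \<open>S\<close> and
  \<open>T\<close>. For this reason everything is stated for two arbitrary finite sets of equal
  size. Each coordinate contributes one factor \<open>h_a\<close>, which explains the squares. For
  inversions this factor comes from Gaussian binomial coefficients, for the character from the
  expansion of \<open>h_a\<close> into power sums, after the fixed chains have been counted by cycle
  types.\<close>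

definition is_chain :: "'a::order set \<Rightarrow> bool" where
  "is_chain c \<longleftrightarrow> (\<forall>x\<in>c. \<forall>y\<in>c. x \<le> y \<or> y \<le> x)"

text \<open>The ground sets are arbitrary because the recursions pass to the elements below some
  \<open>x\<close>, and these form \<open>segre_interior (fst x) (snd x)\<close>.\<close>

definition segre_interior :: "nat set \<Rightarrow> nat set \<Rightarrow> (nat set \<times> nat set) set" where
  "segre_interior A B =
     {(S, T). S \<subseteq> A \<and> T \<subseteq> B \<and> card S = card T \<and> 0 < card S \<and> card S < card A}"

definition cut_inv :: "nat set \<Rightarrow> nat set \<Rightarrow> (nat \<times> nat) set" where
  "cut_inv A S = {(x, y). x \<in> S \<and> y \<in> A - S \<and> y < x}"

text \<open>The disjoint sum keeps the coordinates apart: cardinalities add, and a member is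
  redundant iff it is redundant in both coordinates.\<close>

definition sep_inv ::
    "nat set \<Rightarrow> nat set \<Rightarrow> nat set \<times> nat set \<Rightarrow> (nat \<times> nat + nat \<times> nat) set" where
  "sep_inv A B x = cut_inv A (fst x) <+> cut_inv B (snd x)"

definition chain_inv ::
    "nat set \<Rightarrow> nat set \<Rightarrow> (nat set \<times> nat set) set \<Rightarrow> (nat \<times> nat + nat \<times> nat) set" where
  "chain_inv A B c = (\<Union>x\<in>c. sep_inv A B x)"

text \<open>Comparing with \<open>c - {x}\<close> treats both cases by one formula: for a member it
  says that deletion keeps \<open>chain_inv\<close>, for a non-member that insertion does.\<close>

definition free_elems ::
    "nat set \<Rightarrow> nat set \<Rightarrow> (nat set \<times> nat set) set \<Rightarrow> (nat set \<times> nat set) set" where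
  "free_elems A B c =
     {x \<in> segre_interior A B. is_chain (insert x c) \<and> sep_inv A B x \<subseteq> chain_inv A B (c - {x})}"

lemma segre_interiorD:
  assumes "x \<in> segre_interior A B"
  shows "fst x \<subseteq> A" "snd x \<subseteq> B" "card (fst x) = card (snd x)"
    "0 < card (fst x)" "card (fst x) < card A"
  using assms by (auto simp: segre_interior_def)

lemma is_chain_subset: "is_chain c \<Longrightarrow> d \<subseteq> c \<Longrightarrow> is_chain d"
  by (auto simp: is_chain_def)

lemma chain_inv_mono: "c \<subseteq> d \<Longrightarrow> chain_inv A B c \<subseteq> chain_inv A B d"
  by (auto simp: chain_inv_def)

lemma chain_inv_insert: "chain_inv A B (insert x c) = sep_inv A B x \<union> chain_inv A B c"
  by (auto simp: chain_inv_def)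

lemma finite_segre_interior: "finite A \<Longrightarrow> finite B \<Longrightarrow> finite (segre_interior A B)"
  by (rule finite_subset[of _ "Pow A \<times> Pow B"]) (auto simp: segre_interior_def)

lemma finite_cut_inv: "finite A \<Longrightarrow> S \<subseteq> A \<Longrightarrow> finite (cut_inv A S)"
  by (rule finite_subset[of _ "A \<times> A"]) (auto simp: cut_inv_def)

lemma finite_chain_inv:
  assumes "finite A" "finite B" "c \<subseteq> segre_interior A B"
  shows "finite (chain_inv A B c)"
proof -
  have "finite (sep_inv A B x)" if "x \<in> c" for x
    using assms that finite_cut_inv[of A "fst x"] finite_cut_inv[of B "snd x"]
    by (auto simp: sep_inv_def segre_interior_def)
  moreover have "finite c"
    using assms finite_segre_interior finite_subset by blast
  ultimately show ?thesis by (auto simp: chain_inv_def)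
qed

text \<open>Equality in one coordinate would give equal cardinalities in the other, and an inclusion
  of finite sets of equal size is an equality.\<close>

lemma segre_interior_less:
  assumes "finite A" "finite B" "x \<in> segre_interior A B" "y \<in> segre_interior A B" "x < y"
  shows "fst x \<subset> fst y" "snd x \<subset> snd y" "card (fst x) < card (fst y)"
proof -
  have fin: "finite (fst y)" "finite (snd y)"
    using assms by (auto simp: segre_interior_def dest: finite_subset)
  have le: "fst x \<subseteq> fst y" "snd x \<subseteq> snd y" and ne: "x \<noteq> y"
    using assms(5) by (auto simp: less_le less_eq_prod_def)
  have c: "card (fst x) = card (snd x)" "card (fst y) = card (snd y)"
    using assms by (auto simp: segre_interior_def)
  show "fst x \<subset> fst y" "snd x \<subset> snd y"
    using le ne c fin by (metis card_subset_eq prod_eqI psubsetI)+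
  then show "card (fst x) < card (fst y)" using fin psubset_card_mono by blast
qed

text \<open>Write \<open>p = (x, y)\<close> with \<open>y < x\<close> and take \<open>z\<close> in
  \<open>f a\<close> but not in \<open>f b\<close>. Then \<open>z < x\<close> or
  \<open>y < z\<close>, so \<open>(x, z)\<close> is an inversion separated by \<open>b\<close> or
  \<open>(z, y)\<close> is one separated by \<open>a\<close>. Redundancy provides another member
  separating it; that member differs from both \<open>a\<close> and \<open>b\<close> and, by
  comparability, also separates \<open>p\<close>.\<close>

lemma cut_inv_common:
  fixes f :: "'e \<Rightarrow> nat set"
  assumes p: "p \<in> cut_inv A (f a)" "p \<in> cut_inv A (f b)" and ba: "f b \<subset> f a" and aA: "f a \<subseteq> A"
    and ca: "\<And>e. e \<in> c \<Longrightarrow> f e \<subseteq> f a \<or> f a \<subseteq> f e"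
    and cb: "\<And>e. e \<in> c \<Longrightarrow> f e \<subseteq> f b \<or> f b \<subseteq> f e"
    and ra: "\<And>q. q \<in> cut_inv A (f a) \<Longrightarrow> \<exists>e\<in>c - {a}. q \<in> cut_inv A (f e)"
    and rb: "\<And>q. q \<in> cut_inv A (f b) \<Longrightarrow> \<exists>e\<in>c - {b}. q \<in> cut_inv A (f e)"
  shows "\<exists>e\<in>c - {a, b}. p \<in> cut_inv A (f e)"
proof -
  obtain x y where xy: "p = (x, y)" by fastforce
  obtain z where z: "z \<in> f a" "z \<notin> f b" using ba by blast
  show ?thesis
  proof (cases "z < x")
    case True
    then have "(x, z) \<in> cut_inv A (f b)" using p xy z aA by (auto simp: cut_inv_def)
    from rb[OF this] obtain e where e: "e \<in> c" "e \<noteq> b" "x \<in> f e" "z \<notin> f e"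
      by (auto simp: cut_inv_def)
    then have "f e \<subseteq> f a" using ca z by blast
    then have "e \<in> c - {a, b}" "p \<in> cut_inv A (f e)" using p xy e z by (auto simp: cut_inv_def)
    then show ?thesis by blast
  next
    case False
    then have "(z, y) \<in> cut_inv A (f a)" using p xy z aA by (auto simp: cut_inv_def)
    from ra[OF this] obtain e where e: "e \<in> c" "e \<noteq> a" "z \<in> f e" "y \<notin> f e"
      by (auto simp: cut_inv_def)
    then have "f b \<subseteq> f e" using cb z by blast
    then have "e \<in> c - {a, b}" "p \<in> cut_inv A (f e)" using p xy e z by (auto simp: cut_inv_def)
    then show ?thesis by blast
  qed
qed

lemma Inl_in_chain_inv:
  "Inl p \<in> chain_inv A B c \<longleftrightarrow> (\<exists>e\<in>c. p \<in> cut_inv A (fst e))"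
  by (auto simp: chain_inv_def sep_inv_def)

lemma Inr_in_chain_inv:
  "Inr p \<in> chain_inv A B c \<longleftrightarrow> (\<exists>e\<in>c. p \<in> cut_inv B (snd e))"
  by (auto simp: chain_inv_def sep_inv_def)

lemma sep_inv_common:
  assumes "finite A" "finite B" and c: "is_chain c" "a \<in> c" "b \<in> c" "c \<subseteq> segre_interior A B"
    and ba: "b < a"
    and ra: "sep_inv A B a \<subseteq> chain_inv A B (c - {a})"
    and rb: "sep_inv A B b \<subseteq> chain_inv A B (c - {b})"
  shows "sep_inv A B a \<inter> sep_inv A B b \<subseteq> chain_inv A B (c - {a, b})"
proof
  fix p assume p: "p \<in> sep_inv A B a \<inter> sep_inv A B b"
  have ss: "fst b \<subset> fst a" "snd b \<subset> snd a"
    using segre_interior_less[OF assms(1,2) _ _ ba] c by auto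
  have sub: "fst a \<subseteq> A" "snd a \<subseteq> B" using c segre_interiorD by blast+
  have cmp: "x \<le> y \<or> y \<le> x" if "x \<in> c" "y \<in> c" for x y
    using c that by (auto simp: is_chain_def)
  show "p \<in> chain_inv A B (c - {a, b})"
  proof (cases p)
    case (Inl q)
    have "\<exists>e\<in>c - {a, b}. q \<in> cut_inv A (fst e)"
    proof (rule cut_inv_common[where f = fst])
      show "q \<in> cut_inv A (fst a)" "q \<in> cut_inv A (fst b)" using p Inl by (auto simp: sep_inv_def)
      show "fst e \<subseteq> fst a \<or> fst a \<subseteq> fst e" if "e \<in> c" for e
        using cmp[OF that c(2)] by (auto simp: less_eq_prod_def)
      show "fst e \<subseteq> fst b \<or> fst b \<subseteq> fst e" if "e \<in> c" for e
        using cmp[OF that c(3)] by (auto simp: less_eq_prod_def)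
      show "\<exists>e\<in>c - {a}. q \<in> cut_inv A (fst e)" if "q \<in> cut_inv A (fst a)" for q
        using ra that unfolding Inl_in_chain_inv[symmetric, of _ _ _ B] by (auto simp: sep_inv_def)
      show "\<exists>e\<in>c - {b}. q \<in> cut_inv A (fst e)" if "q \<in> cut_inv A (fst b)" for q
        using rb that unfolding Inl_in_chain_inv[symmetric, of _ _ _ B] by (auto simp: sep_inv_def)
    qed (use ss sub in auto)
    then show ?thesis using Inl by (simp add: Inl_in_chain_inv)
  next
    case (Inr q)
    have "\<exists>e\<in>c - {a, b}. q \<in> cut_inv B (snd e)"
    proof (rule cut_inv_common[where f = snd])
      show "q \<in> cut_inv B (snd a)" "q \<in> cut_inv B (snd b)" using p Inr by (auto simp: sep_inv_def)
      show "snd e \<subseteq> snd a \<or> snd a \<subseteq> snd e" if "e \<in> c" for e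
        using cmp[OF that c(2)] by (auto simp: less_eq_prod_def)
      show "snd e \<subseteq> snd b \<or> snd b \<subseteq> snd e" if "e \<in> c" for e
        using cmp[OF that c(3)] by (auto simp: less_eq_prod_def)
      show "\<exists>e\<in>c - {a}. q \<in> cut_inv B (snd e)" if "q \<in> cut_inv B (snd a)" for q
        using ra that unfolding Inr_in_chain_inv[symmetric, of _ _ _ A] by (auto simp: sep_inv_def)
      show "\<exists>e\<in>c - {b}. q \<in> cut_inv B (snd e)" if "q \<in> cut_inv B (snd b)" for q
        using rb that unfolding Inr_in_chain_inv[symmetric, of _ _ _ A] by (auto simp: sep_inv_def)
    qed (use ss sub in auto)
    then show ?thesis using Inr by (simp add: Inr_in_chain_inv)
  qed
qed

text \<open>Redundancy of \<open>a\<close> may rely on \<open>b\<close> and vice versa. The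
  inversions of \<open>a\<close> that only \<open>b\<close> accounts for are common to both, and
  \<open>sep_inv_common\<close> finds a third member for them.\<close>

lemma redundant_pair:
  assumes "finite A" "finite B" and c: "is_chain c" "a \<in> c" "b \<in> c" "c \<subseteq> segre_interior A B"
    and ab: "a \<noteq> b"
    and ra: "sep_inv A B a \<subseteq> chain_inv A B (c - {a})"
    and rb: "sep_inv A B b \<subseteq> chain_inv A B (c - {b})"
  shows "sep_inv A B a \<subseteq> chain_inv A B (c - {a, b})"
proof -
  have "a < b \<or> b < a" using c ab by (auto simp: is_chain_def less_le)
  then have com: "sep_inv A B a \<inter> sep_inv A B b \<subseteq> chain_inv A B (c - {a, b})"
    using sep_inv_common[OF assms(1,2) c _ ra rb] sep_inv_common[OF assms(1,2) c(1,3,2,4) _ rb ra]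
    by (auto simp: insert_commute)
  have "chain_inv A B (c - {a}) \<subseteq> sep_inv A B b \<union> chain_inv A B (c - {a, b})"
    by (auto simp: chain_inv_def)
  with com ra show ?thesis by blast
qed

text \<open>Take \<open>x\<close> in the first set only and \<open>y\<close> in the second only. The
  larger of them heads an inversion of the set containing it, and a member of \<open>c\<close>
  separating this inversion is incomparable to the other set.\<close>

lemma cut_inv_comparable:
  fixes f :: "'e \<Rightarrow> nat set"
  assumes "f a \<subseteq> A" "f b \<subseteq> A"
    and ca: "\<And>e. e \<in> c \<Longrightarrow> f e \<subseteq> f a \<or> f a \<subseteq> f e"
    and cb: "\<And>e. e \<in> c \<Longrightarrow> f e \<subseteq> f b \<or> f b \<subseteq> f e"
    and ra: "\<And>q. q \<in> cut_inv A (f a) \<Longrightarrow> \<exists>e\<in>c. q \<in> cut_inv A (f e)"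
    and rb: "\<And>q. q \<in> cut_inv A (f b) \<Longrightarrow> \<exists>e\<in>c. q \<in> cut_inv A (f e)"
  shows "f a \<subseteq> f b \<or> f b \<subseteq> f a"
proof (rule ccontr)
  assume "\<not> ?thesis"
  then obtain x y where xy: "x \<in> f a" "x \<notin> f b" "y \<in> f b" "y \<notin> f a" by blast
  then consider "y < x" | "x < y" by fastforce
  then show False
  proof cases
    case 1
    then have "(x, y) \<in> cut_inv A (f a)" using xy assms by (auto simp: cut_inv_def)
    from ra[OF this] obtain e where "e \<in> c" "x \<in> f e" "y \<notin> f e" by (auto simp: cut_inv_def)
    then show False using cb xy by blast
  next
    case 2
    then have "(y, x) \<in> cut_inv A (f b)" using xy assms by (auto simp: cut_inv_def)
    from rb[OF this] obtain e where "e \<in> c" "y \<in> f e" "x \<notin> f e" by (auto simp: cut_inv_def)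
    then show False using ca xy by blast
  qed
qed

lemma segre_interior_comparable:
  assumes "finite A" "finite B" "a \<in> segre_interior A B" "b \<in> segre_interior A B"
    "fst a \<subseteq> fst b \<or> fst b \<subseteq> fst a" "snd a \<subseteq> snd b \<or> snd b \<subseteq> snd a"
  shows "a \<le> b \<or> b \<le> a"
proof -
  have fin: "finite (fst a)" "finite (snd a)" "finite (fst b)" "finite (snd b)"
    and c: "card (fst a) = card (snd a)" "card (fst b) = card (snd b)"
    using assms by (auto simp: segre_interior_def dest: finite_subset)
  \<comment> \<open>Inclusions in opposite directions force equal cardinalities, so the mixed cases
    collapse to equality in the second coordinate.\<close>
  have eq1: "snd a = snd b" if "fst a \<subseteq> fst b" "snd b \<subseteq> snd a"
    using that fin c card_mono[of "fst b" "fst a"] card_mono[of "snd a" "snd b"]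
    by (metis card_seteq)
  have eq2: "snd a = snd b" if "fst b \<subseteq> fst a" "snd a \<subseteq> snd b"
    using that fin c card_mono[of "fst a" "fst b"] card_mono[of "snd b" "snd a"]
    by (metis card_seteq)
  show ?thesis
    using assms(5,6) eq1 eq2 unfolding less_eq_prod_def by blast
qed

text \<open>Ensures that inserting one free element never makes another one incomparable to the
  chain.\<close>

lemma free_elems_comparable:
  assumes "finite A" "finite B" and c: "c \<subseteq> segre_interior A B"
    and a: "a \<in> free_elems A B c" and b: "b \<in> free_elems A B c"
  shows "a \<le> b \<or> b \<le> a"
proof -
  have ab: "a \<in> segre_interior A B" "b \<in> segre_interior A B" using a b by (auto simp: free_elems_def)
  have ra: "sep_inv A B a \<subseteq> chain_inv A B c" and rb: "sep_inv A B b \<subseteq> chain_inv A B c"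
    using a b chain_inv_mono[of "c - {a}" c A B] chain_inv_mono[of "c - {b}" c A B]
    unfolding free_elems_def by blast+
  have cmp: "e \<le> a \<or> a \<le> e" "e \<le> b \<or> b \<le> e" if "e \<in> c" for e
    using that a b by (auto simp: free_elems_def is_chain_def)
  have 1: "fst a \<subseteq> fst b \<or> fst b \<subseteq> fst a"
  proof (rule cut_inv_comparable[where f = fst and A = A and c = c])
    show "\<exists>e\<in>c. q \<in> cut_inv A (fst e)" if "q \<in> cut_inv A (fst a)" for q
      using ra that unfolding Inl_in_chain_inv[symmetric, of _ _ _ B] by (auto simp: sep_inv_def)
    show "\<exists>e\<in>c. q \<in> cut_inv A (fst e)" if "q \<in> cut_inv A (fst b)" for q
      using rb that unfolding Inl_in_chain_inv[symmetric, of _ _ _ B] by (auto simp: sep_inv_def)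
  qed (use segre_interiorD[OF ab(1)] segre_interiorD[OF ab(2)] cmp in \<open>unfold less_eq_prod_def, blast+\<close>)
  have 2: "snd a \<subseteq> snd b \<or> snd b \<subseteq> snd a"
  proof (rule cut_inv_comparable[where f = snd and A = B and c = c])
    show "\<exists>e\<in>c. q \<in> cut_inv B (snd e)" if "q \<in> cut_inv B (snd a)" for q
      using ra that unfolding Inr_in_chain_inv[symmetric, of _ _ _ A] by (auto simp: sep_inv_def)
    show "\<exists>e\<in>c. q \<in> cut_inv B (snd e)" if "q \<in> cut_inv B (snd b)" for q
      using rb that unfolding Inr_in_chain_inv[symmetric, of _ _ _ A] by (auto simp: sep_inv_def)
  qed (use segre_interiorD[OF ab(1)] segre_interiorD[OF ab(2)] cmp in \<open>unfold less_eq_prod_def, blast+\<close>)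
  show ?thesis using segre_interior_comparable[OF assms(1,2) ab 1 2] .
qed

lemma free_elems_toggle:
  assumes fin: "finite A" "finite B" and c: "c \<subseteq> segre_interior A B"
    and a: "a \<in> free_elems A B c" "a \<notin> c"
  shows "free_elems A B (insert a c) = free_elems A B c"
proof (rule Set.set_eqI)
  fix b
  have ra: "sep_inv A B a \<subseteq> chain_inv A B c" and ai: "a \<in> segre_interior A B"
    and ach: "is_chain (insert a c)"
    using a by (auto simp: free_elems_def)
  show "b \<in> free_elems A B (insert a c) \<longleftrightarrow> b \<in> free_elems A B c"
  proof (cases "b = a")
    case True
    then show ?thesis using a by (auto simp: free_elems_def)
  next
    case False
    show ?thesis
    proof
      assume b: "b \<in> free_elems A B (insert a c)"
      \<comment> \<open>Both \<open>a\<close> and \<open>b\<close> are redundant in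
        \<open>d\<close>, so \<open>b\<close> stays redundant when \<open>a\<close> is removed as
        well.\<close>
      define d where "d = insert b (insert a c)"
      have "sep_inv A B b \<subseteq> chain_inv A B (d - {b, a})"
      proof (rule redundant_pair[OF fin])
        show "is_chain d" "d \<subseteq> segre_interior A B" using b c ai by (auto simp: free_elems_def d_def)
        have "insert a c - {b} = d - {b}" by (auto simp: d_def)
        then show "sep_inv A B b \<subseteq> chain_inv A B (d - {b})" using b by (simp add: free_elems_def)
        show "sep_inv A B a \<subseteq> chain_inv A B (d - {a})"
          using ra chain_inv_mono[of c "d - {a}" A B] a False unfolding d_def by blast
      qed (use False in \<open>auto simp: d_def\<close>)
      moreover have "d - {b, a} = c - {b}" using a by (auto simp: d_def)
      ultimately show "b \<in> free_elems A B c"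
        using b is_chain_subset[of "insert b (insert a c)" "insert b c"]
        by (auto simp: free_elems_def)
    next
      assume b: "b \<in> free_elems A B c"
      have "a \<le> b \<or> b \<le> a" using free_elems_comparable[OF fin c a(1) b] .
      then have "is_chain (insert b (insert a c))"
        using b ach unfolding free_elems_def is_chain_def by auto
      moreover have "chain_inv A B (c - {b}) \<subseteq> chain_inv A B (insert a c - {b})"
        by (rule chain_inv_mono) auto
      ultimately show "b \<in> free_elems A B (insert a c)" using b by (auto simp: free_elems_def)
    qed
  qed
qed

lemma chain_inv_toggle:
  assumes "a \<in> free_elems A B c"
  shows "chain_inv A B (insert a c) = chain_inv A B c" "chain_inv A B (c - {a}) = chain_inv A B c"
proof -
  have "sep_inv A B a \<subseteq> chain_inv A B (c - {a})" using assms by (auto simp: free_elems_def)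
  moreover have "chain_inv A B c \<subseteq> sep_inv A B a \<union> chain_inv A B (c - {a})"
    by (auto simp: chain_inv_def)
  ultimately show 1: "chain_inv A B (c - {a}) = chain_inv A B c"
    using chain_inv_mono[of "c - {a}" c A B] by blast
  show "chain_inv A B (insert a c) = chain_inv A B c"
    using 1 \<open>sep_inv A B a \<subseteq> chain_inv A B (c - {a})\<close> by (auto simp: chain_inv_insert)
qed

text \<open>The choice is a function of the set of free elements alone, so chains with the same free
  elements have the same pivot.\<close>

definition pivot :: "nat set \<Rightarrow> nat set \<Rightarrow> (nat set \<times> nat set) set \<Rightarrow> nat set \<times> nat set" where
  "pivot A B c = (SOME x. x \<in> free_elems A B c)"

lemma free_elems_remove:
  assumes "finite A" "finite B" "c \<subseteq> segre_interior A B" "is_chain c" "a \<in> free_elems A B c"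
  shows "free_elems A B (c - {a}) = free_elems A B c"
proof (cases "a \<in> c")
  case True
  have "a \<in> free_elems A B (c - {a})" using assms True by (auto simp: free_elems_def insert_absorb)
  then have "free_elems A B (insert a (c - {a})) = free_elems A B (c - {a})"
    using assms by (intro free_elems_toggle) auto
  then show ?thesis using True by (simp add: insert_absorb)
qed auto

text \<open>Acyclicity of the matching. If deleting \<open>e\<close> lost no inversion,
  \<open>e\<close> itself would be free, so the deletion would not change the pivot, which would
  then still be a member of \<open>c - {e}\<close>.\<close>

lemma chain_inv_remove_less:
  assumes "finite A" "finite B" "c \<subseteq> segre_interior A B" "is_chain c" "e \<in> c"
    and "free_elems A B c \<noteq> {}" "pivot A B c \<in> c" "e \<noteq> pivot A B c"
    and "pivot A B (c - {e}) \<notin> c - {e}"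
  shows "card (chain_inv A B (c - {e})) < card (chain_inv A B c)"
proof (rule ccontr)
  assume neg: "\<not> ?thesis"
  have fin: "finite (chain_inv A B c)" using finite_chain_inv assms by blast
  have "chain_inv A B (c - {e}) \<subseteq> chain_inv A B c" by (rule chain_inv_mono) auto
  then have "chain_inv A B (c - {e}) = chain_inv A B c" using neg fin
    by (meson card_seteq not_le)
  then have "e \<in> free_elems A B c"
    using assms by (auto simp: free_elems_def insert_absorb) (auto simp: chain_inv_def)
  then have "pivot A B (c - {e}) = pivot A B c"
    using free_elems_remove[OF assms(1-4)] by (simp add: pivot_def)
  then show False using assms by auto
qed

lemma ex_max_finite:
  fixes f :: "'a \<Rightarrow> nat"
  assumes "finite S" "S \<noteq> {}"
  shows "\<exists>m\<in>S. \<forall>x\<in>S. f x \<le> f m"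
proof -
  have "Max (f ` S) \<in> f ` S" using assms by simp
  then obtain m where "m \<in> S" "f m = Max (f ` S)" by (metis imageE)
  then show ?thesis using assms by (metis Max_ge finite_imageI imageI)
qed

text \<open>At a gap of the chain, enlarge the neighbour \<open>l\<close> below it by the least
  elements \<open>s\<close>, \<open>t\<close> that the neighbour \<open>u\<close> above it adds. By
  minimality, an inversion of the new element that starts at \<open>s\<close> or \<open>t\<close> is
  separated by \<open>u\<close>; all others are separated by \<open>l\<close>.\<close>

lemma free_elems_nonempty:
  assumes fin: "finite A" "finite B" "card A = card B" and c: "c \<subseteq> segre_interior A B" "is_chain c"
    and r: "0 < r" "r < card A" "\<And>x. x \<in> c \<Longrightarrow> card (fst x) \<noteq> r"
  shows "free_elems A B c \<noteq> {}"
proof -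
  \<comment> \<open>Bottom and top guarantee neighbours on both sides of rank \<open>r\<close>. They
    separate no inversions, so a neighbour that separates one is a member of
    \<open>c\<close>.\<close>
  define D where "D = insert ({}, {}) (insert (A, B) c)"
  have finD: "finite D" using c fin finite_segre_interior finite_subset
    unfolding D_def by blast
  have Dp: "fst x \<subseteq> A" "snd x \<subseteq> B" "card (fst x) = card (snd x)" "card (fst x) \<noteq> r" if "x \<in> D" for x
    using that c(1) r(1,2) r(3)[of x] fin segre_interiorD[of x A B] unfolding D_def by auto
  have fx: "finite (fst x)" "finite (snd x)" if "x \<in> D" for x
    using Dp[OF that] fin finite_subset by blast+
  have Dch: "x \<le> y \<or> y \<le> x" if "x \<in> D" "y \<in> D" for x y
  proof -
    have "({}, {}) \<le> z" "z \<le> (A, B)" if "z \<in> D" for z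
      using Dp[OF that] by (auto simp: less_eq_prod_def)
    then show ?thesis using that c(2) unfolding D_def is_chain_def by blast
  qed
  have card_le: "x \<le> y" if "x \<in> D" "y \<in> D" "card (fst x) < card (fst y)" for x y
  proof -
    have "\<not> y \<le> x" using that fx card_mono[of "fst x" "fst y"] by (auto simp: less_eq_prod_def)
    then show ?thesis using Dch that by blast
  qed
  have card_eq: "x = y" if "x \<in> D" "y \<in> D" "card (fst x) = card (fst y)" for x y
  proof -
    have c2: "card (snd x) = card (snd y)" using that Dp by metis
    show ?thesis
      using Dch[OF that(1,2)]
    proof
      assume "x \<le> y"
      then show ?thesis using card_subset_eq[of "fst y" "fst x"] card_subset_eq[of "snd y" "snd x"]
          that(3) c2 fx[OF that(2)] by (auto simp: less_eq_prod_def intro!: prod_eqI)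
    next
      assume "y \<le> x"
      then show ?thesis using card_subset_eq[of "fst x" "fst y"] card_subset_eq[of "snd x" "snd y"]
          that(3) c2 fx[OF that(1)] by (auto simp: less_eq_prod_def intro!: prod_eqI)
    qed
  qed
  define L where "L = {x \<in> D. card (fst x) < r}"
  define U where "U = {x \<in> D. card (fst x) > r}"
  have "({}, {}) \<in> L" "(A, B) \<in> U" using r by (auto simp: L_def U_def D_def)
  then have ne: "L \<noteq> {}" "U \<noteq> {}" by blast+
  have finLU: "finite L" "finite U" using finD by (auto simp: L_def U_def)
  obtain l where l: "l \<in> L" "\<And>x. x \<in> L \<Longrightarrow> card (fst x) \<le> card (fst l)"
    using ex_max_finite[OF finLU(1) ne(1), of "\<lambda>x. card (fst x)"] by blast
  obtain u where u: "u \<in> U" "\<And>x. x \<in> U \<Longrightarrow> card (fst u) \<le> card (fst x)"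
    using ex_is_arg_min_if_finite[OF finLU(2) ne(2), of "\<lambda>x. card (fst x)"]
    unfolding is_arg_min_def by (metis not_less)
  have lD: "l \<in> D" "card (fst l) < r" and uD: "u \<in> D" "card (fst u) > r"
    using l u by (auto simp: L_def U_def)
  have lu: "fst l \<subseteq> fst u" "snd l \<subseteq> snd u" using card_le[OF lD(1) uD(1)] lD uD
    by (auto simp: less_eq_prod_def)
  have ne1: "fst u - fst l \<noteq> {}" "snd u - snd l \<noteq> {}"
    using lD uD lu Dp[OF lD(1)] Dp[OF uD(1)] by auto
  define s where "s = Min (fst u - fst l)"
  define t where "t = Min (snd u - snd l)"
  have s: "s \<in> fst u" "s \<notin> fst l" and smin: "\<And>v. v \<in> fst u \<Longrightarrow> v \<notin> fst l \<Longrightarrow> s \<le> v"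
    using Min_in[of "fst u - fst l"] Min_le[of "fst u - fst l"] ne1 fx[OF uD(1)] by (auto simp: s_def)
  have t: "t \<in> snd u" "t \<notin> snd l" and tmin: "\<And>v. v \<in> snd u \<Longrightarrow> v \<notin> snd l \<Longrightarrow> t \<le> v"
    using Min_in[of "snd u - snd l"] Min_le[of "snd u - snd l"] ne1 fx[OF uD(1)] by (auto simp: t_def)
  define x where "x = (insert s (fst l), insert t (snd l))"
  have cardx: "card (fst x) = Suc (card (fst l))" "card (snd x) = Suc (card (fst l))"
    using fx[OF lD(1)] s t Dp[OF lD(1)] by (auto simp: x_def)
  have xi: "x \<in> segre_interior A B"
    using cardx r lD s t Dp[OF lD(1)] Dp[OF uD(1)] by (auto simp: segre_interior_def x_def)
  have lx: "l \<le> x" and xu: "x \<le> u" using s t lu by (auto simp: x_def less_eq_prod_def)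
  \<comment> \<open>No member of \<open>D\<close> lies strictly between \<open>l\<close> and
    \<open>u\<close>, so \<open>x\<close>, which lies between them, is comparable to every
    member.\<close>
  have cmp: "e \<le> l \<or> u \<le> e" if "e \<in> D" for e
  proof -
    have "e \<in> L \<or> e \<in> U" using Dp(4)[OF that] that by (auto simp: L_def U_def)
    then consider "e \<in> L" | "e \<in> U" by blast
    then show ?thesis
    proof cases
      case 1
      show ?thesis
      proof (cases "card (fst e) = card (fst l)")
        case True
        have "e = l" using True that lD card_eq by blast
        then show ?thesis by simp
      next
        case False
        then show ?thesis using l(2)[OF 1] card_le[OF that lD(1)] by auto
      qed
    next
      case 2
      show ?thesis
      proof (cases "card (fst e) = card (fst u)")
        case True
        have "e = u" using True that uD card_eq by blast
        then show ?thesis by simp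
      next
        case False
        then show ?thesis using u(2)[OF 2] card_le[OF uD(1) that] by auto
      qed
    qed
  qed
  have "is_chain (insert x c)"
    unfolding is_chain_def
  proof (intro ballI)
    fix p q assume pq: "p \<in> insert x c" "q \<in> insert x c"
    have "e \<le> x \<or> x \<le> e" if "e \<in> c" for e
      using cmp[of e] that lx xu order_trans by (metis D_def insert_iff)
    then show "p \<le> q \<or> q \<le> p" using pq c(2) unfolding is_chain_def
      by (metis insertE order_refl)
  qed
  moreover have "sep_inv A B x \<subseteq> chain_inv A B (c - {x})"
  proof
    fix p assume p: "p \<in> sep_inv A B x"
    have inc: "e \<in> c - {x}" if "e \<in> D" "e \<noteq> ({}, {})" "e \<noteq> (A, B)" "e \<in> {l, u}" for e
    proof -
      have "l \<noteq> x" using s(2) unfolding x_def by (metis fst_conv insertI1)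
      moreover have "u \<noteq> x"
      proof
        assume "u = x"
        then show False using cardx(1) lD(2) uD(2) by simp
      qed
      ultimately show ?thesis using that by (auto simp: D_def)
    qed
    show "p \<in> chain_inv A B (c - {x})"
    proof (cases p)
      case (Inl q)
      then obtain v w where q: "q = (v, w)" "v \<in> fst x" "w \<in> A" "w \<notin> fst x" "w < v"
        using p by (auto simp: sep_inv_def cut_inv_def)
      show ?thesis
      proof (cases "v = s")
        case True
        then have "w \<notin> fst u" using smin[of w] q by (auto simp: x_def)
        then have "u \<noteq> (A, B)" using q by auto
        moreover have "u \<noteq> ({}, {})" using s by auto
        ultimately have "u \<in> c - {x}" using inc uD(1) by simp
        then show ?thesis using Inl q s True \<open>w \<notin> fst u\<close>
          by (auto simp: Inl_in_chain_inv cut_inv_def)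
      next
        case False
        then have "v \<in> fst l" "w \<notin> fst l" using q by (auto simp: x_def)
        moreover from this have "l \<noteq> (A, B)" "l \<noteq> ({}, {})" using q by auto
        ultimately have "l \<in> c - {x}" using inc lD(1) by simp
        then show ?thesis using Inl q \<open>v \<in> fst l\<close> \<open>w \<notin> fst l\<close>
          by (auto simp: Inl_in_chain_inv cut_inv_def)
      qed
    next
      case (Inr q)
      then obtain v w where q: "q = (v, w)" "v \<in> snd x" "w \<in> B" "w \<notin> snd x" "w < v"
        using p by (auto simp: sep_inv_def cut_inv_def)
      show ?thesis
      proof (cases "v = t")
        case True
        then have "w \<notin> snd u" using tmin[of w] q by (auto simp: x_def)
        then have "u \<noteq> (A, B)" using q by auto
        moreover have "u \<noteq> ({}, {})" using t by auto
        ultimately have "u \<in> c - {x}" using inc uD(1) by simp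
        then show ?thesis using Inr q t True \<open>w \<notin> snd u\<close>
          by (auto simp: Inr_in_chain_inv cut_inv_def)
      next
        case False
        then have "v \<in> snd l" "w \<notin> snd l" using q by (auto simp: x_def)
        moreover from this have "l \<noteq> (A, B)" "l \<noteq> ({}, {})" using q by auto
        ultimately have "l \<in> c - {x}" using inc lD(1) by simp
        then show ?thesis using Inr q \<open>v \<in> snd l\<close> \<open>w \<notin> snd l\<close>
          by (auto simp: Inr_in_chain_inv cut_inv_def)
      qed
    qed
  qed
  ultimately have "x \<in> free_elems A B c" using xi by (auto simp: free_elems_def)
  then show ?thesis by blast
qed

section \<open>Exactness below the top degree\<close>

lemma sorted_wrt_less_set_inject:
  fixes xs ys :: "'a::order list"
  assumes "sorted_wrt (<) xs" "sorted_wrt (<) ys" "set xs = set ys"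
  shows "xs = ys"
  using assms
proof (induction xs arbitrary: ys)
  case (Cons x xs)
  then obtain y ys' where ys: "ys = y # ys'" by (cases ys) auto
  have "x = y"
  proof (rule ccontr)
    assume "x \<noteq> y"
    then have "x \<in> set ys'" "y \<in> set xs" using Cons.prems(3) ys by auto
    then have "y < x" "x < y" using Cons.prems ys by auto
    then show False by auto
  qed
  moreover have "x \<notin> set xs" "y \<notin> set ys'" using Cons.prems ys by auto
  ultimately have "set xs = set ys'" using Cons.prems(3) ys by (metis insert_ident list.simps(15))
  then show ?case using Cons ys \<open>x = y\<close> by auto
qed simp

lemma sorted_wrt_less_distinct: "sorted_wrt (<) (xs :: 'a::order list) \<Longrightarrow> distinct xs"
  by (induction xs) auto

lemma ex_sorted_list_of_chain:
  assumes "finite c" "is_chain c"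
  shows "\<exists>xs. sorted_wrt (<) xs \<and> set xs = c"
  using assms
proof (induction "card c" arbitrary: c)
  case 0
  then show ?case by (intro exI[of _ "[]"]) auto
next
  case (Suc k)
  then have "c \<noteq> {}" by auto
  then obtain m where m: "m \<in> c" "\<And>x. x \<in> c \<Longrightarrow> m \<le> x \<Longrightarrow> m = x"
    using finite_has_maximal[OF Suc.prems(1)] by metis
  have lt: "x < m" if "x \<in> c - {m}" for x
    using m that Suc.prems(2) by (auto simp: is_chain_def less_le)
  have "card (c - {m}) = k" using Suc m by simp
  then obtain xs where "sorted_wrt (<) xs" "set xs = c - {m}"
    using Suc.hyps(1)[of "c - {m}"] Suc.prems is_chain_subset[of c "c - {m}"] by auto
  then show ?case using lt m by (intro exI[of _ "xs @ [m]"]) (auto simp: sorted_wrt_append)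
qed

definition chain_list :: "'a::order set \<Rightarrow> 'a list" where
  "chain_list c = (THE xs. sorted_wrt (<) xs \<and> set xs = c)"

lemma chain_list:
  assumes "finite c" "is_chain c"
  shows "sorted_wrt (<) (chain_list c)" "set (chain_list c) = c" "length (chain_list c) = card c"
proof -
  have "\<exists>!xs. sorted_wrt (<) xs \<and> set xs = c"
    using ex_sorted_list_of_chain[OF assms] sorted_wrt_less_set_inject by blast
  from theI'[OF this] show 1: "sorted_wrt (<) (chain_list c)" "set (chain_list c) = c"
    by (auto simp: chain_list_def)
  then show "length (chain_list c) = card c"
    using distinct_card[OF sorted_wrt_less_distinct[OF 1(1)]] by simp
qed

lemma chain_list_set: "sorted_wrt (<) xs \<Longrightarrow> chain_list (set xs) = xs"
  unfolding chain_list_def by (rule the_equality) (auto intro: sorted_wrt_less_set_inject)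

lemma is_chain_set_sorted: "sorted_wrt (<) xs \<Longrightarrow> is_chain (set xs)"
  by (induction xs) (auto simp: is_chain_def less_imp_le)

definition delete_nth :: "nat \<Rightarrow> 'a list \<Rightarrow> 'a list" where
  "delete_nth i xs = take i xs @ drop (Suc i) xs"

text \<open>The boundary operator as a matrix: the incidence number of a simplex and a face.\<close>

definition face_coeff :: "'a list \<Rightarrow> 'a list \<Rightarrow> complex" where
  "face_coeff xs ys = (\<Sum>i<length xs. if delete_nth i xs = ys then (-1) ^ i else 0)"

lemma length_delete_nth: "i < length xs \<Longrightarrow> length (delete_nth i xs) = length xs - 1"
  by (auto simp: delete_nth_def)

lemma delete_nth_delete_nth:
  assumes "i \<le> j" "Suc j < length xs"
  shows "delete_nth j (delete_nth i xs) = delete_nth i (delete_nth (Suc j) xs)"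
  using assms by (intro nth_equalityI) (auto simp: delete_nth_def nth_append min_def)

lemma set_delete_nth:
  assumes "distinct xs" "i < length xs"
  shows "set (delete_nth i xs) = set xs - {xs ! i}"
proof -
  have "xs = take i xs @ xs ! i # drop (Suc i) xs" using assms by (simp add: id_take_nth_drop)
  then have "distinct (take i xs @ xs ! i # drop (Suc i) xs)"
    "set xs = set (take i xs @ xs ! i # drop (Suc i) xs)" using assms by metis+
  then show ?thesis by (auto simp: delete_nth_def)
qed

lemma sorted_wrt_delete_nth:
  assumes "sorted_wrt P xs"
  shows "sorted_wrt P (delete_nth i xs)"
proof -
  have "sorted_wrt P (take i xs @ drop i xs)" using assms by simp
  moreover have "set (drop (Suc i) xs) \<subseteq> set (drop i xs)" by (simp add: set_drop_subset_set_drop)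
  ultimately show ?thesis
    using sorted_wrt_drop[OF assms, of "Suc i"] unfolding delete_nth_def sorted_wrt_append by blast
qed

text \<open>The entries are distinct, so exactly one position yields the face and no signs
  cancel.\<close>

lemma face_coeff_nonzero_iff:
  fixes xs ys :: "'a::order list"
  assumes "sorted_wrt (<) xs"
  shows "face_coeff xs ys \<noteq> 0 \<longleftrightarrow> (\<exists>e\<in>set xs. sorted_wrt (<) ys \<and> set ys = set xs - {e})"
proof
  assume "face_coeff xs ys \<noteq> 0"
  then obtain i where "i < length xs" "delete_nth i xs = ys"
    unfolding face_coeff_def using sum.not_neutral_contains_not_neutral[of _ "{..<length xs}"]
    by (smt (verit) lessThan_iff)
  then show "\<exists>e\<in>set xs. sorted_wrt (<) ys \<and> set ys = set xs - {e}"
    using set_delete_nth[OF sorted_wrt_less_distinct[OF assms], of i]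
      sorted_wrt_delete_nth[OF assms, of i] nth_mem[of i xs] by blast
next
  assume "\<exists>e\<in>set xs. sorted_wrt (<) ys \<and> set ys = set xs - {e}"
  then obtain e where e: "e \<in> set xs" "sorted_wrt (<) ys" "set ys = set xs - {e}" by blast
  have d: "distinct xs" using sorted_wrt_less_distinct assms by blast
  obtain i where i: "i < length xs" "xs ! i = e" using e by (auto simp: in_set_conv_nth)
  have eq: "delete_nth j xs = ys \<longleftrightarrow> j = i" if "j < length xs" for j
  proof
    assume "j = i"
    then show "delete_nth j xs = ys"
      using sorted_wrt_less_set_inject[OF sorted_wrt_delete_nth[OF assms] e(2)]
        set_delete_nth[OF d that] i e by auto
  next
    assume "delete_nth j xs = ys"
    then have "set xs - {xs ! j} = set xs - {e}" using set_delete_nth[OF d that] e by simp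
    then have "xs ! j = e" using e nth_mem[OF that] by blast
    then show "j = i" using d i that nth_eq_iff_index_eq by blast
  qed
  have "face_coeff xs ys = (\<Sum>j<length xs. if j = i then (-1) ^ j else 0)"
    unfolding face_coeff_def by (rule sum.cong) (auto simp: eq)
  then show "face_coeff xs ys \<noteq> 0" using i by simp
qed

text \<open>The boundary of a boundary vanishes: deleting position \<open>i\<close> and then
  \<open>j \<ge> i\<close> has the same result as deleting \<open>Suc j\<close> and then
  \<open>i\<close>, with the opposite sign.\<close>

lemma face_coeff_delete_nth_sum:
  "(\<Sum>i<length xs. (-1) ^ i * face_coeff (delete_nth i xs) ys) = 0"
proof (cases "length xs")
  case (Suc m)
  let ?g = "\<lambda>i j. if delete_nth j (delete_nth i xs) = ys then (-1) ^ (i + j) else (0::complex)"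
  have "(\<Sum>i<length xs. (-1) ^ i * face_coeff (delete_nth i xs) ys) = (\<Sum>i<Suc m. \<Sum>j<m. ?g i j)"
    unfolding Suc face_coeff_def
    by (rule sum.cong) (auto simp: length_delete_nth Suc sum_distrib_left power_add intro!: sum.cong)
  also have "\<dots> = (\<Sum>(i, j)\<in>{..<Suc m} \<times> {..<m}. ?g i j)" by (simp add: sum.cartesian_product)
  also have "{..<Suc m} \<times> {..<m} = {(i, j). i \<le> j \<and> j < m} \<union> {(i, j). j < i \<and> i \<le> m}" (is "_ = ?U \<union> ?V")
    by auto
  also have "(\<Sum>(i, j)\<in>?U \<union> ?V. ?g i j) = (\<Sum>(i, j)\<in>?U. ?g i j) + (\<Sum>(i, j)\<in>?V. ?g i j)"
  proof (rule sum.union_disjoint)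
    show "finite ?U" by (rule finite_subset[of _ "{..m} \<times> {..m}"]) auto
    show "finite ?V" by (rule finite_subset[of _ "{..m} \<times> {..m}"]) auto
  qed auto
  also have "(\<Sum>(i, j)\<in>?V. ?g i j) = (\<Sum>(i, j)\<in>?U. - ?g i j)"
    by (rule sum.reindex_bij_witness[of _ "\<lambda>(i, j). (Suc j, i)" "\<lambda>(i, j). (j, i - 1)"])
      (auto simp: Suc delete_nth_delete_nth gr0_conv_Suc add.commute elim!: less_natE)
  also have "(\<Sum>(i, j)\<in>?U. - ?g i j) = - (\<Sum>(i, j)\<in>?U. ?g i j)"
    by (simp add: sum_negf split_def)
  finally show ?thesis by simp
qed (simp add: face_coeff_def)

lemma face_coeff_comp:
  assumes "finite X" "\<And>i. i < length y \<Longrightarrow> delete_nth i y \<in> X"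
  shows "(\<Sum>x\<in>X. face_coeff y x * face_coeff x w) = 0"
proof -
  have "(\<Sum>x\<in>X. face_coeff y x * face_coeff x w)
    = (\<Sum>i<length y. \<Sum>x\<in>X. if delete_nth i y = x then (-1) ^ i * face_coeff x w else 0)"
    unfolding face_coeff_def[of y]
    by (subst sum.swap) (auto simp: sum_distrib_right intro!: sum.cong)
  also have "\<dots> = (\<Sum>i<length y. (-1) ^ i * face_coeff (delete_nth i y) w)"
    using assms by (intro sum.cong) auto
  finally show ?thesis using face_coeff_delete_nth_sum by simp
qed

section \<open>Linear algebra of acyclic matchings\<close>

lemma triangular_eliminate:
  fixes d :: "'y \<Rightarrow> 'x \<Rightarrow> complex" and rk :: "'x \<Rightarrow> nat"
  assumes fin: "finite Up" "finite Y"
    and u: "\<And>c. c \<in> Up \<Longrightarrow> u c \<in> Y" "\<And>c. c \<in> Up \<Longrightarrow> d (u c) c \<noteq> 0"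
    and tri: "\<And>c c'. c \<in> Up \<Longrightarrow> c' \<in> Up \<Longrightarrow> c' \<noteq> c \<Longrightarrow> d (u c) c' \<noteq> 0 \<Longrightarrow> rk c' < rk c"
  shows "\<exists>y. \<forall>c\<in>Up. z c = (\<Sum>y'\<in>Y. y y' * d y' c)"
proof -
  \<comment> \<open>Sorted by \<open>rk\<close>, the matrix \<open>d (u c) c'\<close> on
    \<open>Up\<close> is triangular with nonzero diagonal. Back substitution is an induction on a
    bound \<open>N\<close> for the ranks in the support of \<open>z\<close>.\<close>
  have "\<exists>y. \<forall>c\<in>Up. z c = (\<Sum>y'\<in>Y. y y' * d y' c)" if "\<And>c. c \<in> Up \<Longrightarrow> z c \<noteq> 0 \<Longrightarrow> rk c < N" for N z
    using that
  proof (induction N arbitrary: z)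
    case 0
    then have "\<forall>c\<in>Up. z c = (\<Sum>y'\<in>Y. 0 * d y' c)" by auto
    then show ?case by (intro exI[of _ "\<lambda>_. 0"])
  next
    case (Suc N)
    define K where "K = {c \<in> Up. rk c = N}"
    \<comment> \<open>Clears the layer of rank \<open>N\<close>; by triangularity it disturbs only
      lower ranks.\<close>
    define y0 where "y0 y' = (\<Sum>c\<in>K. if u c = y' then z c / d (u c) c else 0)" for y'
    have K: "finite K" "K \<subseteq> Up" using fin by (auto simp: K_def)
    have dy0: "(\<Sum>y'\<in>Y. y0 y' * d y' x) = (\<Sum>c\<in>K. z c / d (u c) c * d (u c) x)" for x
    proof -
      have "(\<Sum>y'\<in>Y. y0 y' * d y' x)
        = (\<Sum>c\<in>K. \<Sum>y'\<in>Y. if u c = y' then z c / d (u c) c * d y' x else 0)"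
        unfolding y0_def
        by (subst sum.swap) (auto simp: sum_distrib_right intro!: sum.cong)
      also have "\<dots> = (\<Sum>c\<in>K. z c / d (u c) c * d (u c) x)"
        using u K fin by (intro sum.cong) auto
      finally show ?thesis .
    qed
    define z' where "z' x = z x - (\<Sum>y'\<in>Y. y0 y' * d y' x)" for x
    have "rk c < N" if c: "c \<in> Up" "z' c \<noteq> 0" for c
    proof (rule ccontr)
      assume "\<not> rk c < N"
      have off: "d (u c') c = 0" if "c' \<in> K" "c' \<noteq> c" for c'
        using tri[of c' c] that c \<open>\<not> rk c < N\<close> by (auto simp: K_def)
      show False
      proof (cases "c \<in> K")
        case True
        have "(\<Sum>c'\<in>K. z c' / d (u c') c' * d (u c') c) = (\<Sum>c'\<in>{c}. z c' / d (u c') c' * d (u c') c)"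
          using K off True by (intro sum.mono_neutral_right) auto
        then show False using c u by (simp add: z'_def dy0)
      next
        case False
        have "(\<Sum>c'\<in>K. z c' / d (u c') c' * d (u c') c) = 0"
          using off False by (intro sum.neutral) auto
        moreover have "rk c > N" using False c \<open>\<not> rk c < N\<close> by (auto simp: K_def)
        then have "z c = 0" using Suc.prems[OF c(1)] by fastforce
        ultimately show False using c by (simp add: z'_def dy0)
      qed
    qed
    from Suc.IH[of z', OF this] obtain y1 where y1: "\<forall>c\<in>Up. z' c = (\<Sum>y'\<in>Y. y1 y' * d y' c)"
      by blast
    have "\<forall>c\<in>Up. z c = (\<Sum>y'\<in>Y. (y1 y' + y0 y') * d y' c)"
      using y1 by (auto simp: z'_def algebra_simps sum.distrib)
    then show ?case by (intro exI[of _ "\<lambda>y'. y1 y' + y0 y'"])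
  qed
  moreover have "rk c < Suc (Max (rk ` Up))" if "c \<in> Up" for c
    using that fin by (simp add: le_imp_less_Suc)
  ultimately show ?thesis by blast
qed

text \<open>Let \<open>m\<close> have the largest rank in the support of a nonzero \<open>z\<close>.
  By triangularity no other member of the support reaches \<open>v m\<close>, so the boundary of
  \<open>z\<close> is nonzero there.\<close>

lemma triangular_kernel:
  fixes d :: "'x \<Rightarrow> 'w \<Rightarrow> complex" and rk :: "'x \<Rightarrow> nat"
  assumes fin: "finite Dn" and v: "\<And>x. x \<in> Dn \<Longrightarrow> d x (v x) \<noteq> 0"
    and tri: "\<And>x x'. x \<in> Dn \<Longrightarrow> x' \<in> Dn \<Longrightarrow> x \<noteq> x' \<Longrightarrow> d x (v x') \<noteq> 0 \<Longrightarrow> rk x' < rk x"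
    and cyc: "\<And>w. (\<Sum>x\<in>Dn. z x * d x w) = 0" and x: "x \<in> Dn"
  shows "z x = 0"
proof (rule ccontr)
  assume "z x \<noteq> 0"
  then have ne: "{x \<in> Dn. z x \<noteq> 0} \<noteq> {}" using x by blast
  obtain m where m: "m \<in> Dn" "z m \<noteq> 0" "\<And>x'. x' \<in> Dn \<Longrightarrow> z x' \<noteq> 0 \<Longrightarrow> rk x' \<le> rk m"
    using ex_max_finite[OF _ ne, of rk] fin by auto
  have "(\<Sum>x'\<in>Dn. z x' * d x' (v m)) = (\<Sum>x'\<in>{m}. z x' * d x' (v m))"
  proof (rule sum.mono_neutral_right)
    show "\<forall>i\<in>Dn - {m}. z i * d i (v m) = 0"
      using tri[OF _ m(1)] m(3) by (fastforce simp: not_less[symmetric])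
  qed (use fin m in auto)
  then show False using cyc[of "v m"] v[OF m(1)] m by simp
qed

text \<open>Discrete Morse theory without critical cells in \<open>X\<close>: every cell is matched
  upwards by \<open>u\<close> or downwards by \<open>v\<close>. Subtracting a boundary clears
  \<open>z\<close> on \<open>Up\<close>; what remains is a cycle supported on \<open>X - Up\<close>,
  hence zero.\<close>

lemma matching_exact:
  fixes d :: "'x \<Rightarrow> 'x \<Rightarrow> complex" and rk :: "'x \<Rightarrow> nat"
  assumes fin: "finite X" "finite Y" and Up: "Up \<subseteq> X"
    and dd: "\<And>y w. y \<in> Y \<Longrightarrow> (\<Sum>x\<in>X. d y x * d x w) = 0"
    and u: "\<And>c. c \<in> Up \<Longrightarrow> u c \<in> Y" "\<And>c. c \<in> Up \<Longrightarrow> d (u c) c \<noteq> 0"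
    and tri: "\<And>c c'. c \<in> Up \<Longrightarrow> c' \<in> Up \<Longrightarrow> c' \<noteq> c \<Longrightarrow> d (u c) c' \<noteq> 0 \<Longrightarrow> rk c' < rk c"
    and v: "\<And>x. x \<in> X - Up \<Longrightarrow> d x (v x) \<noteq> 0"
    and tri': "\<And>x x'. x \<in> X - Up \<Longrightarrow> x' \<in> X - Up \<Longrightarrow> x \<noteq> x' \<Longrightarrow> d x (v x') \<noteq> 0 \<Longrightarrow> rk x' < rk x"
    and cyc: "\<And>w. (\<Sum>x\<in>X. z x * d x w) = 0"
  shows "\<exists>y. \<forall>x\<in>X. z x = (\<Sum>y'\<in>Y. y y' * d y' x)"
proof -
  obtain y where y: "\<And>c. c \<in> Up \<Longrightarrow> z c = (\<Sum>y'\<in>Y. y y' * d y' c)"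
    using triangular_eliminate[where rk = rk and d = d and u = u and z = z,
        OF finite_subset[OF Up fin(1)] fin(2) u tri] by blast
  define z' where "z' x = z x - (\<Sum>y'\<in>Y. y y' * d y' x)" for x
  have "z' x = 0" if "x \<in> X - Up" for x
  proof (rule triangular_kernel[where rk = rk and d = d and v = v and z = z', OF _ v tri' _ that])
    fix w
    have "(\<Sum>x\<in>X - Up. z' x * d x w) = (\<Sum>x\<in>X. z' x * d x w)"
      using fin y by (intro sum.mono_neutral_left) (auto simp: z'_def)
    also have "\<dots> = (\<Sum>x\<in>X. z x * d x w) - (\<Sum>x\<in>X. \<Sum>y'\<in>Y. y y' * (d y' x * d x w))"
      by (simp add: z'_def left_diff_distrib sum_subtractf sum_distrib_right mult.assoc)
    also have "(\<Sum>x\<in>X. \<Sum>y'\<in>Y. y y' * (d y' x * d x w)) = 0"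
      by (subst sum.swap) (simp add: sum_distrib_left[symmetric] dd)
    finally show "(\<Sum>x\<in>X - Up. z' x * d x w) = 0" by (simp add: cyc)
  qed (use fin in auto)
  then have "\<forall>x\<in>X. z x = (\<Sum>y'\<in>Y. y y' * d y' x)" using y by (fastforce simp: z'_def)
  then show ?thesis by blast
qed

section \<open>Exactness for chains of the Segre interior\<close>

definition segre_chains :: "nat set \<Rightarrow> nat set \<Rightarrow> (nat set \<times> nat set) list set" where
  "segre_chains A B = {xs. sorted_wrt (<) xs \<and> set xs \<subseteq> segre_interior A B}"

lemma card_fst_inj_on_chain:
  assumes "finite A" "finite B" "c \<subseteq> segre_interior A B" "is_chain c"
  shows "inj_on (\<lambda>x. card (fst x)) c" "(\<lambda>x. card (fst x)) ` c \<subseteq> {1..<card A}"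
proof -
  show "inj_on (\<lambda>x. card (fst x)) c"
  proof (rule inj_onI, rule ccontr)
    fix x y assume "x \<in> c" "y \<in> c" "card (fst x) = card (fst y)" "x \<noteq> y"
    moreover from this have "x < y \<or> y < x" using assms by (auto simp: is_chain_def less_le)
    ultimately show False using segre_interior_less(3)[OF assms(1,2)] assms(3)
      by (metis less_irrefl subsetD)
  qed
  show "(\<lambda>x. card (fst x)) ` c \<subseteq> {1..<card A}"
    using segre_interiorD assms(3) by (fastforce simp: Suc_le_eq)
qed

lemma length_segre_chain:
  assumes "finite A" "finite B" "xs \<in> segre_chains A B"
  shows "length xs \<le> card A - 1"
proof -
  have inj: "inj_on (\<lambda>x. card (fst x)) (set xs)" and ran: "(\<lambda>x. card (fst x)) ` set xs \<subseteq> {1..<card A}"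
    using card_fst_inj_on_chain[of A B "set xs"] is_chain_set_sorted[of xs] assms
    by (auto simp: segre_chains_def)
  have "length xs = card (set xs)"
    using assms sorted_wrt_less_distinct[of xs] by (simp add: segre_chains_def distinct_card)
  also have "\<dots> = card ((\<lambda>x. card (fst x)) ` set xs)"
    using inj by (simp add: card_image)
  also have "\<dots> \<le> card {1..<card A}"
    using ran by (intro card_mono) auto
  finally show ?thesis by simp
qed

lemma finite_segre_chains:
  assumes "finite A" "finite B"
  shows "finite (segre_chains A B)"
proof (rule finite_subset)
  show "segre_chains A B \<subseteq> {xs. set xs \<subseteq> segre_interior A B \<and> length xs \<le> card A - 1}"
    using length_segre_chain[OF assms] by (auto simp: segre_chains_def)
qed (use assms finite_segre_interior finite_lists_length_le in auto)

text \<open>Pigeonhole: fewer than \<open>card A - 1\<close> members cannot occupy all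
  ranks.\<close>

lemma free_elems_nonempty_short:
  assumes fin: "finite A" "finite B" "card A = card B" and xs: "xs \<in> segre_chains A B"
    and l: "Suc (length xs) < card A"
  shows "free_elems A B (set xs) \<noteq> {}"
proof -
  let ?R = "(\<lambda>x. card (fst x)) ` set xs"
  have "card ?R \<le> card (set xs)" by (simp add: card_image_le)
  also have "\<dots> \<le> length xs" by (rule card_length)
  also have "\<dots> < card {1..<card A}" using l by simp
  finally have "\<not> {1..<card A} \<subseteq> ?R" by (meson List.finite_set card_mono finite_imageI not_le)
  then obtain r where "r \<in> {1..<card A}" "r \<notin> ?R" by blast
  then show ?thesis
    using xs by (intro free_elems_nonempty[OF fin, of _ r]) (auto simp: segre_chains_def is_chain_set_sorted)
qed

text \<open>Below the top length every chain has a free element, so the pivot matches all of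
  \<open>X\<close>: upwards if it is absent from the chain, downwards if it is present. The number
  of separated inversions serves as rank because toggling the pivot preserves it.\<close>

lemma segre_chains_exact:
  assumes fin: "finite A" "finite B" "card A = card B" and l: "Suc l < card A"
    and X: "X = {xs \<in> segre_chains A B. length xs = l}"
    and Y: "Y = {xs \<in> segre_chains A B. length xs = Suc l}"
    and cyc: "\<And>w. (\<Sum>x\<in>X. z x * face_coeff x w) = 0"
  shows "\<exists>y. \<forall>x\<in>X. z x = (\<Sum>y'\<in>Y. y y' * face_coeff y' x)"
proof -
  define p where "p xs = pivot A B (set xs)" for xs
  define Up where "Up = {xs \<in> X. p xs \<notin> set xs}"
  define u where "u xs = chain_list (insert (p xs) (set xs))" for xs
  define v where "v xs = chain_list (set xs - {p xs})" for xs
  define rk where "rk xs = card (chain_inv A B (set xs))" for xs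
  have finX: "finite X" "finite Y" using finite_segre_chains[OF fin(1,2)] X Y by auto
  have srt: "sorted_wrt (<) xs" "set xs \<subseteq> segre_interior A B" "is_chain (set xs)"
    if "xs \<in> X" for xs using that is_chain_set_sorted[of xs] by (auto simp: X segre_chains_def)
  have ne: "free_elems A B (set xs) \<noteq> {}" if "xs \<in> X" for xs
    using free_elems_nonempty_short[OF fin, of xs] that l by (auto simp: X)
  have pf: "p xs \<in> free_elems A B (set xs)" if "xs \<in> X" for xs
    using ne[OF that] by (auto simp: p_def pivot_def intro: someI)
  have chi: "is_chain (insert (p xs) (set xs))" "p xs \<in> segre_interior A B" if "xs \<in> X" for xs
    using pf[OF that] by (auto simp: free_elems_def)
  have us: "sorted_wrt (<) (u xs)" "set (u xs) = insert (p xs) (set xs)"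
    "length (u xs) = card (insert (p xs) (set xs))" if "xs \<in> X" for xs
    using chain_list[OF _ chi(1)[OF that]] by (auto simp: u_def)
  have vs: "sorted_wrt (<) (v xs)" "set (v xs) = set xs - {p xs}" if "xs \<in> X" for xs
    using chain_list[OF _ is_chain_subset[OF srt(3)[OF that], of "set xs - {p xs}"]]
    by (auto simp: v_def)
  have pu: "pivot A B (insert (p xs) (set xs)) = p xs" if "xs \<in> Up" for xs
    using free_elems_toggle[OF fin(1,2) srt(2) pf, of xs] that
    by (simp add: Up_def p_def pivot_def)
  have pv: "pivot A B (set xs - {p xs}) = p xs" if "xs \<in> X" for xs
    using free_elems_remove[OF fin(1,2) srt(2) srt(3) pf, of xs] that
    by (simp add: p_def pivot_def)
  show ?thesis
  proof (rule matching_exact[OF finX, of Up face_coeff u rk v])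
    show "Up \<subseteq> X" by (auto simp: Up_def)
    show "(\<Sum>x\<in>X. face_coeff y x * face_coeff x w) = 0" if y: "y \<in> Y" for y w
    proof (rule face_coeff_comp[OF finX(1)])
      fix i assume "i < length y"
      then show "delete_nth i y \<in> X"
        using y sorted_wrt_delete_nth[of "(<)" y i] set_delete_nth[of y i]
          sorted_wrt_less_distinct[of y] length_delete_nth[of i y]
        by (auto simp: X Y segre_chains_def)
    qed
    show "u c \<in> Y" "face_coeff (u c) c \<noteq> 0" if c: "c \<in> Up" for c
    proof -
      have cX: "c \<in> X" "p c \<notin> set c" using c by (auto simp: Up_def)
      have "card (set c) = l" using cX sorted_wrt_less_distinct[OF srt(1)[OF cX(1)]]
        by (auto simp: X distinct_card)
      then show "u c \<in> Y" using us[OF cX(1)] cX chi[OF cX(1)] srt[OF cX(1)]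
        by (auto simp: Y segre_chains_def)
      show "face_coeff (u c) c \<noteq> 0"
        using face_coeff_nonzero_iff[OF us(1)[OF cX(1)], of c] us(2)[OF cX(1)] cX srt[OF cX(1)] by auto
    qed
    show "rk c' < rk c" if c: "c \<in> Up" "c' \<in> Up" "c' \<noteq> c" "face_coeff (u c) c' \<noteq> 0" for c c'
    proof -
      have cX: "c \<in> X" "p c \<notin> set c" "c' \<in> X" "p c' \<notin> set c'" using c by (auto simp: Up_def)
      let ?d = "insert (p c) (set c)"
      obtain e where e: "e \<in> ?d" "set c' = ?d - {e}"
        using c(4) unfolding face_coeff_nonzero_iff[OF us(1)[OF cX(1)]] us(2)[OF cX(1)] by blast
      have "e \<noteq> p c"
      proof
        assume "e = p c"
        then have "set c' = set c" using e cX by auto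
        then show False using sorted_wrt_less_set_inject[OF srt(1)[OF cX(3)] srt(1)[OF cX(1)]] c(3) by simp
      qed
      \<comment> \<open>\<open>c'\<close> lacks its pivot and arises from \<open>?d\<close> by
        deleting a member other than the pivot, so an inversion is lost, whereas adding the pivot to
        \<open>c\<close> gained none.\<close>
      have "card (chain_inv A B (?d - {e})) < card (chain_inv A B ?d)"
      proof (rule chain_inv_remove_less[OF fin(1,2) _ chi(1)[OF cX(1)] e(1)])
        show "?d \<subseteq> segre_interior A B" using chi srt cX by auto
        show "free_elems A B ?d \<noteq> {}"
          using free_elems_toggle[OF fin(1,2) srt(2) pf, of c] cX ne by auto
        show "pivot A B (?d - {e}) \<notin> ?d - {e}" using e cX by (simp add: p_def)
      qed (use pu[OF c(1)] \<open>e \<noteq> p c\<close> in auto)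
      then show ?thesis using e chain_inv_toggle(1)[OF pf[OF cX(1)]] by (simp add: rk_def)
    qed
    have dn: "x \<in> X" "p x \<in> set x" if "x \<in> X - Up" for x using that by (auto simp: Up_def)
    show "face_coeff x (v x) \<noteq> 0" if "x \<in> X - Up" for x
      using face_coeff_nonzero_iff[OF srt(1)] dn[OF that] vs by auto
    show "rk x' < rk x" if x: "x \<in> X - Up" "x' \<in> X - Up" "x \<noteq> x'" "face_coeff x (v x') \<noteq> 0" for x x'
    proof -
      note xX = dn[OF x(1)] dn[OF x(2)]
      obtain e where e: "e \<in> set x" "set x' - {p x'} = set x - {e}"
        using x(4) unfolding face_coeff_nonzero_iff[OF srt(1)[OF xX(1)]] vs(2)[OF xX(3)] by blast
      have "e \<noteq> p x"
      proof
        assume "e = p x"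
        then have "set x' - {p x'} = set x - {p x}" using e by auto
        \<comment> \<open>Removing the pivot keeps the free elements, so the remainder determines
          the pivot and thereby the whole chain.\<close>
        then have "p x' = p x" using pv[OF xX(1)] pv[OF xX(3)] by simp
        then have "set x' = set x"
          using \<open>set x' - {p x'} = set x - {p x}\<close> insert_Diff[OF xX(2)] insert_Diff[OF xX(4)] by metis
        then show False using sorted_wrt_less_set_inject[OF srt(1)[OF xX(3)] srt(1)[OF xX(1)]] x(3) by simp
      qed
      have "card (chain_inv A B (set x - {e})) < card (chain_inv A B (set x))"
      proof (rule chain_inv_remove_less[OF fin(1,2) srt(2,3)[OF xX(1)] e(1) ne[OF xX(1)]])
        show "pivot A B (set x - {e}) \<notin> set x - {e}" using pv[OF xX(3)] e(2) by auto
      qed (use xX \<open>e \<noteq> p x\<close> in \<open>auto simp: p_def\<close>)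
      then show ?thesis using chain_inv_toggle(2)[OF pf[OF xX(3)]] e by (simp add: rk_def)
    qed
  qed (rule cyc)
qed

section \<open>Traces on cycle spaces\<close>

definition fun_module :: "('x \<Rightarrow> complex) set \<Rightarrow> (complex, 'x \<Rightarrow> complex) module" where
  "fun_module Z = \<lparr>carrier = Z, monoid.mult = undefined, one = undefined,
     zero = (\<lambda>_. 0), add = (\<lambda>c d x. c x + d x), smult = (\<lambda>a c x. a * c x)\<rparr>"

text \<open>In the top degree the only boundary is 0, so homology classes are singletons. The locale
  translates coordinates and bases between this quotient \<open>Q\<close> and the function space
  \<open>Z\<close>.\<close>

locale fun_subspace =
  fixes X :: "'x set" and Z :: "('x \<Rightarrow> complex) set"
  assumes fin: "finite X" and supp: "\<And>z x. z \<in> Z \<Longrightarrow> x \<notin> X \<Longrightarrow> z x = 0"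
    and zero: "(\<lambda>_. 0) \<in> Z" and add: "\<And>u v. u \<in> Z \<Longrightarrow> v \<in> Z \<Longrightarrow> (\<lambda>x. u x + v x) \<in> Z"
    and scale: "\<And>a v. v \<in> Z \<Longrightarrow> (\<lambda>x. a * v x) \<in> Z"
begin

abbreviation Q where "Q \<equiv> quotient_module (fun_module Z) {\<lambda>_. 0}"

lemma carrier_Q: "carrier Q = (\<lambda>v. {v}) ` Z"
  by (auto simp: quotient_module_def fun_module_def A_RCOSETS_def' a_r_coset_def')

lemma add_Q: "{u} \<oplus>\<^bsub>Q\<^esub> {v} = {\<lambda>x. u x + v x}"
  by (auto simp: quotient_module_def fun_module_def set_add_def')

lemma zero_Q: "\<zero>\<^bsub>Q\<^esub> = {\<lambda>_. 0}"
  by (auto simp: quotient_module_def)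

lemma smult_Q: "a \<odot>\<^bsub>Q\<^esub> {v} = {\<lambda>x. a * v x}"
  by (auto simp: quotient_module_def fun_module_def a_r_coset_def')

lemma abelian_monoid_Q: "abelian_monoid Q"
  by (rule abelian_monoidI)
    (auto simp: carrier_Q add_Q zero_Q add zero algebra_simps intro!: imageI)

lemma finsum_Q:
  assumes "finite F" "f \<in> F \<rightarrow> carrier Q"
  shows "finsum Q f F = {\<lambda>x. \<Sum>e\<in>F. the_elem (f e) x}"
  using assms
proof (induction F rule: finite_induct)
  case empty
  then show ?case using abelian_monoid.finsum_empty[OF abelian_monoid_Q] by (simp add: zero_Q)
next
  case (insert e F)
  then obtain v where v: "f e = {v}" by (auto simp: carrier_Q)
  have "finsum Q f (insert e F) = f e \<oplus>\<^bsub>Q\<^esub> finsum Q f F"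
    using insert by (intro abelian_monoid.finsum_insert[OF abelian_monoid_Q]) auto
  also have "\<dots> = {\<lambda>x. \<Sum>e\<in>insert e F. the_elem (f e) x}"
    using insert v by (simp add: Pi_iff add_Q)
  finally show ?case .
qed

lemma is_coords_Q:
  assumes "finite F" "F \<subseteq> carrier Q"
  shows "is_coords Q F {z} a \<longleftrightarrow>
    a \<in> extensional F \<and> (\<forall>y. z y = (\<Sum>e\<in>F. a e * the_elem e y))"
proof -
  have e: "\<exists>v\<in>Z. e = {v}" if "e \<in> F" for e using that assms by (auto simp: carrier_Q)
  have "finsum Q (\<lambda>e. a e \<odot>\<^bsub>Q\<^esub> e) F = {\<lambda>x. \<Sum>e\<in>F. the_elem (a e \<odot>\<^bsub>Q\<^esub> e) x}"
    using e by (intro finsum_Q assms) (fastforce simp: smult_Q carrier_Q intro: scale)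
  also have "\<dots> = {\<lambda>x. \<Sum>e\<in>F. a e * the_elem e x}"
  proof -
    have "the_elem (a e \<odot>\<^bsub>Q\<^esub> e) x = a e * the_elem e x" if "e \<in> F" for e x
      using e[OF that] by (auto simp: smult_Q)
    then show ?thesis by simp
  qed
  finally show ?thesis by (auto simp: is_coords_def)
qed

text \<open>A spanning set of least cardinality is independent: a nontrivial relation would express
  one member by the others, and it could be dropped.\<close>

lemma ex_minimal_spanning:
  assumes E: "\<And>x. x \<in> X \<Longrightarrow> E x \<in> Z" "\<And>z y. z \<in> Z \<Longrightarrow> z y = (\<Sum>x\<in>X. z x * E x y)"
  shows "\<exists>B. finite B \<and> B \<subseteq> Z \<and> (\<forall>z\<in>Z. \<exists>a. \<forall>y. z y = (\<Sum>b\<in>B. a b * b y)) \<and>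
    (\<forall>c. (\<forall>y. (\<Sum>b\<in>B. c b * b y) = 0) \<longrightarrow> (\<forall>b\<in>B. c b = 0))"
proof -
  define spans where "spans B \<longleftrightarrow> finite B \<and> B \<subseteq> Z \<and>
    (\<forall>z\<in>Z. \<exists>a. \<forall>y. z y = (\<Sum>b\<in>B. a b * b y))" for B
  have "spans (E ` X)"
    unfolding spans_def
  proof (intro conjI ballI)
    fix z assume z: "z \<in> Z"
    \<comment> \<open>Different \<open>x\<close> may give the same vector \<open>E x\<close>, so
      their coefficients are collected.\<close>
    have "z y = (\<Sum>b\<in>E ` X. (\<Sum>x | x \<in> X \<and> E x = b. z x) * b y)" for y
    proof -
      have "z y = (\<Sum>x\<in>X. z x * E x y)" using E z by blast
      also have "\<dots> = (\<Sum>b\<in>E ` X. \<Sum>x | x \<in> X \<and> E x = b. z x * E x y)"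
        by (rule sum.image_gen[OF fin])
      also have "\<dots> = (\<Sum>b\<in>E ` X. (\<Sum>x | x \<in> X \<and> E x = b. z x) * b y)"
        by (auto simp: sum_distrib_right intro!: sum.cong)
      finally show ?thesis .
    qed
    then show "\<exists>a. \<forall>y. z y = (\<Sum>b\<in>E ` X. a b * b y)"
      by (intro exI[of _ "\<lambda>b. \<Sum>x | x \<in> X \<and> E x = b. z x"] allI)
  qed (use fin E in auto)
  then obtain B where B: "spans B" "\<And>B'. spans B' \<Longrightarrow> card B \<le> card B'"
    using ex_has_least_nat[of spans _ card] by blast
  have finB: "finite B" using B by (auto simp: spans_def)
  have "c b0 = 0" if c: "\<forall>y. (\<Sum>b\<in>B. c b * b y) = 0" and b0: "b0 \<in> B" for c b0
  proof (rule ccontr)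
    assume nz: "c b0 \<noteq> 0"
    have split: "(\<Sum>b\<in>B. f b) = f b0 + (\<Sum>b\<in>B - {b0}. f b)" for f :: "_ \<Rightarrow> complex"
      using b0 finB by (simp add: sum.remove)
    have b0y: "b0 y = - (\<Sum>b\<in>B - {b0}. c b * b y) / c b0" for y
      using c[rule_format, of y] nz split[of "\<lambda>b. c b * b y"]
      by (simp add: field_simps eq_neg_iff_add_eq_0)
    have "spans (B - {b0})"
      unfolding spans_def
    proof (intro conjI ballI)
      fix z assume "z \<in> Z"
      then obtain a where a: "\<And>y. z y = (\<Sum>b\<in>B. a b * b y)" using B unfolding spans_def by blast
      have "z y = (\<Sum>b\<in>B - {b0}. (a b - a b0 * c b / c b0) * b y)" for y
      proof -
        have "z y = a b0 * b0 y + (\<Sum>b\<in>B - {b0}. a b * b y)" by (simp add: a split)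
        also have "a b0 * b0 y = (\<Sum>b\<in>B - {b0}. - (a b0 * c b / c b0) * b y)"
          unfolding b0y[of y] sum_negf[symmetric] sum_divide_distrib sum_distrib_left
          by (rule sum.cong) simp_all
        finally show ?thesis by (simp add: left_diff_distrib sum_subtractf sum_negf)
      qed
      then show "\<exists>a. \<forall>y. z y = (\<Sum>b\<in>B - {b0}. a b * b y)"
        by (intro exI[of _ "\<lambda>b. a b - a b0 * c b / c b0"] allI)
    qed (use B in \<open>auto simp: spans_def\<close>)
    then have "card B \<le> card (B - {b0})" by (rule B)
    then show False using b0 finB by (metis card_Diff1_less not_le)
  qed
  then show ?thesis using B(1) unfolding spans_def by blast
qed

lemma ex_basis_Q:
  assumes E: "\<And>x. x \<in> X \<Longrightarrow> E x \<in> Z" "\<And>z y. z \<in> Z \<Longrightarrow> z y = (\<Sum>x\<in>X. z x * E x y)"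
  shows "\<exists>F. is_basis Q F"
proof -
  have "\<exists>B. finite B \<and> B \<subseteq> Z \<and> (\<forall>z\<in>Z. \<exists>a. \<forall>y. z y = (\<Sum>b\<in>B. a b * b y)) \<and>
    (\<forall>c. (\<forall>y. (\<Sum>b\<in>B. c b * b y) = 0) \<longrightarrow> (\<forall>b\<in>B. c b = 0))"
    using E by (rule ex_minimal_spanning)
  then obtain B where B: "finite B" "B \<subseteq> Z" "\<forall>z\<in>Z. \<exists>a. \<forall>y. z y = (\<Sum>b\<in>B. a b * b y)"
    "\<forall>c. (\<forall>y. (\<Sum>b\<in>B. c b * b y) = 0) \<longrightarrow> (\<forall>b\<in>B. c b = 0)"
    by (elim exE conjE) (rule that)
  let ?F = "(\<lambda>v. {v}) ` B"
  have F: "finite ?F" "?F \<subseteq> carrier Q" using B by (auto simp: carrier_Q)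
  have re: "(\<Sum>e\<in>?F. a e * the_elem e y) = (\<Sum>b\<in>B. a {b} * b y)" for a y
    by (subst sum.reindex) (auto simp: inj_on_def)
  have "\<exists>!a. is_coords Q ?F v a" if v: "v \<in> carrier Q" for v
  proof -
    obtain z where z: "z \<in> Z" "v = {z}" using v by (auto simp: carrier_Q)
    obtain a where a: "\<And>y. z y = (\<Sum>b\<in>B. a b * b y)" using B(3) z(1) by blast
    define a' where "a' = restrict (\<lambda>e. a (the_elem e)) ?F"
    have "is_coords Q ?F v a'"
      unfolding z is_coords_Q[OF F] re using a by (auto simp: a'_def)
    moreover have "c = c'" if c: "is_coords Q ?F v c" "is_coords Q ?F v c'" for c c'
    proof -
      have ext: "c \<in> extensional ?F" "c' \<in> extensional ?F"
        and eq: "\<And>y. (\<Sum>b\<in>B. c {b} * b y) = (\<Sum>b\<in>B. c' {b} * b y)"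
        using c[unfolded z is_coords_Q[OF F] re] by simp_all
      have "c {b} - c' {b} = 0" if "b \<in> B" for b
        using B(4)[rule_format, of "\<lambda>b. c {b} - c' {b}" b] eq that
        by (simp add: left_diff_distrib sum_subtractf)
      then show ?thesis using ext by (auto intro!: extensionalityI[of _ ?F])
    qed
    ultimately show ?thesis by blast
  qed
  then have "is_basis Q ?F" using F by (auto simp: is_basis_def)
  then show ?thesis by blast
qed

text \<open>The matrix \<open>E\<close> describes a projection \<open>P\<close> of the functions on
  \<open>X\<close> onto \<open>Z\<close>. Extend \<open>G\<close> to the permutation of the basis by
  \<open>g\<close>. Then \<open>P G\<close> maps into \<open>Z\<close> and agrees with
  \<open>G\<close> on \<open>Z\<close>, so the two traces are equal, and \<open>P G\<close> has the
  diagonal entries \<open>E (g x) x\<close>.\<close>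

lemma linear_trace_Q:
  assumes E: "\<And>x. x \<in> X \<Longrightarrow> E x \<in> Z" "\<And>z y. z \<in> Z \<Longrightarrow> z y = (\<Sum>x\<in>X. z x * E x y)"
    and g: "bij_betw g X X" and G: "\<And>z. z \<in> Z \<Longrightarrow> G z \<in> Z" "\<And>z x. z \<in> Z \<Longrightarrow> x \<in> X \<Longrightarrow> G z (g x) = z x"
  shows "linear_trace Q (\<lambda>C. G ` C) = (\<Sum>x\<in>X. E (g x) x)"
proof -
  define F where "F = (SOME F. is_basis Q F)"
  have basis: "is_basis Q F" using ex_basis_Q[where E = E, OF E] unfolding F_def by (rule someI_ex)
  have F: "finite F" "F \<subseteq> carrier Q" using basis by (auto simp: is_basis_def)
  have Fe: "\<exists>v\<in>Z. e = {v}" if "e \<in> F" for e using that F by (auto simp: carrier_Q)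
  define co where "co z e = coords Q F {z} e" for z e
  have ex1: "\<exists>!a. is_coords Q F {z} a" if "z \<in> Z" for z
    using basis that by (auto simp: is_basis_def carrier_Q)
  have co: "z y = (\<Sum>e\<in>F. co z e * the_elem e y)" if "z \<in> Z" for z y
  proof -
    have "is_coords Q F {z} (coords Q F {z})"
      unfolding coords_def by (rule theI'[OF ex1[OF that]])
    then show ?thesis unfolding is_coords_Q[OF F] co_def by blast
  qed
  have co_unique: "co z e = a e" if "z \<in> Z" "\<And>y. z y = (\<Sum>e\<in>F. a e * the_elem e y)" "e \<in> F" for z a e
  proof -
    have "is_coords Q F {z} (restrict a F)" unfolding is_coords_Q[OF F] using that by auto
    then have "coords Q F {z} = restrict a F"
      unfolding coords_def using ex1[OF that(1)] by (intro the1_equality)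
    then show ?thesis using that by (simp add: co_def)
  qed
  \<comment> \<open>Every \<open>z\<close> is a combination of the \<open>E x\<close>, so the
    coordinates of the \<open>E x\<close> determine all others.\<close>
  have co_lin: "co z e = (\<Sum>x\<in>X. z x * co (E x) e)" if z: "z \<in> Z" "e \<in> F" for z e
  proof (rule co_unique[OF z(1) _ z(2)])
    fix y
    have "z y = (\<Sum>x\<in>X. z x * E x y)" using E z by blast
    also have "\<dots> = (\<Sum>x\<in>X. z x * (\<Sum>e\<in>F. co (E x) e * the_elem e y))"
      using co E by (intro sum.cong) auto
    also have "\<dots> = (\<Sum>x\<in>X. \<Sum>e\<in>F. z x * co (E x) e * the_elem e y)"
      by (simp add: sum_distrib_left mult.assoc)
    also have "\<dots> = (\<Sum>e\<in>F. (\<Sum>x\<in>X. z x * co (E x) e) * the_elem e y)"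
      by (subst sum.swap) (simp add: sum_distrib_right)
    finally show "z y = (\<Sum>e\<in>F. (\<Sum>x\<in>X. z x * co (E x) e) * the_elem e y)" .
  qed
  have "linear_trace Q (\<lambda>C. G ` C) = (\<Sum>e\<in>F. coords Q F (G ` e) e)"
    by (simp add: linear_trace_def F_def Let_def)
  also have "\<dots> = (\<Sum>e\<in>F. \<Sum>x\<in>X. the_elem e x * co (E (g x)) e)"
  proof (rule sum.cong[OF refl])
    fix e assume e: "e \<in> F"
    obtain v where v: "v \<in> Z" "e = {v}" using Fe[OF e] by blast
    have "coords Q F (G ` e) e = co (G v) e" by (simp add: co_def v)
    also have "\<dots> = (\<Sum>x\<in>X. G v x * co (E x) e)" using co_lin G v e by blast
    also have "\<dots> = (\<Sum>x\<in>X. G v (g x) * co (E (g x)) e)"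
      using sum.reindex_bij_betw[OF g, of "\<lambda>x. G v x * co (E x) e"] by simp
    also have "\<dots> = (\<Sum>x\<in>X. v x * co (E (g x)) e)" using G v by simp
    finally show "coords Q F (G ` e) e = (\<Sum>x\<in>X. the_elem e x * co (E (g x)) e)" using v by simp
  qed
  \<comment> \<open>Exchanging the sums recombines the coordinates of \<open>E (g x)\<close> into
    its value at \<open>x\<close>.\<close>
  also have "\<dots> = (\<Sum>x\<in>X. \<Sum>e\<in>F. co (E (g x)) e * the_elem e x)"
    by (subst sum.swap) (simp add: mult.commute)
  also have "\<dots> = (\<Sum>x\<in>X. E (g x) x)"
  proof (rule sum.cong[OF refl])
    fix x assume "x \<in> X"
    then have "E (g x) \<in> Z" using E(1) bij_betwE[OF g] by blast
    from co[OF this, of x] show "(\<Sum>e\<in>F. co (E (g x)) e * the_elem e x) = E (g x) x" by simp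
  qed
  finally show ?thesis .
qed

end

lemma delete_nth_map: "delete_nth i (map f xs) = map f (delete_nth i xs)"
  by (simp add: delete_nth_def take_map drop_map)

lemma face_coeff_map:
  assumes "inj f"
  shows "face_coeff (map f xs) (map f ys) = face_coeff xs ys"
  by (simp add: face_coeff_def delete_nth_map inj_map_eq_map[OF assms])

lemma face_coeff_zero_length:
  assumes "length xs \<noteq> Suc (length ys)"
  shows "face_coeff xs ys = 0"
proof -
  have "delete_nth i xs \<noteq> ys" if "i < length xs" for i
    using assms length_delete_nth[OF that] that by auto
  then show ?thesis by (simp add: face_coeff_def)
qed

section \<open>Projections onto cycles and the Hopf trace formula\<close>

definition ranked_chains :: "nat set \<Rightarrow> nat set \<Rightarrow> nat \<Rightarrow> (nat set \<times> nat set) list set" where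
  "ranked_chains A B l = {xs \<in> segre_chains A B. length xs = l}"

lemma face_coeff_ranked_chains:
  assumes "x \<in> ranked_chains A B (Suc l)" "w \<notin> ranked_chains A B l"
  shows "face_coeff x w = 0"
proof (rule ccontr)
  assume nz: "face_coeff x w \<noteq> 0"
  have "sorted_wrt (<) x" "set x \<subseteq> segre_interior A B" "length x = Suc l"
    using assms by (auto simp: ranked_chains_def segre_chains_def)
  moreover have "length x = Suc (length w)" using nz face_coeff_zero_length by blast
  ultimately show False using nz assms(2) face_coeff_nonzero_iff[of x w]
    by (auto simp: ranked_chains_def segre_chains_def)
qed

lemma face_coeff_ranked_comp:
  assumes "finite A" "finite B" "y \<in> ranked_chains A B (Suc l)"
  shows "(\<Sum>x\<in>ranked_chains A B l. face_coeff y x * face_coeff x w) = 0"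
proof (rule face_coeff_comp)
  show "finite (ranked_chains A B l)" using finite_segre_chains[OF assms(1,2)] by (auto simp: ranked_chains_def)
  fix i assume "i < length y"
  then show "delete_nth i y \<in> ranked_chains A B l"
    using assms(3) sorted_wrt_delete_nth[of "(<)" y i] set_delete_nth[of y i]
      sorted_wrt_less_distinct[of y] length_delete_nth[of i y]
    by (auto simp: ranked_chains_def segre_chains_def)
qed

text \<open>Sending the basis chain \<open>x\<close> to \<open>E x\<close> is a projection of the
  chains of length \<open>l\<close> onto the cycles: the values are cycles, and cycles are
  reproduced.\<close>

definition cycle_projection ::
    "nat set \<Rightarrow> nat set \<Rightarrow> nat \<Rightarrow>
     ((nat set \<times> nat set) list \<Rightarrow> (nat set \<times> nat set) list \<Rightarrow> complex) \<Rightarrow> bool" where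
  "cycle_projection A B l E \<longleftrightarrow>
     (\<forall>x\<in>ranked_chains A B l. (\<forall>y. y \<notin> ranked_chains A B l \<longrightarrow> E x y = 0) \<and>
        (\<forall>w. (\<Sum>y\<in>ranked_chains A B l. E x y * face_coeff y w) = 0)) \<and>
     (\<forall>z. (\<forall>y. y \<notin> ranked_chains A B l \<longrightarrow> z y = 0) \<longrightarrow>
        (\<forall>w. (\<Sum>y\<in>ranked_chains A B l. z y * face_coeff y w) = 0) \<longrightarrow>
        (\<forall>y. z y = (\<Sum>x\<in>ranked_chains A B l. z x * E x y)))"

text \<open>Write \<open>d\<close> for the boundary. Exactness lifts the projection \<open>E\<close>
  to \<open>H\<close> with \<open>d H = E\<close>, and \<open>1 - H d\<close> is then a projection
  onto the cycles one degree higher. By cyclicity of the trace, \<open>H d\<close> contributes the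
  trace of \<open>E\<close>, so the signed count of fixed chains builds up by induction.\<close>

lemma cycle_projection_trace:
  fixes f :: "nat set \<times> nat set \<Rightarrow> nat set \<times> nat set"
  assumes fin: "finite A" "finite B" "card A = card B" and f: "inj f"
    and g: "\<And>l. bij_betw (map f) (ranked_chains A B l) (ranked_chains A B l)"
    and l: "l < card A"
  shows "\<exists>E. cycle_projection A B l E \<and> (\<Sum>x\<in>ranked_chains A B l. E (map f x) x) =
        (\<Sum>j\<le>l. (-1) ^ (l + j) * of_nat (card {x \<in> ranked_chains A B j. map f x = x}))"
  using l
proof (induction l)
  case 0
  have X0: "ranked_chains A B 0 = {[]}" by (auto simp: ranked_chains_def segre_chains_def)
  have c: "{x. x = [] \<and> map f x = x} = {[]}" by auto
  \<comment> \<open>In dimension -1 the empty chain is the only simplex and is a cycle, so the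
    projection is the identity.\<close>
  let ?E = "\<lambda>x y :: (nat set \<times> nat set) list. if x = y \<and> y = [] then 1 else (0 :: complex)"
  have "cycle_projection A B 0 ?E"
    unfolding cycle_projection_def X0 by (simp add: face_coeff_def)
  then show ?case unfolding X0 by (intro exI[of _ ?E] conjI) (simp_all add: X0 c)
next
  case (Suc l)
  let ?X = "ranked_chains A B l" and ?Y = "ranked_chains A B (Suc l)"
  have finX: "finite ?X" "finite ?Y" using finite_segre_chains[OF fin(1,2)] by (auto simp: ranked_chains_def)
  obtain E where E: "cycle_projection A B l E"
    and Etr: "(\<Sum>x\<in>?X. E (map f x) x) =
        (\<Sum>j\<le>l. (-1) ^ (l + j) * of_nat (card {x \<in> ranked_chains A B j. map f x = x}))"
    using Suc.IH[OF Suc_lessD[OF Suc.prems]] by blast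
  have E0: "(\<Sum>y\<in>?X. E x y * face_coeff y w) = 0" if "x \<in> ?X" for x w
    using E that unfolding cycle_projection_def by blast
  have Erep: "z y = (\<Sum>x\<in>?X. z x * E x y)"
    if "\<And>y. y \<notin> ?X \<Longrightarrow> z y = 0" "\<And>w. (\<Sum>y\<in>?X. z y * face_coeff y w) = 0" for z y
    using E that unfolding cycle_projection_def by blast
  have "\<exists>y. \<forall>x'\<in>?X. E x x' = (\<Sum>y'\<in>?Y. y y' * face_coeff y' x')" if "x \<in> ?X" for x
    using Suc.prems E0[OF that]
    by (intro segre_chains_exact[OF fin, of l]) (auto simp: ranked_chains_def)
  then obtain H where H: "\<And>x x'. x \<in> ?X \<Longrightarrow> x' \<in> ?X \<Longrightarrow> E x x' = (\<Sum>y'\<in>?Y. H x y' * face_coeff y' x')"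
    by metis
  \<comment> \<open>This is \<open>1 - H d\<close>. The boundary of \<open>x\<close> is itself a
    cycle, hence fixed by the previous projection, so the boundary of \<open>E' x\<close>
    vanishes.\<close>
  define E' where "E' x y = (if y \<in> ?Y then (if x = y then 1 else 0)
     - (\<Sum>w\<in>?X. face_coeff x w * H w y) else 0)" for x y
  have face0: "face_coeff x w = 0" if "x \<in> ?Y" "w \<notin> ?X" for x w
    using face_coeff_ranked_chains that .
  show ?case unfolding cycle_projection_def
  proof (intro exI[of _ E'] conjI ballI allI impI)
    fix x w assume x: "x \<in> ?Y"
    show "(\<Sum>y\<in>?Y. E' x y * face_coeff y w) = 0"
    proof (cases "w \<in> ?X")
      case True
      have "(\<Sum>y\<in>?Y. E' x y * face_coeff y w)
        = (\<Sum>y\<in>?Y. (if x = y then face_coeff y w else 0)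
            - (\<Sum>v\<in>?X. face_coeff x v * (H v y * face_coeff y w)))"
        by (rule sum.cong) (auto simp: E'_def left_diff_distrib sum_distrib_right mult.assoc)
      also have "\<dots> = face_coeff x w - (\<Sum>v\<in>?X. face_coeff x v * (\<Sum>y\<in>?Y. H v y * face_coeff y w))"
        using x finX by (simp add: sum_subtractf sum_distrib_left sum.swap[of _ ?Y ?X])
      also have "(\<Sum>v\<in>?X. face_coeff x v * (\<Sum>y\<in>?Y. H v y * face_coeff y w))
        = (\<Sum>v\<in>?X. face_coeff x v * E v w)"
        using H True by (intro sum.cong) auto
      also have "\<dots> = face_coeff x w"
        using Erep[of "face_coeff x" w] face0[OF x] face_coeff_ranked_comp[OF fin(1,2) x] by simp
      finally show ?thesis by simp
    qed (use face0 in simp)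
  next
    fix z y assume z: "\<forall>y. y \<notin> ?Y \<longrightarrow> z y = 0" "\<forall>w. (\<Sum>y\<in>?Y. z y * face_coeff y w) = 0"
    show "z y = (\<Sum>x\<in>?Y. z x * E' x y)"
    proof (cases "y \<in> ?Y")
      case True
      have "(\<Sum>x\<in>?Y. z x * E' x y)
        = (\<Sum>x\<in>?Y. (if x = y then z x else 0) - (\<Sum>w\<in>?X. z x * face_coeff x w * H w y))"
        using True by (intro sum.cong) (auto simp: E'_def right_diff_distrib sum_distrib_left mult.assoc)
      also have "\<dots> = z y - (\<Sum>w\<in>?X. (\<Sum>x\<in>?Y. z x * face_coeff x w) * H w y)"
        using True finX by (simp add: sum_subtractf sum_distrib_right sum.swap[of _ ?Y ?X])
      finally show ?thesis using z by simp
    qed (use z in \<open>simp add: E'_def\<close>)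
  next
    have "(\<Sum>x\<in>?Y. E' (map f x) x)
      = (\<Sum>x\<in>?Y. (if map f x = x then 1 else 0) - (\<Sum>w\<in>?X. face_coeff (map f x) w * H w x))"
      by (rule sum.cong) (auto simp: E'_def)
    also have "\<dots> = (\<Sum>x\<in>?Y. if map f x = x then 1 else 0)
        - (\<Sum>x\<in>?Y. \<Sum>w\<in>?X. face_coeff (map f x) w * H w x)"
      by (simp add: sum_subtractf)
    \<comment> \<open>Incidence numbers are invariant under \<open>f\<close>, so reindexing moves
      the action from \<open>x\<close> to \<open>w\<close>.\<close>
    also have "(\<Sum>x\<in>?Y. \<Sum>w\<in>?X. face_coeff (map f x) w * H w x)
      = (\<Sum>x\<in>?Y. \<Sum>w\<in>?X. face_coeff x w * H (map f w) x)"
    proof (rule sum.cong[OF refl])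
      fix x
      have "(\<Sum>w\<in>?X. face_coeff (map f x) w * H w x)
        = (\<Sum>w\<in>?X. face_coeff (map f x) (map f w) * H (map f w) x)"
        using sum.reindex_bij_betw[OF g, of "\<lambda>w. face_coeff (map f x) w * H w x" l] by simp
      then show "(\<Sum>w\<in>?X. face_coeff (map f x) w * H w x) = (\<Sum>w\<in>?X. face_coeff x w * H (map f w) x)"
        by (simp add: face_coeff_map[OF f])
    qed
    also have "\<dots> = (\<Sum>w\<in>?X. \<Sum>x\<in>?Y. H (map f w) x * face_coeff x w)"
      by (subst sum.swap) (simp add: mult.commute)
    also have "\<dots> = (\<Sum>w\<in>?X. E (map f w) w)"
    proof (rule sum.cong[OF refl])
      fix w assume w: "w \<in> ?X"
      then have "map f w \<in> ?X" using bij_betwE[OF g] by blast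
      from H[OF this w] show "(\<Sum>x\<in>?Y. H (map f w) x * face_coeff x w) = E (map f w) w" by simp
    qed
    also have "(\<Sum>x\<in>?Y. if map f x = x then 1 else 0) = (of_nat (card {x \<in> ?Y. map f x = x}) :: complex)"
      using sum.inter_filter[OF finX(2), of "\<lambda>_. 1 :: complex" "\<lambda>x. map f x = x"] by simp
    finally show "(\<Sum>x\<in>?Y. E' (map f x) x) = (\<Sum>j\<le>Suc l. (-1) ^ (Suc l + j) *
        of_nat (card {x \<in> ranked_chains A B j. map f x = x}))"
      by (simp add: Etr sum_negf)
  qed (simp add: E'_def)
qed

section \<open>The $q$-series\<close>

definition qpoch :: "nat \<Rightarrow> complex fps" where
  "qpoch m = (\<Prod>i=1..m. 1 - fps_X ^ i)"

lemma one_minus_X_power_nth0: "0 < i \<Longrightarrow> fps_nth (1 - fps_X ^ i :: complex fps) 0 = 1"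
  by (simp add: fps_X_power_nth)

lemma qpoch_0: "qpoch 0 = 1"
  by (simp add: qpoch_def)

lemma qpoch_Suc: "qpoch (Suc m) = qpoch m * (1 - fps_X ^ Suc m)"
  by (simp add: qpoch_def)

lemma qpoch_nth0: "fps_nth (qpoch m) 0 = 1"
  by (induction m) (simp_all add: qpoch_0 qpoch_Suc fps_X_power_nth del: power_Suc)

lemma qpoch_inverse: "inverse (qpoch m) * qpoch m = 1" "qpoch m * inverse (qpoch m) = 1"
  using inverse_mult_eq_1[of "qpoch m"] inverse_mult_eq_1'[of "qpoch m"] qpoch_nth0 by simp_all

lemma one_minus_X_power_inverse:
  assumes "0 < i"
  shows "inverse (1 - fps_X ^ i) * (1 - fps_X ^ i :: complex fps) = 1"
  using inverse_mult_eq_1[of "1 - fps_X ^ i :: complex fps"] one_minus_X_power_nth0[OF assms] by simp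

lemma qpoch_inverse_Suc: "inverse (qpoch m) = (1 - fps_X ^ Suc m) * inverse (qpoch (Suc m))"
proof -
  have "(1 - fps_X ^ Suc m) * inverse (qpoch (Suc m))
    = inverse (qpoch m) * (qpoch m * (1 - fps_X ^ Suc m)) * inverse (qpoch (Suc m))"
    using qpoch_inverse(1)[of m] by (simp add: mult.assoc[symmetric] del: power_Suc)
  also have "\<dots> = inverse (qpoch m)"
    unfolding qpoch_Suc[symmetric] mult.assoc qpoch_inverse(2) by simp
  finally show ?thesis by simp
qed

text \<open>The Newton identity for the principal specializations: the difference of the two sides
  of degree \<open>n\<close>, multiplied by \<open>1 - q^n\<close>, is the difference in degree \<open>n - 1\<close>.\<close>

lemma qpoch_newton:
  "of_nat n * inverse (qpoch n)
     = (\<Sum>k=1..n. inverse (1 - fps_X ^ k) * inverse (qpoch (n - k)))"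
proof (induction n)
  case 0
  then show ?case by simp
next
  case (Suc n)
  let ?a = "\<lambda>m. inverse (qpoch m)" and ?p = "\<lambda>k. inverse (1 - fps_X ^ k :: complex fps)"
  let ?S = "\<Sum>k=1..Suc n. ?p k * ?a (Suc n - k)"
  have p: "?p k * fps_X ^ k = ?p k - 1" if "0 < k" for k
    using one_minus_X_power_inverse[OF that] by (simp add: algebra_simps)
  have "(1 - fps_X ^ Suc n) * ?S = (\<Sum>k=1..Suc n. ?p k * ?a (Suc n - k) * (1 - fps_X ^ Suc n))"
    by (simp only: sum_distrib_right mult.commute[of "1 - fps_X ^ Suc n"])
  also have "\<dots> = (\<Sum>k=1..Suc n. ?a (Suc n - k) +
      (?p k - 1) * ((1 - fps_X ^ (Suc n - k)) * ?a (Suc n - k)))"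
  proof (rule sum.cong[OF refl])
    fix k assume k: "k \<in> {1..Suc n}"
    have "fps_X ^ Suc n = fps_X ^ k * (fps_X ^ (Suc n - k) :: complex fps)"
      using k by (simp only: power_add[symmetric]) simp
    then have "?p k * ?a (Suc n - k) * (1 - fps_X ^ Suc n) =
      ?p k * (1 - fps_X ^ k) * ?a (Suc n - k)
        + ?p k * fps_X ^ k * ((1 - fps_X ^ (Suc n - k)) * ?a (Suc n - k))"
      by (simp only:) (simp only: algebra_simps mult_1_left mult_1_right)
    also have "?p k * (1 - fps_X ^ k) = 1" using one_minus_X_power_inverse k by auto
    also have "?p k * fps_X ^ k = ?p k - 1" using p k by auto
    finally show "?p k * ?a (Suc n - k) * (1 - fps_X ^ Suc n) = ?a (Suc n - k) +
      (?p k - 1) * ((1 - fps_X ^ (Suc n - k)) * ?a (Suc n - k))" by simp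
  qed
  also have "\<dots> = (\<Sum>k=1..Suc n. ?a (Suc n - k))
      + (\<Sum>k=1..n. (?p k - 1) * ((1 - fps_X ^ (Suc n - k)) * ?a (Suc n - k)))"
    by (simp add: sum.distrib)
  also have "(\<Sum>k=1..n. (?p k - 1) * ((1 - fps_X ^ (Suc n - k)) * ?a (Suc n - k)))
      = (\<Sum>k=1..n. (?p k - 1) * ?a (n - k))"
    by (rule sum.cong) (auto simp: qpoch_inverse_Suc[symmetric] Suc_diff_le simp del: power_Suc)
  also have "\<dots> = of_nat n * ?a n - (\<Sum>k=1..n. ?a (n - k))"
    by (simp add: left_diff_distrib sum_subtractf Suc)
  also have "(\<Sum>k=1..Suc n. ?a (Suc n - k)) = ?a n + (\<Sum>k=1..n. ?a (n - k))"
    using sum.atLeast_Suc_atMost_Suc_shift[of "\<lambda>k. ?a (Suc n - k)" 0 n]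
    by (simp add: sum.atLeast_Suc_atMost[of 0 n])
  also have "?a n + (\<Sum>k=1..n. ?a (n - k)) + (of_nat n * ?a n - (\<Sum>k=1..n. ?a (n - k)))
      = of_nat (Suc n) * ?a n" by (simp add: distrib_right)
  finally have "(1 - fps_X ^ Suc n) * ?S = of_nat (Suc n) * ?a n" .
  then have "(1 - fps_X ^ Suc n) * ?S = (1 - fps_X ^ Suc n) * (of_nat (Suc n) * ?a (Suc n))"
    using qpoch_inverse_Suc[of n] by (simp only: mult.left_commute)
  then have eq: "?p (Suc n) * (1 - fps_X ^ Suc n) * ?S
    = ?p (Suc n) * (1 - fps_X ^ Suc n) * (of_nat (Suc n) * ?a (Suc n))"
    by (simp only: mult.assoc)
  show ?case
    using eq[unfolded one_minus_X_power_inverse[OF zero_less_Suc] mult_1_left] by (rule sym)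
qed

text \<open>The sum is a Gaussian binomial coefficient. Splitting off the maximum \<open>t\<close>
  gives the q-Pascal rule: if \<open>t\<close> lies in \<open>S\<close>, it forms an inversion with
  every element outside \<open>S\<close>, otherwise with none.\<close>

lemma qbinomial_subsets:
  assumes "finite A" "a \<le> card A"
  shows "(\<Sum>S | S \<subseteq> A \<and> card S = a. fps_X ^ card (cut_inv A S)) * (qpoch a * qpoch (card A - a)) = qpoch (card A)"
  using assms
proof (induction A arbitrary: a rule: finite_linorder_max_induct)
  case empty
  have "{S. S = {} \<and> card S = 0} = {{} :: nat set}" by auto
  then show ?case using empty by (simp add: cut_inv_def qpoch_0)
next
  case (insert t A)
  let ?m = "card A"
  let ?b = "\<lambda>A a. \<Sum>S | S \<subseteq> A \<and> card S = a. fps_X ^ card (cut_inv A S) :: complex fps"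
  have t: "t \<notin> A" using insert by auto
  have cA: "card (insert t A) = Suc ?m" using insert t by simp
  have finS: "finite {S. S \<subseteq> A \<and> P S}" for P using insert(1) by auto
  have c1: "card (cut_inv (insert t A) S) = card (cut_inv A S)" if "S \<subseteq> A" for S
  proof -
    have "{(x, y). x \<in> S \<and> y \<in> insert t A - S \<and> y < x} = {(x, y). x \<in> S \<and> y \<in> A - S \<and> y < x}"
      using that insert(2) by force
    then show ?thesis by (simp add: cut_inv_def)
  qed
  have c2: "card (cut_inv (insert t A) (insert t S)) = card (cut_inv A S) + (?m - card S)" if "S \<subseteq> A" for S
  proof -
    have finS: "finite S" using that insert(1) finite_subset by blast
    have "{(x, y). x \<in> insert t S \<and> y \<in> insert t A - insert t S \<and> y < x}
      = {(x, y). x \<in> S \<and> y \<in> A - S \<and> y < x} \<union> {t} \<times> (A - S)"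
      using that insert(2) t by auto
    moreover have "card ({(x, y). x \<in> S \<and> y \<in> A - S \<and> y < x} \<union> {t} \<times> (A - S))
      = card {(x, y). x \<in> S \<and> y \<in> A - S \<and> y < x} + card ({t} \<times> (A - S))"
    proof (rule card_Un_disjoint)
      show "finite {(x, y). x \<in> S \<and> y \<in> A - S \<and> y < x}"
        by (rule finite_subset[of _ "S \<times> A"]) (use finS insert(1) in auto)
    qed (use that t insert(1) in auto)
    moreover have "card ({t} \<times> (A - S)) = ?m - card S"
      using that finS by (simp add: card_cartesian_product card_Diff_subset)
    ultimately show ?thesis by (simp add: cut_inv_def)
  qed
  have split: "?b (insert t A) a = ?b A a + (if a = 0 then 0 else fps_X ^ (Suc ?m - a) * ?b A (a - 1))"
  proof -
    have "{S. S \<subseteq> insert t A \<and> card S = a} = {S. S \<subseteq> A \<and> card S = a}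
      \<union> insert t ` {S. S \<subseteq> A \<and> Suc (card S) = a}" (is "?L = ?U \<union> ?V")
    proof (intro equalityI subsetI)
      fix S assume S: "S \<in> ?L"
      show "S \<in> ?U \<union> ?V"
      proof (cases "t \<in> S")
        case True
        have "finite S" using S insert(1) finite_subset by auto
        then have "Suc (card (S - {t})) = a" using True S card_Suc_Diff1[of S t] by simp
        moreover have "S = insert t (S - {t})" "S - {t} \<subseteq> A" using True S by auto
        ultimately show ?thesis by blast
      qed (use S in auto)
    next
      fix S assume S: "S \<in> ?U \<union> ?V"
      have "card (insert t S') = Suc (card S')" if "S' \<subseteq> A" for S'
        using that t insert(1) finite_subset[OF that] by (auto simp: card_insert_if)
      then show "S \<in> ?L" using S by auto
    qed
    then have "?b (insert t A) a = (\<Sum>S\<in>?U. fps_X ^ card (cut_inv (insert t A) S))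
      + (\<Sum>S\<in>?V. fps_X ^ card (cut_inv (insert t A) S))"
      using finS t by (simp only:) (intro sum.union_disjoint, auto)
    also have "(\<Sum>S\<in>?U. fps_X ^ card (cut_inv (insert t A) S) :: complex fps) = ?b A a"
      by (rule sum.cong) (auto simp: c1)
    also have "(\<Sum>S\<in>?V. fps_X ^ card (cut_inv (insert t A) S) :: complex fps)
      = (\<Sum>S | S \<subseteq> A \<and> Suc (card S) = a. fps_X ^ (card (cut_inv A S) + (?m - card S)))"
    proof (subst sum.reindex)
      show "inj_on (insert t) {S. S \<subseteq> A \<and> Suc (card S) = a}"
        using t by (auto simp: inj_on_def)
    qed (auto simp: c2 intro!: sum.cong)
    also have "\<dots> = (if a = 0 then 0 else fps_X ^ (Suc ?m - a) * ?b A (a - 1))"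
    proof (cases a)
      case (Suc a')
      have "(\<Sum>S | S \<subseteq> A \<and> Suc (card S) = a. fps_X ^ (card (cut_inv A S) + (?m - card S)) :: complex fps)
        = (\<Sum>S | S \<subseteq> A \<and> card S = a'. fps_X ^ (?m - a') * fps_X ^ card (cut_inv A S))"
        using Suc by (intro sum.cong) (auto simp: power_add mult.commute)
      then show ?thesis using Suc by (simp add: sum_distrib_left)
    qed simp
    finally show ?thesis .
  qed
  \<comment> \<open>At either end one of the two Pascal terms vanishes, and the induction hypothesis
    is applied to the other alone.\<close>
  consider "a = 0" | "a = Suc ?m" | a' where "a = Suc a'" "a' < ?m"
    using insert.prems cA by (cases a) force+
  then show ?case
  proof cases
    case 1
    then show ?thesis using insert.IH[of 0] unfolding split cA
      by (simp add: qpoch_0 qpoch_Suc mult.assoc[symmetric] del: power_Suc)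
  next
    case 2
    have "card S \<noteq> Suc ?m" if "S \<subseteq> A" for S using card_mono[OF insert(1) that] by simp
    then have "?b A (Suc ?m) = 0" by (intro sum.neutral) auto
    then have b: "?b (insert t A) a = ?b A ?m" unfolding split using 2 by simp
    have "?b A ?m * (qpoch (Suc ?m) * qpoch 0) = ?b A ?m * (qpoch ?m * qpoch (?m - ?m)) * (1 - fps_X ^ Suc ?m)"
      unfolding qpoch_Suc by (simp only: mult.assoc mult.commute mult.left_commute diff_self_eq_0)
    also have "\<dots> = qpoch (Suc ?m)" unfolding insert.IH[OF order_refl] qpoch_Suc ..
    finally show ?thesis unfolding b cA using 2 by simp
  next
    case 3
    let ?B0 = "?b A (Suc a')" and ?B1 = "?b A a'"
    define r where "r = ?m - Suc a'"
    have r: "?m - a' = Suc r" "?m - Suc a' = r" using 3 by (auto simp: r_def)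
    have IH0: "?B0 * (qpoch (Suc a') * qpoch r) = qpoch ?m" using insert.IH[of "Suc a'"] 3 r by simp
    have IH1: "?B1 * (qpoch a' * qpoch (Suc r)) = qpoch ?m" using insert.IH[of a'] 3 r by simp
    have m: "Suc ?m = Suc r + Suc a'" using r 3 by simp
    have "?b (insert t A) a * (qpoch a * qpoch (Suc ?m - a))
      = (?B0 + fps_X ^ Suc r * ?B1) * (qpoch (Suc a') * qpoch (Suc r))"
      unfolding split using 3 r by simp
    also have "\<dots> = ?B0 * (qpoch (Suc a') * qpoch r) * (1 - fps_X ^ Suc r)
      + fps_X ^ Suc r * (?B1 * (qpoch a' * qpoch (Suc r))) * (1 - fps_X ^ Suc a')"
      unfolding qpoch_Suc by (simp only: algebra_simps)
    also have "\<dots> = qpoch ?m * (1 - fps_X ^ Suc r) + fps_X ^ Suc r * qpoch ?m * (1 - fps_X ^ Suc a')"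
      unfolding IH0 IH1 by simp
    also have "\<dots> = qpoch ?m * (1 - fps_X ^ Suc r * fps_X ^ Suc a')"
      by (simp only: algebra_simps mult_1_left mult_1_right)
    also have "fps_X ^ Suc r * fps_X ^ Suc a' = (fps_X ^ Suc ?m :: complex fps)"
      by (simp only: m power_add)
    also have "qpoch ?m * (1 - fps_X ^ Suc ?m) = qpoch (Suc ?m)"
      by (simp only: qpoch_Suc)
    finally show ?thesis unfolding cA .
  qed
qed

section \<open>Principal specialization of series\<close>

fun var_weight :: "var \<Rightarrow> nat" where
  "var_weight (XVar i) = i - 1"
| "var_weight (YVar i) = i - 1"

definition mon_weight :: "var multiset \<Rightarrow> nat" where
  "mon_weight M = (\<Sum>v\<in>#M. var_weight v)"

lemma principal_value_eq: "principal_value v = fps_X ^ var_weight v"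
  by (cases v) auto

lemma specialize_monomial_eq: "specialize_monomial f M = fps_const (f M) * fps_X ^ mon_weight M"
proof -
  have "(\<Prod>v\<in>#M. principal_value v) = fps_X ^ mon_weight M"
    by (induction M) (auto simp: mon_weight_def principal_value_eq power_add)
  then show ?thesis by (simp add: specialize_monomial_def)
qed

lemma specialize_monomial_nth:
  "fps_nth (specialize_monomial f M) d = (if mon_weight M = d then f M else 0)"
  by (simp add: specialize_monomial_eq fps_X_power_nth)

definition monomials :: "nat \<Rightarrow> nat \<Rightarrow> var multiset set" where
  "monomials D d = {M. size M \<le> D \<and> mon_weight M = d}"

text \<open>Since \<open>XVar 1\<close> has weight 0, infinitely many monomials share a weight, and
  a sum over an infinite set is 0 by convention. A degree bound leaves the finite index set
  \<open>monomials D d\<close> for the coefficient of \<open>q^d\<close>.\<close>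

definition degree_le :: "nat \<Rightarrow> series \<Rightarrow> bool" where
  "degree_le D f \<longleftrightarrow> (\<forall>M. f M \<noteq> 0 \<longrightarrow> size M \<le> D)"

lemma finite_bounded_multisets:
  assumes "finite A"
  shows "finite {M. set_mset M \<subseteq> A \<and> size M \<le> k}"
proof (rule finite_subset)
  show "{M. set_mset M \<subseteq> A \<and> size M \<le> k} \<subseteq> mset ` {xs. set xs \<subseteq> A \<and> length xs \<le> k}"
  proof
    fix M assume M: "M \<in> {M. set_mset M \<subseteq> A \<and> size M \<le> k}"
    obtain xs where "M = mset xs" using ex_mset[of M] by blast
    then show "M \<in> mset ` {xs. set xs \<subseteq> A \<and> length xs \<le> k}" using M by auto
  qed
  show "finite (mset ` {xs. set xs \<subseteq> A \<and> length xs \<le> k})"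
    using finite_lists_length_le[OF assms] by blast
qed

lemma finite_monomials: "finite (monomials D d)"
proof (rule finite_subset)
  \<comment> \<open>A variable occurring in a monomial of weight \<open>d\<close> has weight at most
    \<open>d\<close>, hence index at most \<open>Suc d\<close>.\<close>
  let ?A = "XVar ` {..Suc d} \<union> YVar ` {..Suc d}"
  have "v \<in> ?A" if "v \<in># M" "mon_weight M = d" for v M
  proof -
    have "var_weight v \<le> d"
      using that by (metis mon_weight_def sum_mset.remove le_add1 image_mset_single msed_map_invL
          insert_DiffM image_mset_add_mset sum_mset.add_mset)
    then show ?thesis by (cases v) auto
  qed
  then show "monomials D d \<subseteq> {M. set_mset M \<subseteq> ?A \<and> size M \<le> D}"
    by (auto simp: monomials_def)
  show "finite {M. set_mset M \<subseteq> ?A \<and> size M \<le> D}" by (rule finite_bounded_multisets) auto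
qed

lemma ps_nth:
  assumes "degree_le D f"
  shows "fps_nth (principal_specialization f) d = (\<Sum>M\<in>monomials D d. f M)"
proof -
  have "fps_nth (principal_specialization f) d = (\<Sum>M | mon_weight M = d \<and> f M \<noteq> 0. f M)"
    unfolding principal_specialization_def fps_nth_Abs_fps specialize_monomial_nth
    by (rule sum.cong) auto
  also have "\<dots> = (\<Sum>M\<in>monomials D d. f M)"
    using assms finite_monomials[of D d]
    by (intro sum.mono_neutral_left) (auto simp: monomials_def degree_le_def)
  finally show ?thesis .
qed

lemma degree_le_mult:
  assumes "degree_le D f" "degree_le D' g"
  shows "degree_le (D + D') (series_mult f g)"
  unfolding degree_le_def
proof (intro allI impI)
  fix M assume "series_mult f g M \<noteq> 0"
  then obtain A where A: "A \<subseteq># M" "f A * g (M - A) \<noteq> 0"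
    unfolding series_mult_def using sum.not_neutral_contains_not_neutral by force
  then have "size A \<le> D" "size (M - A) \<le> D'" using assms by (auto simp: degree_le_def)
  then show "size M \<le> D + D'" using A by (simp add: size_Diff_submset)
qed

lemma finite_submsets: "finite {A. A \<subseteq># M}"
proof (rule finite_subset)
  show "{A. A \<subseteq># M} \<subseteq> {A. set_mset A \<subseteq> set_mset M \<and> size A \<le> size M}"
    by (auto dest: mset_subset_eqD size_mset_mono)
qed (simp add: finite_bounded_multisets)

lemma mon_weight_add: "mon_weight (A + B) = mon_weight A + mon_weight B"
  by (simp add: mon_weight_def)

text \<open>Weights add, so the pairs \<open>(M, A)\<close> correspond to pairs
  \<open>(A, M - A)\<close> of monomials within the two degree bounds; all other submultisets
  contribute 0.\<close>

lemma ps_mult: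
  assumes f: "degree_le D f" and g: "degree_le D' g"
  shows "principal_specialization (series_mult f g) = principal_specialization f * principal_specialization g"
proof (rule fps_ext)
  fix d
  let ?m = "monomials (D + D') d"
  let ?R = "\<Union>i\<in>{..d}. monomials D i \<times> monomials D' (d - i)"
  let ?L = "SIGMA M:?m. {A. A \<subseteq># M}"
  have finR: "finite ?R" using finite_monomials by auto
  have "fps_nth (principal_specialization (series_mult f g)) d
    = (\<Sum>M\<in>?m. \<Sum>A | A \<subseteq># M. f A * g (M - A))"
    using ps_nth[OF degree_le_mult[OF f g]] by (simp add: series_mult_def)
  also have "\<dots> = (\<Sum>(M, A)\<in>?L. f A * g (M - A))"
    by (rule sum.Sigma) (auto simp: finite_monomials finite_submsets)
  also have "\<dots> = (\<Sum>(M, A)\<in>{(M, A). A \<subseteq># M \<and> (A, M - A) \<in> ?R}. f A * g (M - A))"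
  proof (rule sum.mono_neutral_right)
    show "finite ?L" by (simp add: finite_monomials finite_submsets)
    show "{(M, A). A \<subseteq># M \<and> (A, M - A) \<in> ?R} \<subseteq> ?L"
    proof
      fix p assume "p \<in> {(M, A). A \<subseteq># M \<and> (A, M - A) \<in> ?R}"
      then obtain M A i where p: "p = (M, A)" "A \<subseteq># M" "i \<le> d" "A \<in> monomials D i"
        "M - A \<in> monomials D' (d - i)" by auto
      then have "size (A + (M - A)) \<le> D + D'" "mon_weight (A + (M - A)) = d"
        unfolding mon_weight_add size_union by (auto simp: monomials_def)
      then show "p \<in> ?L" using p by (simp add: monomials_def)
    qed
    show "\<forall>p\<in>?L - {(M, A). A \<subseteq># M \<and> (A, M - A) \<in> ?R}. (case p of (M, A) \<Rightarrow> f A * g (M - A)) = 0"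
    proof
      fix p assume "p \<in> ?L - {(M, A). A \<subseteq># M \<and> (A, M - A) \<in> ?R}"
      then obtain M A where p: "p = (M, A)" "M \<in> ?m" "A \<subseteq># M" "(A, M - A) \<notin> ?R" by auto
      have "f A * g (M - A) = 0"
      proof (rule ccontr)
        assume "f A * g (M - A) \<noteq> 0"
        then have "size A \<le> D" "size (M - A) \<le> D'" using f g by (auto simp: degree_le_def)
        moreover have "mon_weight A + mon_weight (M - A) = d"
          using p mon_weight_add[of A "M - A"] by (simp add: monomials_def)
        ultimately have "(A, M - A) \<in> ?R" by (auto simp: monomials_def intro!: bexI[of _ "mon_weight A"])
        then show False using p by blast
      qed
      then show "(case p of (M, A) \<Rightarrow> f A * g (M - A)) = 0" using p by simp
    qed
  qed
  also have "\<dots> = (\<Sum>(A, B)\<in>?R. f A * g B)"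
    by (rule sum.reindex_bij_witness[of _ "\<lambda>(A, B). (A + B, A)" "\<lambda>(M, A). (A, M - A)"]) auto
  also have "\<dots> = (\<Sum>i\<le>d. \<Sum>(A, B)\<in>monomials D i \<times> monomials D' (d - i). f A * g B)"
    using finite_monomials by (intro sum.UNION_disjoint) (auto simp: monomials_def)
  also have "\<dots> = (\<Sum>i\<le>d. fps_nth (principal_specialization f) i * fps_nth (principal_specialization g) (d - i))"
    by (simp add: ps_nth[OF f] ps_nth[OF g] sum_product sum.cartesian_product)
  finally show "fps_nth (principal_specialization (series_mult f g)) d
    = fps_nth (principal_specialization f * principal_specialization g) d"
    by (simp add: fps_mult_nth atLeast0AtMost)
qed

lemma ps_sum:
  assumes "finite I" "\<And>i. i \<in> I \<Longrightarrow> degree_le D (f i)"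
  shows "principal_specialization (\<lambda>M. \<Sum>i\<in>I. c i * f i M)
    = (\<Sum>i\<in>I. fps_const (c i) * principal_specialization (f i))"
proof (rule fps_ext)
  fix d
  have "degree_le D (\<lambda>M. \<Sum>i\<in>I. c i * f i M)"
    unfolding degree_le_def
  proof (intro allI impI)
    fix M assume "(\<Sum>i\<in>I. c i * f i M) \<noteq> 0"
    then obtain i where "i \<in> I" "c i * f i M \<noteq> 0" using sum.not_neutral_contains_not_neutral by force
    then show "size M \<le> D" using assms(2) by (auto simp: degree_le_def)
  qed
  then have "fps_nth (principal_specialization (\<lambda>M. \<Sum>i\<in>I. c i * f i M)) d
    = (\<Sum>M\<in>monomials D d. \<Sum>i\<in>I. c i * f i M)" by (rule ps_nth)
  also have "\<dots> = (\<Sum>i\<in>I. c i * (\<Sum>M\<in>monomials D d. f i M))"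
    by (subst sum.swap) (simp add: sum_distrib_left)
  also have "\<dots> = (\<Sum>i\<in>I. c i * fps_nth (principal_specialization (f i)) d)"
    by (rule sum.cong) (simp_all add: ps_nth[OF assms(2)])
  finally show "fps_nth (principal_specialization (\<lambda>M. \<Sum>i\<in>I. c i * f i M)) d
    = fps_nth (\<Sum>i\<in>I. fps_const (c i) * principal_specialization (f i)) d"
    by (simp add: fps_sum_nth)
qed

lemma degree_le_power_sum: "degree_le k (power_sum v k)"
  by (auto simp: degree_le_def power_sum_def)

text \<open>The geometric series in \<open>q^k\<close>: the variable of index \<open>i\<close>
  contributes \<open>q^(k (i - 1))\<close>, so \<open>q^d\<close> arises only for
  \<open>i = d / k + 1\<close>, and only if \<open>k\<close> divides \<open>d\<close>.\<close>

lemma ps_power_sum: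
  assumes v: "v = XVar \<or> v = YVar" and k: "0 < k"
  shows "principal_specialization (power_sum v k) = inverse (1 - fps_X ^ k)"
proof -
  have wt: "mon_weight (replicate_mset k (v i)) = k * (i - 1)" for i
    using v by (auto simp: mon_weight_def image_replicate_mset)
  have inj: "replicate_mset k (v i) = replicate_mset k (v j) \<longleftrightarrow> i = j" for i j
    using v k by (auto dest!: arg_cong[where f = set_mset])
  have nth: "fps_nth (principal_specialization (power_sum v k)) d = (if k dvd d then 1 else 0)" for d
  proof -
    have "fps_nth (principal_specialization (power_sum v k)) d
      = (\<Sum>M\<in>monomials k d. if \<exists>i\<ge>1. M = replicate_mset k (v i) then 1 else 0)"
      using ps_nth[OF degree_le_power_sum] by (simp add: power_sum_def)
    also have "\<dots> = of_nat (card {M \<in> monomials k d. \<exists>i\<ge>1. M = replicate_mset k (v i)})"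
      using sum.inter_filter[OF finite_monomials, of "\<lambda>_. 1 :: complex" k d
          "\<lambda>M. \<exists>i\<ge>1. M = replicate_mset k (v i)"] by simp
    also have "{M \<in> monomials k d. \<exists>i\<ge>1. M = replicate_mset k (v i)}
      = (if k dvd d then {replicate_mset k (v (Suc (d div k)))} else {})"
    proof -
      have "M \<in> monomials k d \<and> (\<exists>i\<ge>1. M = replicate_mset k (v i))
        \<longleftrightarrow> k dvd d \<and> M = replicate_mset k (v (Suc (d div k)))" for M
      proof
        assume "M \<in> monomials k d \<and> (\<exists>i\<ge>1. M = replicate_mset k (v i))"
        then obtain i where "i \<ge> 1" "M = replicate_mset k (v i)" "k * (i - 1) = d"
          using wt by (auto simp: monomials_def)
        then show "k dvd d \<and> M = replicate_mset k (v (Suc (d div k)))" using k by auto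
      next
        assume "k dvd d \<and> M = replicate_mset k (v (Suc (d div k)))"
        then show "M \<in> monomials k d \<and> (\<exists>i\<ge>1. M = replicate_mset k (v i))"
          using wt by (auto simp: monomials_def intro!: exI[of _ "Suc (d div k)"])
      qed
      then show ?thesis by auto
    qed
    finally show ?thesis by simp
  qed
  have "principal_specialization (power_sum v k) * (1 - fps_X ^ k) = 1"
  proof (rule fps_ext)
    fix d
    show "fps_nth (principal_specialization (power_sum v k) * (1 - fps_X ^ k)) d = fps_nth 1 d"
      using k by (auto simp: right_diff_distrib nth fps_X_power_mult_right_nth dvd_minus_self
          dest: dvd_imp_le)
  qed
  then show ?thesis
    using k by (metis fps_inverse_unique mult.commute)
qed

lemma degree_le_power_sum_partition: "degree_le (sum_list \<mu>) (power_sum_partition v \<mu>)"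
proof (induction \<mu>)
  case Nil
  then show ?case by (auto simp: power_sum_partition_def series_one_def degree_le_def)
next
  case (Cons k \<mu>)
  then show ?case using degree_le_mult[OF degree_le_power_sum]
    by (simp add: power_sum_partition_def)
qed

lemma ps_one: "principal_specialization series_one = 1"
proof (rule fps_ext)
  fix d
  have "degree_le 0 series_one" by (auto simp: degree_le_def series_one_def)
  moreover have "monomials 0 d = (if d = 0 then {{#}} else {})"
    by (auto simp: monomials_def mon_weight_def)
  ultimately show "fps_nth (principal_specialization series_one) d = fps_nth 1 d"
    by (simp add: ps_nth series_one_def)
qed

lemma ps_power_sum_partition:
  assumes "v = XVar \<or> v = YVar" "0 \<notin> set \<mu>"
  shows "principal_specialization (power_sum_partition v \<mu>) = (\<Prod>k\<in>#mset \<mu>. inverse (1 - fps_X ^ k))"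
  using assms(2)
proof (induction \<mu>)
  case Nil
  then show ?case by (simp add: power_sum_partition_def ps_one)
next
  case (Cons k \<mu>)
  have "principal_specialization (power_sum_partition v (k # \<mu>))
    = principal_specialization (power_sum v k) * principal_specialization (power_sum_partition v \<mu>)"
    using ps_mult[OF degree_le_power_sum degree_le_power_sum_partition]
    by (simp add: power_sum_partition_def)
  then show ?case using Cons ps_power_sum[OF assms(1), of k] by simp
qed

section \<open>Cycle types as multisets\<close>

definition mset_partitions :: "nat \<Rightarrow> nat multiset set" where
  "mset_partitions m = {M. 0 \<notin># M \<and> sum_mset M = m}"

definition z_mset :: "nat multiset \<Rightarrow> nat" where
  "z_mset M = (\<Prod>i\<in>set_mset M. i ^ count M i * fact (count M i))"

text \<open>If \<open>M\<close> lists the cycle lengths of a permutation, this is the number of ways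
  to select cycles whose lengths form \<open>A\<close>.\<close>

definition mset_choose :: "nat multiset \<Rightarrow> nat multiset \<Rightarrow> nat" where
  "mset_choose M A = (\<Prod>i\<in>set_mset M \<union> set_mset A. count M i choose count A i)"

lemma size_le_sum_mset: "0 \<notin># M \<Longrightarrow> size M \<le> sum_mset (M :: nat multiset)"
proof (induction M)
  case (add x M)
  then show ?case by (cases x) auto
qed simp

lemma member_le_sum_mset: "x \<in># M \<Longrightarrow> x \<le> sum_mset (M :: nat multiset)"
  by (auto dest!: multi_member_split)

lemma finite_mset_partitions: "finite (mset_partitions m)"
proof (rule finite_subset)
  show "mset_partitions m \<subseteq> {M. set_mset M \<subseteq> {..m} \<and> size M \<le> m}"
    using size_le_sum_mset member_le_sum_mset by (auto simp: mset_partitions_def)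
qed (simp add: finite_bounded_multisets)

lemma mset_partitions_0: "mset_partitions 0 = {{#}}"
proof -
  have "M = {#}" if "0 \<notin># M" "sum_mset M = 0" for M :: "nat multiset"
    using size_le_sum_mset[OF that(1)] that(2) by simp
  then show ?thesis by (auto simp: mset_partitions_def)
qed

lemma z_mset_eq:
  assumes "finite K" "set_mset M \<subseteq> K"
  shows "z_mset M = (\<Prod>i\<in>K. i ^ count M i * fact (count M i))"
  unfolding z_mset_def using assms by (intro prod.mono_neutral_left) (auto simp: not_in_iff)

lemma mset_choose_eq:
  assumes "finite K" "set_mset M \<subseteq> K" "set_mset A \<subseteq> K"
  shows "mset_choose M A = (\<Prod>i\<in>K. count M i choose count A i)"
  unfolding mset_choose_def using assms by (intro prod.mono_neutral_left) (auto simp: not_in_iff)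

lemma z_mset_pos: "0 \<notin># M \<Longrightarrow> 0 < z_mset M"
  unfolding z_mset_def by (rule prod_pos) (metis fact_gt_zero mult_pos_pos neq0_conv zero_less_power)

text \<open>For each length \<open>i\<close> this is the factorization of
  \<open>fact (count M i)\<close> through a binomial coefficient.\<close>

lemma z_mset_split:
  assumes "A \<subseteq># M"
  shows "z_mset M = mset_choose M A * (z_mset A * z_mset (M - A))"
proof -
  let ?K = "set_mset M"
  have K: "set_mset A \<subseteq> ?K" "set_mset (M - A) \<subseteq> ?K"
    using assms by (auto dest: mset_subset_eqD in_diffD)
  have "i ^ count M i * fact (count M i) = (count M i choose count A i) *
    ((i ^ count A i * fact (count A i)) * (i ^ count (M - A) i * fact (count (M - A) i)))" for i
  proof -
    have le: "count A i \<le> count M i" using assms by (simp add: mset_subset_eq_count)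
    have "i ^ count M i = i ^ count A i * i ^ (count M i - count A i)"
      using le by (simp add: power_add[symmetric])
    moreover have "fact (count M i) = fact (count A i) * fact (count M i - count A i) * (count M i choose count A i)"
      using binomial_fact_lemma[OF le] by simp
    ultimately show ?thesis by (simp add: mult_ac)
  qed
  then show ?thesis
    using K by (simp add: z_mset_eq[of ?K] mset_choose_eq[of ?K] prod.distrib[symmetric])
qed

lemma mset_choose_eq_0:
  assumes "\<not> A \<subseteq># M"
  shows "mset_choose M A = 0"
proof -
  obtain i where "count A i > count M i" using assms by (auto simp: subseteq_mset_def not_le)
  moreover from this have "i \<in># A" by (metis count_greater_zero_iff gr_implies_not0 neq0_conv)
  ultimately show ?thesis by (auto simp: mset_choose_def intro!: bexI[of _ i])
qed

text \<open>Pascal's rule in the factor for \<open>k\<close>, mirroring the decision whether an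
  additional cycle of length \<open>k\<close> is selected.\<close>

lemma mset_choose_add:
  "mset_choose (add_mset k M) A = mset_choose M A + (if k \<in># A then mset_choose M (A - {#k#}) else 0)"
proof -
  define K where "K = insert k (set_mset M \<union> set_mset A)"
  have K: "finite K" "set_mset (add_mset k M) \<subseteq> K" "set_mset M \<subseteq> K" "set_mset A \<subseteq> K"
    "set_mset (A - {#k#}) \<subseteq> K" "k \<in> K"
    by (auto simp: K_def dest: in_diffD)
  have split: "prod f K = f k * prod f (K - {k})" for f :: "nat \<Rightarrow> nat"
    using K by (simp add: prod.remove)
  let ?P = "\<Prod>i\<in>K - {k}. count M i choose count A i"
  have 1: "mset_choose (add_mset k M) A = (Suc (count M k) choose count A k) * ?P"
    unfolding mset_choose_eq[OF K(1,2,4)] split by (intro arg_cong2[of _ _ _ _ "(*)"] prod.cong) auto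
  have 2: "mset_choose M A = (count M k choose count A k) * ?P"
    unfolding mset_choose_eq[OF K(1,3,4)] split by simp
  have 3: "mset_choose M (A - {#k#}) = (count M k choose (count A k - 1)) * ?P"
    unfolding mset_choose_eq[OF K(1,3,5)] split by (intro arg_cong2[of _ _ _ _ "(*)"] prod.cong) auto
  show ?thesis
  proof (cases "count A k")
    case 0
    then have "k \<notin># A" by (simp add: not_in_iff)
    then show ?thesis using 1[unfolded 0] 2[unfolded 0] by simp
  next
    case (Suc c)
    then have "k \<in># A" by (metis Suc_neq_Zero not_in_iff)
    then show ?thesis using 1 2 3 Suc by (simp add: distrib_right)
  qed
qed

text \<open>Subsets are grouped by their multiset of labels. In the induction, omitting or using the
  new element gives the two terms of \<open>mset_choose_add\<close>.\<close>

lemma sum_Pow_image_mset: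
  fixes f :: "nat multiset \<Rightarrow> 'r::comm_semiring_1"
  assumes "finite R"
  shows "(\<Sum>R'\<in>Pow R. f (image_mset l (mset_set R')))
    = (\<Sum>A | A \<subseteq># image_mset l (mset_set R).
        of_nat (mset_choose (image_mset l (mset_set R)) A) * f A)"
  using assms
proof (induction R arbitrary: f rule: finite_induct)
  case empty
  then show ?case by (simp add: mset_choose_def)
next
  case (insert r R)
  let ?M = "image_mset l (mset_set R)" and ?k = "l r"
  let ?U = "{A. A \<subseteq># add_mset ?k ?M}"
  have M': "image_mset l (mset_set (insert r R)) = add_mset ?k ?M" using insert by simp
  have "(\<Sum>R'\<in>Pow (insert r R). f (image_mset l (mset_set R')))
    = (\<Sum>R'\<in>Pow R. f (image_mset l (mset_set R'))) + (\<Sum>R'\<in>insert r ` Pow R. f (image_mset l (mset_set R')))"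
    unfolding Pow_insert using insert by (intro sum.union_disjoint) auto
  also have "(\<Sum>R'\<in>insert r ` Pow R. f (image_mset l (mset_set R')))
    = (\<Sum>R'\<in>Pow R. f (image_mset l (mset_set (insert r R'))))"
  proof (subst sum.reindex)
    show "inj_on (insert r) (Pow R)"
      using insert(2) by (intro inj_onI) (metis Pow_iff insert_ident subsetD)
  qed simp
  also have "\<dots> = (\<Sum>R'\<in>Pow R. f (add_mset ?k (image_mset l (mset_set R'))))"
  proof (rule sum.cong[OF refl])
    fix R' assume "R' \<in> Pow R"
    then have "finite R'" "r \<notin> R'" using insert finite_subset by auto
    then show "f (image_mset l (mset_set (insert r R'))) = f (add_mset ?k (image_mset l (mset_set R')))"
      by simp
  qed
  also have "\<dots> = (\<Sum>A | A \<subseteq># ?M. of_nat (mset_choose ?M A) * f (add_mset ?k A))"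
    using insert.IH[of "\<lambda>A. f (add_mset ?k A)"] .
  also have "\<dots> = (\<Sum>A | A \<subseteq># add_mset ?k ?M \<and> ?k \<in># A. of_nat (mset_choose ?M (A - {#?k#})) * f A)"
    by (rule sum.reindex_bij_witness[of _ "\<lambda>A. A - {#?k#}" "add_mset ?k"])
      (auto simp: insert_subset_eq_iff subset_eq_diff_conv)
  also have "\<dots> = (\<Sum>A\<in>?U. if ?k \<in># A then of_nat (mset_choose ?M (A - {#?k#})) * f A else 0)"
    using sum.inter_filter[OF finite_submsets, of "\<lambda>A. of_nat (mset_choose ?M (A - {#?k#})) * f A"
        "add_mset ?k ?M" "\<lambda>A. ?k \<in># A"] by simp
  also have "(\<Sum>R'\<in>Pow R. f (image_mset l (mset_set R'))) = (\<Sum>A | A \<subseteq># ?M. of_nat (mset_choose ?M A) * f A)"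
    by (rule insert.IH)
  \<comment> \<open>\<open>mset_choose\<close> vanishes off the submultisets of its first argument,
    so the range may be enlarged to that of the other summand.\<close>
  also have "\<dots> = (\<Sum>A\<in>?U. of_nat (mset_choose ?M A) * f A)"
    using finite_submsets mset_choose_eq_0
    by (intro sum.mono_neutral_left) (auto intro: subset_mset.order_trans)
  finally show ?case
    unfolding M' mset_choose_add sum.distrib[symmetric]
    by (auto intro!: sum.cong simp: distrib_right)
qed

lemma sum_mset_partitions_split:
  fixes \<phi> :: "nat multiset \<Rightarrow> nat multiset \<Rightarrow> 'r::comm_monoid_add"
  assumes "a \<le> m"
  shows "(\<Sum>M\<in>mset_partitions m. \<Sum>A | A \<subseteq># M \<and> sum_mset A = a. \<phi> A (M - A))
    = (\<Sum>A\<in>mset_partitions a. \<Sum>B\<in>mset_partitions (m - a). \<phi> A B)"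
proof -
  have "(\<Sum>M\<in>mset_partitions m. \<Sum>A | A \<subseteq># M \<and> sum_mset A = a. \<phi> A (M - A))
    = (\<Sum>(M, A)\<in>(SIGMA M:mset_partitions m. {A. A \<subseteq># M \<and> sum_mset A = a}). \<phi> A (M - A))"
  proof (rule sum.Sigma)
    show "\<forall>M\<in>mset_partitions m. finite {A. A \<subseteq># M \<and> sum_mset A = a}"
      using finite_submsets by (metis (no_types, lifting) Collect_mono finite_subset)
  qed (rule finite_mset_partitions)
  also have "\<dots> = (\<Sum>(A, B)\<in>mset_partitions a \<times> mset_partitions (m - a). \<phi> A B)"
  proof (rule sum.reindex_bij_witness[of _ "\<lambda>(A, B). (A + B, A)" "\<lambda>(M, A). (A, M - A)"])
    fix p assume "p \<in> (SIGMA M:mset_partitions m. {A. A \<subseteq># M \<and> sum_mset A = a})"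
    then obtain M A where p: "p = (M, A)" "0 \<notin># M" "sum_mset M = m" "A \<subseteq># M" "sum_mset A = a"
      by (auto simp: mset_partitions_def)
    have "sum_mset (M - A) = m - a" using p by (simp add: sum_mset_diff)
    then show "(case p of (M, A) \<Rightarrow> (A, M - A)) \<in> mset_partitions a \<times> mset_partitions (m - a)"
      using p by (auto simp: mset_partitions_def dest: in_diffD mset_subset_eqD)
  qed (use assms in \<open>auto simp: mset_partitions_def\<close>)
  finally show ?thesis by (simp add: sum.cartesian_product)
qed

text \<open>The principal specialization of \<open>p_\<mu> / z_\<mu>\<close>, where \<open>M\<close>
  is the multiset of parts of \<open>\<mu>\<close>.\<close>

definition mset_weight :: "nat multiset \<Rightarrow> complex fps" where
  "mset_weight M = fps_const (1 / of_nat (z_mset M)) * (\<Prod>k\<in>#M. inverse (1 - fps_X ^ k))"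

text \<open>The geometric factors are multiplicative already; the binomial factor compensates
  exactly for \<open>z_mset\<close> not being so.\<close>

lemma mset_weight_split:
  assumes "A \<subseteq># M" "0 \<notin># M"
  shows "of_nat (mset_choose M A) * mset_weight M = mset_weight A * mset_weight (M - A)"
proof -
  have pos: "z_mset M \<noteq> 0" "z_mset A \<noteq> 0" "z_mset (M - A) \<noteq> 0"
  proof -
    have "0 \<notin># A" "0 \<notin># M - A" using assms mset_subset_eqD in_diffD by metis+
    then show "z_mset M \<noteq> 0" "z_mset A \<noteq> 0" "z_mset (M - A) \<noteq> 0" using z_mset_pos assms(2) by force+
  qed
  have w: "(\<Prod>k\<in>#M. inverse (1 - fps_X ^ k :: complex fps))
    = (\<Prod>k\<in>#A. inverse (1 - fps_X ^ k)) * (\<Prod>k\<in>#M - A. inverse (1 - fps_X ^ k))"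
    using assms(1) by (metis image_mset_union prod_mset.union subset_mset.add_diff_inverse)
  have "of_nat (mset_choose M A) * (1 / of_nat (z_mset M))
    = (1 / of_nat (z_mset A)) * (1 / of_nat (z_mset (M - A)) :: complex)"
    using pos unfolding z_mset_split[OF assms(1)] by (simp add: field_simps)
  then have "fps_const (of_nat (mset_choose M A)) * fps_const (1 / of_nat (z_mset M))
    = fps_const (1 / of_nat (z_mset A)) * fps_const (1 / of_nat (z_mset (M - A)) :: complex)"
    by (simp only: fps_const_mult)
  then show ?thesis unfolding mset_weight_def w fps_of_nat[symmetric]
    by (metis (no_types, lifting) mult.assoc mult.left_commute)
qed

text \<open>The case of a single part in \<open>mset_weight_split\<close>; the weight of
  \<open>{#k#}\<close> is \<open>1 / (k (1 - q^k))\<close>.\<close>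

lemma mset_weight_remove:
  assumes "k \<in># M" "0 \<notin># M"
  shows "of_nat (k * count M k) * mset_weight M = inverse (1 - fps_X ^ k) * mset_weight (M - {#k#})"
proof -
  have "mset_choose M {#k#} = (\<Prod>i\<in>set_mset M. count M i choose count {#k#} i)"
    using assms by (intro mset_choose_eq) auto
  also have "\<dots> = (\<Prod>i\<in>{k}. count M i choose count {#k#} i)"
    using assms by (intro prod.mono_neutral_right) auto
  finally have c: "mset_choose M {#k#} = count M k" by simp
  have k: "k \<noteq> 0" using assms by metis
  have "of_nat k * mset_weight {#k#} = inverse (1 - fps_X ^ k)"
    using k by (simp add: mset_weight_def z_mset_def fps_of_nat[symmetric] mult.assoc[symmetric]
        fps_const_mult)
  then show ?thesis
    using mset_weight_split[of "{#k#}" M] assms by (simp add: c mult.assoc)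
qed

lemma sum_mset_eq_sum_count: "sum_mset M = (\<Sum>k\<in>set_mset M. k * count M k)" for M :: "nat multiset"
proof (induction M)
  case (add x M)
  have "(\<Sum>k\<in>set_mset (add_mset x M). k * count (add_mset x M) k)
    = (\<Sum>k\<in>insert x (set_mset M). k * count M k + (if k = x then k else 0))"
    by (intro sum.cong) auto
  also have "\<dots> = (\<Sum>k\<in>insert x (set_mset M). k * count M k) + x"
    by (simp add: sum.distrib)
  also have "(\<Sum>k\<in>insert x (set_mset M). k * count M k) = (\<Sum>k\<in>set_mset M. k * count M k)"
    by (intro sum.mono_neutral_right) (auto simp: not_in_iff)
  finally show ?case using add by simp
qed simp

text \<open>The sum is the principal specialization of \<open>h_m\<close>. Writing \<open>m\<close>
  as the sum of the parts and removing one part \<open>k\<close> gives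
  \<open>m h_m = p_1 h_(m-1) + ... + p_m h_0\<close>, the same recursion that
  \<open>qpoch_newton\<close> provides for the right side.\<close>

lemma sum_mset_weight: "(\<Sum>M\<in>mset_partitions m. mset_weight M) = inverse (qpoch m)"
proof (induction m rule: less_induct)
  case (less m)
  show ?case
  proof (cases "m = 0")
    case True
    then show ?thesis by (simp add: mset_partitions_0 mset_weight_def z_mset_def qpoch_0)
  next
    case False
    let ?p = "\<lambda>k. inverse (1 - fps_X ^ k :: complex fps)"
    have "of_nat m * (\<Sum>M\<in>mset_partitions m. mset_weight M)
      = (\<Sum>M\<in>mset_partitions m. \<Sum>k\<in>set_mset M. ?p k * mset_weight (M - {#k#}))"
      unfolding sum_distrib_left
    proof (rule sum.cong[OF refl])
      fix M assume "M \<in> mset_partitions m"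
      then have M: "0 \<notin># M" "m = (\<Sum>k\<in>set_mset M. k * count M k)"
        using sum_mset_eq_sum_count by (auto simp: mset_partitions_def)
      have "of_nat m * mset_weight M = (\<Sum>k\<in>set_mset M. of_nat (k * count M k) * mset_weight M)"
        by (subst M(2)) (simp only: of_nat_sum sum_distrib_right)
      also have "\<dots> = (\<Sum>k\<in>set_mset M. ?p k * mset_weight (M - {#k#}))"
        by (rule sum.cong[OF refl]) (rule mset_weight_remove[OF _ M(1)])
      finally show "of_nat m * mset_weight M = (\<Sum>k\<in>set_mset M. ?p k * mset_weight (M - {#k#}))" .
    qed
    also have "\<dots> = (\<Sum>(M, k)\<in>(SIGMA M:mset_partitions m. set_mset M). ?p k * mset_weight (M - {#k#}))"
      by (rule sum.Sigma) (auto simp: finite_mset_partitions)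
    also have "\<dots> = (\<Sum>(k, N)\<in>(SIGMA k:{1..m}. mset_partitions (m - k)). ?p k * mset_weight N)"
    proof (rule sum.reindex_bij_witness[of _ "\<lambda>(k, N). (add_mset k N, k)" "\<lambda>(M, k). (k, M - {#k#})"])
      fix p assume "p \<in> (SIGMA M:mset_partitions m. set_mset M)"
      then obtain M k where p: "p = (M, k)" "0 \<notin># M" "sum_mset M = m" "k \<in># M"
        by (auto simp: mset_partitions_def)
      then have "k \<noteq> 0" "k \<le> m" "sum_mset (M - {#k#}) = m - k"
        using member_le_sum_mset[of k M] by (metis, simp, simp add: sum_mset_diff)
      then show "(case p of (M, k) \<Rightarrow> (k, M - {#k#})) \<in> (SIGMA k:{1..m}. mset_partitions (m - k))"
        using p by (auto simp: mset_partitions_def dest: in_diffD)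
    qed (auto simp: mset_partitions_def)
    also have "\<dots> = (\<Sum>k=1..m. \<Sum>N\<in>mset_partitions (m - k). ?p k * mset_weight N)"
      by (rule sum.Sigma[symmetric]) (auto simp: finite_mset_partitions)
    also have "\<dots> = (\<Sum>k=1..m. ?p k * inverse (qpoch (m - k)))"
      using less by (intro sum.cong) (auto simp: sum_distrib_left[symmetric])
    also have "\<dots> = of_nat m * inverse (qpoch m)" by (rule qpoch_newton[symmetric])
    finally show ?thesis using False by simp
  qed
qed

section \<open>Cycle types of permutations on invariant sets\<close>

definition cycle_mset :: "(nat \<Rightarrow> nat) \<Rightarrow> nat set \<Rightarrow> nat multiset" where
  "cycle_mset \<sigma> S = image_mset card (mset_set (orbit \<sigma> ` S))"

lemma invariant_orbit_subset:
  assumes "\<sigma> ` S \<subseteq> S" "x \<in> S"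
  shows "orbit \<sigma> x \<subseteq> S"
proof
  fix y assume "y \<in> orbit \<sigma> x"
  then show "y \<in> S" by induct (use assms in auto)
qed

lemma orbit_eq_of_mem: "permutation \<sigma> \<Longrightarrow> y \<in> orbit \<sigma> x \<Longrightarrow> orbit \<sigma> y = orbit \<sigma> x"
  by (rule orbit_cyclic_eq3[OF cyclic_on_orbit'])

lemma finite_orbit_permutation: "permutation \<sigma> \<Longrightarrow> finite (orbit \<sigma> x)"
  by (rule finite_orbit[OF permutation_self_in_orbit])

lemma Union_orbits:
  assumes "permutation \<sigma>" "\<sigma> ` S \<subseteq> S"
  shows "\<Union> (orbit \<sigma> ` S) = S"
  using invariant_orbit_subset[OF assms(2)] permutation_self_in_orbit[OF assms(1)] by blast

lemma sum_cycle_mset: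
  assumes "permutation \<sigma>" "\<sigma> ` S \<subseteq> S" "finite S"
  shows "sum_mset (cycle_mset \<sigma> S) = card S"
proof -
  have "sum_mset (cycle_mset \<sigma> S) = (\<Sum>C\<in>orbit \<sigma> ` S. card C)"
    by (simp add: cycle_mset_def sum_unfold_sum_mset)
  also have "\<dots> = card (\<Union> (orbit \<sigma> ` S))"
  proof (rule card_Union_disjoint[symmetric])
    show "pairwise disjnt (orbit \<sigma> ` S)"
    proof (rule pairwiseI)
      fix C D assume CD: "C \<in> orbit \<sigma> ` S" "D \<in> orbit \<sigma> ` S" "C \<noteq> D"
      then obtain x y where "C = orbit \<sigma> x" "D = orbit \<sigma> y" by blast
      then have "z \<notin> D" if "z \<in> C" for z
        using that CD(3) orbit_eq_of_mem[OF assms(1), of z x] orbit_eq_of_mem[OF assms(1), of z y] by auto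
      then show "disjnt C D" by (auto simp: disjnt_def)
    qed
  qed (auto simp: finite_orbit_permutation[OF assms(1)])
  finally show ?thesis by (simp add: Union_orbits[OF assms(1,2)])
qed

lemma permutation_subset_invariant:
  assumes "permutation \<sigma>" "finite S" "\<sigma> ` S \<subseteq> S"
  shows "\<sigma> ` S = S"
proof (rule card_subset_eq[OF assms(2,3)])
  have "inj_on \<sigma> S" using permutation_bijective[OF assms(1)] bij_is_inj inj_on_subset by blast
  then show "card (\<sigma> ` S) = card S" by (rule card_image)
qed

text \<open>The invariant subsets of \<open>A\<close> are the unions of orbits, so they correspond
  to subsets of the set of orbits, counted by \<open>sum_Pow_image_mset\<close>.\<close>

lemma sum_invariant_subsets:
  fixes f :: "nat multiset \<Rightarrow> 'r::comm_semiring_1"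
  assumes \<sigma>: "permutation \<sigma>" and A: "finite A" "\<sigma> ` A = A"
  shows "(\<Sum>S | S \<subseteq> A \<and> \<sigma> ` S = S. f (cycle_mset \<sigma> S))
    = (\<Sum>N | N \<subseteq># cycle_mset \<sigma> A. of_nat (mset_choose (cycle_mset \<sigma> A) N) * f N)"
proof -
  have "(\<Sum>S | S \<subseteq> A \<and> \<sigma> ` S = S. f (cycle_mset \<sigma> S))
    = (\<Sum>R\<in>Pow (orbit \<sigma> ` A). f (image_mset card (mset_set R)))"
  proof (rule sum.reindex_bij_witness[of _ Union "\<lambda>S. orbit \<sigma> ` S"])
    fix S assume S: "S \<in> {S. S \<subseteq> A \<and> \<sigma> ` S = S}"
    then show "\<Union> (orbit \<sigma> ` S) = S" by (intro Union_orbits[OF \<sigma>]) auto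
    show "orbit \<sigma> ` S \<in> Pow (orbit \<sigma> ` A)" using S by auto
    show "f (image_mset card (mset_set (orbit \<sigma> ` S))) = f (cycle_mset \<sigma> S)"
      by (simp add: cycle_mset_def)
  next
    fix R assume R: "R \<in> Pow (orbit \<sigma> ` A)"
    show "orbit \<sigma> ` \<Union> R = R"
    proof
      show "orbit \<sigma> ` \<Union> R \<subseteq> R"
      proof
        fix C assume "C \<in> orbit \<sigma> ` \<Union> R"
        then obtain y D where y: "C = orbit \<sigma> y" "y \<in> D" "D \<in> R" by auto
        then obtain x where "D = orbit \<sigma> x" using R by auto
        then show "C \<in> R" using y orbit_eq_of_mem[OF \<sigma>] by metis
      qed
      show "R \<subseteq> orbit \<sigma> ` \<Union> R"
      proof
        fix C assume C: "C \<in> R"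
        then obtain x where "C = orbit \<sigma> x" using R by auto
        then show "C \<in> orbit \<sigma> ` \<Union> R" using C permutation_self_in_orbit[OF \<sigma>, of x] by blast
      qed
    qed
    have sub: "\<Union> R \<subseteq> A" using R invariant_orbit_subset[of \<sigma> A] A by blast
    have "\<sigma> ` \<Union> R \<subseteq> \<Union> R"
    proof
      fix z assume "z \<in> \<sigma> ` \<Union> R"
      then obtain y D where y: "z = \<sigma> y" "y \<in> D" "D \<in> R" by auto
      then obtain x where "D = orbit \<sigma> x" using R by auto
      then show "z \<in> \<Union> R" using y orbit.step[of y \<sigma> x] by blast
    qed
    then have "\<sigma> ` \<Union> R = \<Union> R"
      using permutation_subset_invariant[OF \<sigma> finite_subset[OF sub A(1)]] by blast
    then show "\<Union> R \<in> {S. S \<subseteq> A \<and> \<sigma> ` S = S}" using sub by blast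
  qed
  also have "\<dots> = (\<Sum>N | N \<subseteq># cycle_mset \<sigma> A. of_nat (mset_choose (cycle_mset \<sigma> A) N) * f N)"
    unfolding cycle_mset_def using A by (intro sum_Pow_image_mset) auto
  finally show ?thesis .
qed

lemma ex_cyclic_permutation:
  assumes "finite A" "A \<noteq> {}"
  shows "\<exists>\<sigma>. \<sigma> permutes A \<and> cyclic_on \<sigma> A"
  using assms
proof (induction A rule: finite_ne_induct)
  case (singleton x)
  have "orbit id x = {x}" by (simp add: orbit_eq_singleton_iff)
  then have "cyclic_on id {x}" by (simp add: cyclic_on_def)
  then show ?case using permutes_id[of "{x}"] by blast
next
  case (insert a A)
  from insert.IH obtain \<sigma> where \<sigma>: "\<sigma> permutes A" "cyclic_on \<sigma> A" by (elim exE conjE)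
  obtain b where b: "b \<in> A" using insert.hyps(2) by blast
  \<comment> \<open>Inserts \<open>a\<close> into the cycle between \<open>b\<close> and
    \<open>\<sigma> b\<close>.\<close>
  define \<rho> where "\<rho> = \<sigma> \<circ> transpose a b"
  have \<rho>a: "\<rho> a = \<sigma> b" by (simp add: \<rho>_def)
  have \<rho>b: "\<rho> b = a" using \<sigma>(1) insert by (simp add: \<rho>_def permutes_not_in)
  have \<rho>y: "\<rho> y = \<sigma> y" if "y \<noteq> a" "y \<noteq> b" for y using that by (simp add: \<rho>_def transpose_def)
  have perm: "\<rho> permutes insert a A"
    unfolding \<rho>_def using b
    by (intro permutes_compose permutes_swap_id permutes_subset[OF \<sigma>(1)]) auto
  have orbA: "orbit \<sigma> b = A" using \<sigma>(2) b by (simp add: orbit_cyclic_eq3)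
  have "y \<in> orbit \<rho> a" if "y \<in> orbit \<sigma> b" for y
    using that
  proof induct
    case base
    then show ?case using orbit.base[of \<rho> a] by (simp add: \<rho>a)
  next
    case (step y)
    show ?case
    proof (cases "y = b")
      case True
      then show ?thesis using orbit.base[of \<rho> a] by (simp add: \<rho>a)
    next
      case False
      have "y \<noteq> a" using step(1) insert orbA by auto
      then show ?thesis using orbit.step[OF step(2)] \<rho>y False by simp
    qed
  qed
  then have sub: "A \<subseteq> orbit \<rho> a" using orbA by blast
  have "a \<in> orbit \<rho> a" using orbit.step[of b \<rho> a] sub b \<rho>b by auto
  then have "insert a A = orbit \<rho> a" using sub permutes_orbit_subset[OF perm, of a] by auto
  then show ?case using perm by (auto simp: cyclic_on_def)
qed

text \<open>Guarantees that the choice in \<open>perm_of_type\<close> meets its specification. The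
  permutation is built one part at a time, by composing a cycle on \<open>k\<close> elements with a
  permutation of the rest.\<close>

lemma ex_permutes_cycle_mset:
  assumes "0 \<notin># M" "finite A" "card A = sum_mset M"
  shows "\<exists>\<sigma>. \<sigma> permutes A \<and> cycle_mset \<sigma> A = M"
  using assms
proof (induction M arbitrary: A)
  case empty
  then show ?case by (intro exI[of _ id]) (auto simp: cycle_mset_def permutes_id)
next
  case (add k M)
  then have k: "k > 0" by (cases k) auto
  have "k \<le> card A" using add by simp
  then obtain A1 where A1: "A1 \<subseteq> A" "card A1 = k" "finite A1"
    by (meson obtain_subset_with_card_n)
  define A2 where "A2 = A - A1"
  have A2: "finite A2" "card A2 = sum_mset M" "A1 \<inter> A2 = {}" "A = A1 \<union> A2"
    using add A1 by (auto simp: A2_def card_Diff_subset)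
  obtain \<sigma>2 where \<sigma>2: "\<sigma>2 permutes A2" "cycle_mset \<sigma>2 A2 = M" using add A2 by auto
  have "A1 \<noteq> {}" using A1 k by auto
  then obtain \<sigma>1 where \<sigma>1: "\<sigma>1 permutes A1" "cyclic_on \<sigma>1 A1"
    using ex_cyclic_permutation A1 by blast
  define \<sigma> where "\<sigma> = \<sigma>1 \<circ> \<sigma>2"
  have perm: "\<sigma> permutes A"
    unfolding \<sigma>_def using A2(4)
    by (intro permutes_compose permutes_subset[OF \<sigma>1(1)] permutes_subset[OF \<sigma>2(1)]) auto
  have o1: "orbit \<sigma> x = A1" if x: "x \<in> A1" for x
  proof -
    have "orbit \<sigma>1 x = orbit \<sigma> x"
    proof (rule orbit_cong0[OF x])
      show "\<sigma>1 \<in> A1 \<rightarrow> A1" using permutes_in_image[OF \<sigma>1(1)] by auto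
      show "\<sigma>1 y = \<sigma> y" if "y \<in> A1" for y
      proof -
        have "y \<notin> A2" using that A2(3) by blast
        then show ?thesis using permutes_not_in[OF \<sigma>2(1)] by (simp add: \<sigma>_def)
      qed
    qed
    then show ?thesis using orbit_cyclic_eq3[OF \<sigma>1(2) x] by simp
  qed
  have o2: "orbit \<sigma> x = orbit \<sigma>2 x" if x: "x \<in> A2" for x
  proof (rule sym, rule orbit_cong0[OF x])
    show in2: "\<sigma>2 \<in> A2 \<rightarrow> A2" using permutes_in_image[OF \<sigma>2(1)] by auto
    show "\<sigma>2 y = \<sigma> y" if "y \<in> A2" for y
    proof -
      have "\<sigma>2 y \<in> A2" using in2 that by auto
      then have "\<sigma>2 y \<notin> A1" using A2(3) by auto
      then show ?thesis using permutes_not_in[OF \<sigma>1(1)] by (simp add: \<sigma>_def)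
    qed
  qed
  have "orbit \<sigma> ` A = orbit \<sigma> ` A1 \<union> orbit \<sigma> ` A2" using A2(4) by (simp add: image_Un)
  also have "orbit \<sigma> ` A1 = {A1}" using o1 \<open>A1 \<noteq> {}\<close> by auto
  also have "orbit \<sigma> ` A2 = orbit \<sigma>2 ` A2" using o2 by auto
  finally have orb: "orbit \<sigma> ` A = insert A1 (orbit \<sigma>2 ` A2)" by simp
  \<comment> \<open>\<open>cycle_mset\<close> runs over a set of orbits, so the new part is counted
    only if its orbit is not already present.\<close>
  have "A1 \<notin> orbit \<sigma>2 ` A2"
    using permutes_orbit_subset[OF \<sigma>2(1)] A2(3) \<open>A1 \<noteq> {}\<close> by blast
  then have "cycle_mset \<sigma> A = add_mset k (cycle_mset \<sigma>2 A2)"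
    unfolding cycle_mset_def orb using A2(1) A1 by simp
  then show ?case using perm \<sigma>2 by auto
qed

section \<open>Signed sums over chains\<close>

lemma segre_interiorI:
  assumes "fst x \<subseteq> A" "snd x \<subseteq> B" "card (fst x) = card (snd x)" "0 < card (fst x)" "card (fst x) < card A"
  shows "x \<in> segre_interior A B"
  using assms by (cases x) (simp add: segre_interior_def)

lemma segre_interior_trans:
  assumes "finite A" "finite B" "x \<in> segre_interior A B"
  shows "y \<in> segre_interior (fst x) (snd x) \<longleftrightarrow> y \<in> segre_interior A B \<and> y < x"
proof
  assume y: "y \<in> segre_interior (fst x) (snd x)"
  note yD = segre_interiorD[OF y] and xD = segre_interiorD[OF assms(3)]
  have "y \<in> segre_interior A B"
    by (rule segre_interiorI) (use yD xD in auto)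
  moreover have "y \<le> x" "y \<noteq> x" using yD by (auto simp: less_eq_prod_def)
  ultimately show "y \<in> segre_interior A B \<and> y < x" by simp
next
  assume y: "y \<in> segre_interior A B \<and> y < x"
  note yD = segre_interiorD[of y A B] and l = segre_interior_less[OF assms(1,2) _ assms(3), of y]
  show "y \<in> segre_interior (fst x) (snd x)"
    by (rule segre_interiorI) (use y yD l in auto)
qed

lemma segre_chains_append:
  assumes "finite A" "finite B" "x \<in> segre_interior A B"
  shows "c @ [x] \<in> segre_chains A B \<longleftrightarrow> c \<in> segre_chains (fst x) (snd x)"
proof -
  have "set c \<subseteq> segre_interior (fst x) (snd x) \<longleftrightarrow> set c \<subseteq> segre_interior A B \<and> (\<forall>y\<in>set c. y < x)"
    using segre_interior_trans[OF assms] by blast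
  then show ?thesis using assms(3) unfolding segre_chains_def mem_Collect_eq sorted_wrt_append
    by auto
qed

text \<open>A nonempty chain is its last member \<open>x\<close> together with an arbitrary chain of
  the Segre interior below \<open>x\<close>.\<close>

lemma sum_segre_chains_last:
  fixes f :: "(nat set \<times> nat set) list \<Rightarrow> 'r::comm_monoid_add"
  assumes fin: "finite A" "finite B"
  shows "(\<Sum>c\<in>segre_chains A B. f c)
    = f [] + (\<Sum>x\<in>segre_interior A B. \<Sum>c\<in>segre_chains (fst x) (snd x). f (c @ [x]))"
proof -
  have fin': "finite (segre_chains (fst x) (snd x))" if "x \<in> segre_interior A B" for x
    using segre_interiorD[OF that] fin by (intro finite_segre_chains) (auto dest: finite_subset)
  have "(\<Sum>c\<in>segre_chains A B. f c) = f [] + (\<Sum>c\<in>segre_chains A B - {[]}. f c)"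
    using finite_segre_chains[OF fin] by (intro sum.remove) (auto simp: segre_chains_def)
  also have "(\<Sum>c\<in>segre_chains A B - {[]}. f c)
    = (\<Sum>(x, c)\<in>(SIGMA x:segre_interior A B. segre_chains (fst x) (snd x)). f (c @ [x]))"
  proof (rule sum.reindex_bij_witness[of _ "\<lambda>(x, c). c @ [x]" "\<lambda>xs. (last xs, butlast xs)"])
    fix xs assume xs: "xs \<in> segre_chains A B - {[]}"
    then have "last xs \<in> segre_interior A B" using last_in_set[of xs] by (auto simp: segre_chains_def)
    then show "(last xs, butlast xs) \<in> (SIGMA x:segre_interior A B. segre_chains (fst x) (snd x))"
      using xs segre_chains_append[OF fin, of "last xs" "butlast xs"] by simp
  qed (use segre_chains_append[OF fin] in auto)
  also have "\<dots> = (\<Sum>x\<in>segre_interior A B. \<Sum>c\<in>segre_chains (fst x) (snd x). f (c @ [x]))"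
    using fin' finite_segre_interior[OF fin] by (intro sum.Sigma[symmetric]) auto
  finally show ?thesis .
qed

lemma sum_segre_interior:
  fixes f :: "nat set \<Rightarrow> nat set \<Rightarrow> 'r::comm_monoid_add"
  assumes "finite A" "finite B"
  shows "(\<Sum>x\<in>segre_interior A B. f (fst x) (snd x))
    = (\<Sum>a\<in>{1..<card A}. \<Sum>S | S \<subseteq> A \<and> card S = a. \<Sum>T | T \<subseteq> B \<and> card T = a. f S T)"
proof -
  let ?g = "\<lambda>a. {S. S \<subseteq> A \<and> card S = a} \<times> {T. T \<subseteq> B \<and> card T = a}"
  have "segre_interior A B = (\<Union>a\<in>{1..<card A}. ?g a)"
    by (auto simp: segre_interior_def)
  then have "(\<Sum>x\<in>segre_interior A B. f (fst x) (snd x)) = (\<Sum>x\<in>(\<Union>a\<in>{1..<card A}. ?g a). f (fst x) (snd x))"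
    by simp
  also have "\<dots> = (\<Sum>a\<in>{1..<card A}. \<Sum>x\<in>?g a. f (fst x) (snd x))"
    using assms by (intro sum.UNION_disjoint) auto
  also have "\<dots> = (\<Sum>a\<in>{1..<card A}. \<Sum>S | S \<subseteq> A \<and> card S = a. \<Sum>T | T \<subseteq> B \<and> card T = a. f S T)"
    by (simp add: sum.cartesian_product split_beta)
  finally show ?thesis .
qed

text \<open>The specialized alternating sum over compositions of \<open>m\<close>: \<open>a\<close>
  is the rank of the last member of a chain and \<open>m - a\<close> the last part. The exponent
  \<open>m + a + 1\<close> has the parity of \<open>m - a - 1\<close> and avoids truncated
  subtraction.\<close>

function segre_series :: "nat \<Rightarrow> complex fps" where
  "segre_series m = (-1) ^ (m + 1) * (inverse (qpoch m))\<^sup>2 +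
     (\<Sum>a\<in>{1..<m}. (-1) ^ (m + a + 1) * (inverse (qpoch (m - a)))\<^sup>2 * segre_series a)"
  by pat_completeness auto
termination by (relation "measure id") auto

declare segre_series.simps [simp del]

text \<open>The sign is normalized so that chains of the maximal length \<open>card A - 1\<close>
  count positively.\<close>

definition inv_series :: "nat set \<Rightarrow> nat set \<Rightarrow> complex fps" where
  "inv_series A B = (\<Sum>c\<in>segre_chains A B.
     (-1) ^ (card A + 1 + length c) * fps_X ^ card (chain_inv A B (set c)))"

text \<open>An inversion separated by an earlier member has its larger entry inside the last member
  \<open>x\<close>. If the smaller entry lies outside, \<open>x\<close> separates it already;
  otherwise it is an inversion within the interval below \<open>x\<close>.\<close>

lemma card_chain_inv_append:
  assumes fin: "finite A" "finite B" and x: "x \<in> segre_interior A B"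
    and c: "c \<in> segre_chains (fst x) (snd x)"
  shows "card (chain_inv A B (set (c @ [x]))) = card (cut_inv A (fst x)) + card (cut_inv B (snd x))
    + card (chain_inv (fst x) (snd x) (set c))"
proof -
  have xD: "fst x \<subseteq> A" "snd x \<subseteq> B" using segre_interiorD[OF x] by auto
  have fx: "finite (fst x)" "finite (snd x)" using xD fin finite_subset by auto
  have eD: "fst e \<subseteq> fst x" "snd e \<subseteq> snd x" if "e \<in> set c" for e
    using c that segre_interiorD[of e "fst x" "snd x"] by (auto simp: segre_chains_def)
  have un: "chain_inv A B (set (c @ [x])) = sep_inv A B x \<union> chain_inv (fst x) (snd x) (set c)"
  proof (rule Set.set_eqI)
    fix p
    show "p \<in> chain_inv A B (set (c @ [x])) \<longleftrightarrow> p \<in> sep_inv A B x \<union> chain_inv (fst x) (snd x) (set c)"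
    proof (cases p)
      case (Inl q)
      show ?thesis unfolding Inl Inl_in_chain_inv Un_iff
        using eD(1) xD(1) by (cases q) (auto simp: sep_inv_def cut_inv_def)
    next
      case (Inr q)
      show ?thesis unfolding Inr Inr_in_chain_inv Un_iff
        using eD(2) xD(2) by (cases q) (auto simp: sep_inv_def cut_inv_def)
    qed
  qed
  have dis: "sep_inv A B x \<inter> chain_inv (fst x) (snd x) (set c) = {}"
    by (auto simp: sep_inv_def cut_inv_def chain_inv_def)
  have f1: "finite (cut_inv A (fst x))" "finite (cut_inv B (snd x))"
    using finite_cut_inv fin xD by auto
  have f2: "finite (chain_inv (fst x) (snd x) (set c))"
    using finite_chain_inv[OF fx] c by (auto simp: segre_chains_def)
  show ?thesis unfolding un using f1 f2 dis
    by (subst card_Un_disjoint) (auto simp: sep_inv_def card_Plus)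
qed

text \<open>The exponents of the two sides differ by \<open>2 * s\<close>.\<close>

lemma sign_append:
  "(-1) ^ (m + 1 + (l + 1)) = (-1) ^ (m + s + 1) * ((-1) ^ (s + 1 + l) :: 'r::comm_ring_1)"
proof -
  have "(-1) ^ (m + s + 1) * ((-1) ^ (s + 1 + l) :: 'r) = (-1) ^ ((m + 1 + (l + 1)) + 2 * s)"
    by (simp only: power_add[symmetric]) (rule arg_cong[of _ _ "\<lambda>k. (-1) ^ k"], simp)
  then show ?thesis by (simp add: power_add)
qed

lemma qbinomial_subsets':
  assumes "finite A" "a \<le> card A"
  shows "(\<Sum>S | S \<subseteq> A \<and> card S = a. fps_X ^ card (cut_inv A S))
    = qpoch (card A) * (inverse (qpoch a) * inverse (qpoch (card A - a)))"
proof -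
  let ?b = "\<Sum>S | S \<subseteq> A \<and> card S = a. fps_X ^ card (cut_inv A S) :: complex fps"
  have "?b = ?b * (qpoch a * inverse (qpoch a)) * (qpoch (card A - a) * inverse (qpoch (card A - a)))"
    by (simp add: qpoch_inverse)
  also have "\<dots> = ?b * (qpoch a * qpoch (card A - a)) * (inverse (qpoch a) * inverse (qpoch (card A - a)))"
    by (simp only: mult_ac)
  finally show ?thesis unfolding qbinomial_subsets[OF assms] .
qed

text \<open>For a last member \<open>(S, T)\<close> of size \<open>a\<close>, the sums over
  \<open>S\<close> and \<open>T\<close> give two Gaussian binomials. Their denominators
  \<open>(q; q)_a\<close> cancel against the factor from the induction hypothesis and leave the
  recursion of \<open>segre_series\<close>.\<close>

lemma inv_series_eq:
  assumes "finite A" "finite B" "card A = card B"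
  shows "inv_series A B = (qpoch (card A))\<^sup>2 * segre_series (card A)"
  using assms
proof (induction "card A" arbitrary: A B rule: less_induct)
  case less
  note fin = less.prems(1,2)
  let ?m = "card A" and ?h = "\<lambda>m. inverse (qpoch m)"
  let ?F = "\<lambda>S T. (-1) ^ (?m + card S + 1) * fps_X ^ card (cut_inv A S) * fps_X ^ card (cut_inv B T) *
     ((qpoch (card S))\<^sup>2 * segre_series (card S))"
  have "inv_series A B = (-1) ^ (?m + 1) + (\<Sum>x\<in>segre_interior A B. \<Sum>c\<in>segre_chains (fst x) (snd x).
      (-1) ^ (?m + 1 + length (c @ [x])) * fps_X ^ card (chain_inv A B (set (c @ [x]))))"
    unfolding inv_series_def sum_segre_chains_last[OF fin] by (simp add: chain_inv_def)
  also have "(\<Sum>x\<in>segre_interior A B. \<Sum>c\<in>segre_chains (fst x) (snd x).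
      (-1) ^ (?m + 1 + length (c @ [x])) * fps_X ^ card (chain_inv A B (set (c @ [x]))) :: complex fps)
    = (\<Sum>x\<in>segre_interior A B. ?F (fst x) (snd x))"
  proof (rule sum.cong[OF refl])
    fix x assume x: "x \<in> segre_interior A B"
    note xD = segre_interiorD[OF x]
    have fx: "finite (fst x)" "finite (snd x)" using xD fin finite_subset by auto
    have "(\<Sum>c\<in>segre_chains (fst x) (snd x).
        (-1) ^ (?m + 1 + length (c @ [x])) * fps_X ^ card (chain_inv A B (set (c @ [x]))) :: complex fps)
      = (\<Sum>c\<in>segre_chains (fst x) (snd x). (-1) ^ (?m + card (fst x) + 1) * fps_X ^ card (cut_inv A (fst x))
          * fps_X ^ card (cut_inv B (snd x))
          * ((-1) ^ (card (fst x) + 1 + length c) * fps_X ^ card (chain_inv (fst x) (snd x) (set c))))"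
    proof (rule sum.cong[OF refl])
      fix c assume c: "c \<in> segre_chains (fst x) (snd x)"
      have "(-1) ^ (?m + 1 + length (c @ [x])) =
        (-1) ^ (?m + card (fst x) + 1) * ((-1) ^ (card (fst x) + 1 + length c) :: complex fps)"
        using sign_append[of ?m "length c" "card (fst x)"] by simp
      then show "(-1) ^ (?m + 1 + length (c @ [x])) * fps_X ^ card (chain_inv A B (set (c @ [x])))
        = (-1) ^ (?m + card (fst x) + 1) * fps_X ^ card (cut_inv A (fst x)) * fps_X ^ card (cut_inv B (snd x))
          * ((-1) ^ (card (fst x) + 1 + length c) * fps_X ^ card (chain_inv (fst x) (snd x) (set c)) :: complex fps)"
        unfolding card_chain_inv_append[OF fin x c] power_add[of fps_X] by (simp only: mult_ac)
    qed
    also have "\<dots> = (-1) ^ (?m + card (fst x) + 1) * fps_X ^ card (cut_inv A (fst x))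
          * fps_X ^ card (cut_inv B (snd x)) * inv_series (fst x) (snd x)"
      by (simp only: inv_series_def sum_distrib_left)
    also have "inv_series (fst x) (snd x) = (qpoch (card (fst x)))\<^sup>2 * segre_series (card (fst x))"
      using xD fx by (intro less.hyps) auto
    finally show "(\<Sum>c\<in>segre_chains (fst x) (snd x).
        (-1) ^ (?m + 1 + length (c @ [x])) * fps_X ^ card (chain_inv A B (set (c @ [x]))))
      = ?F (fst x) (snd x)" .
  qed
  also have "\<dots> = (\<Sum>a\<in>{1..<?m}. \<Sum>S | S \<subseteq> A \<and> card S = a. \<Sum>T | T \<subseteq> B \<and> card T = a. ?F S T)"
    by (rule sum_segre_interior[OF fin])
  also have "\<dots> = (\<Sum>a\<in>{1..<?m}. (qpoch ?m)\<^sup>2 * ((-1) ^ (?m + a + 1) * (?h (?m - a))\<^sup>2 * segre_series a))"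
  proof (rule sum.cong[OF refl])
    fix a assume a: "a \<in> {1..<?m}"
    have "(\<Sum>S | S \<subseteq> A \<and> card S = a. \<Sum>T | T \<subseteq> B \<and> card T = a. ?F S T)
      = (\<Sum>S | S \<subseteq> A \<and> card S = a. \<Sum>T | T \<subseteq> B \<and> card T = a.
          fps_X ^ card (cut_inv A S) * fps_X ^ card (cut_inv B T) *
          ((-1) ^ (?m + a + 1) * ((qpoch a)\<^sup>2 * segre_series a)))"
      by (intro sum.cong refl) (auto simp: mult_ac)
    also have "\<dots> = (\<Sum>S | S \<subseteq> A \<and> card S = a. fps_X ^ card (cut_inv A S)) *
        (\<Sum>T | T \<subseteq> B \<and> card T = a. fps_X ^ card (cut_inv B T)) *
        ((-1) ^ (?m + a + 1) * ((qpoch a)\<^sup>2 * segre_series a))"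
      by (subst sum_product) (simp only: sum_distrib_right)
    also have "\<dots> = (qpoch ?m * (?h a * ?h (?m - a))) * (qpoch ?m * (?h a * ?h (?m - a))) *
        ((-1) ^ (?m + a + 1) * ((qpoch a)\<^sup>2 * segre_series a))"
      using a qbinomial_subsets'[OF fin(1), of a] qbinomial_subsets'[OF fin(2), of a] less.prems(3) by simp
    also have "\<dots> = (?h a * qpoch a) * (?h a * qpoch a) *
        ((qpoch ?m)\<^sup>2 * ((-1) ^ (?m + a + 1) * (?h (?m - a))\<^sup>2 * segre_series a))"
      unfolding power2_eq_square by (simp only: mult_ac)
    finally show "(\<Sum>S | S \<subseteq> A \<and> card S = a. \<Sum>T | T \<subseteq> B \<and> card T = a. ?F S T)
      = (qpoch ?m)\<^sup>2 * ((-1) ^ (?m + a + 1) * (?h (?m - a))\<^sup>2 * segre_series a)"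
      by (simp add: qpoch_inverse)
  qed
  also have "(-1) ^ (?m + 1) + \<dots> = (qpoch ?m)\<^sup>2 * segre_series ?m"
  proof -
    have "(qpoch ?m)\<^sup>2 * ((-1) ^ (?m + 1) * (?h ?m)\<^sup>2) = (qpoch ?m * ?h ?m) * (qpoch ?m * ?h ?m) * (-1) ^ (?m + 1)"
      unfolding power2_eq_square by (simp only: mult_ac)
    then have "(qpoch ?m)\<^sup>2 * ((-1) ^ (?m + 1) * (?h ?m)\<^sup>2) = (-1) ^ (?m + 1)"
      by (simp add: qpoch_inverse)
    then show ?thesis unfolding segre_series.simps[of ?m] distrib_left sum_distrib_left by simp
  qed
  finally show ?case .
qed

text \<open>The signed count of fixed chains in terms of the two cycle types alone: \<open>A\<close>
  and \<open>B\<close> are the cycle types on the last member of the chain, and the binomial factors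
  count the invariant sets having these types.\<close>

function fixed_chain_sum :: "nat multiset \<Rightarrow> nat multiset \<Rightarrow> complex" where
  "fixed_chain_sum M N = (-1) ^ (sum_mset M + 1) +
     (\<Sum>A | A \<subseteq># M \<and> 0 < sum_mset A \<and> sum_mset A < sum_mset M. \<Sum>B | B \<subseteq># N \<and> sum_mset B = sum_mset A.
        (-1) ^ (sum_mset M + sum_mset A + 1) * (of_nat (mset_choose M A) * of_nat (mset_choose N B))
          * fixed_chain_sum A B)"
  by pat_completeness auto
termination by (relation "measure (\<lambda>(M, N). sum_mset M)") auto

declare fixed_chain_sum.simps [simp del]

text \<open>Splitting \<open>M\<close> into \<open>A\<close> and its complement factors the weight.
  The complement ranges over all partitions of \<open>m - a\<close>, which sum to the specialization
  of \<open>h_(m-a)\<close>.\<close>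

lemma sum_mset_weight_choose:
  assumes "a \<le> m"
  shows "(\<Sum>M\<in>mset_partitions m. \<Sum>A | A \<subseteq># M \<and> sum_mset A = a. of_nat (mset_choose M A) * mset_weight M * \<phi> A)
    = inverse (qpoch (m - a)) * (\<Sum>A\<in>mset_partitions a. mset_weight A * \<phi> A)"
proof -
  have "(\<Sum>M\<in>mset_partitions m. \<Sum>A | A \<subseteq># M \<and> sum_mset A = a. of_nat (mset_choose M A) * mset_weight M * \<phi> A)
    = (\<Sum>M\<in>mset_partitions m. \<Sum>A | A \<subseteq># M \<and> sum_mset A = a. mset_weight A * mset_weight (M - A) * \<phi> A)"
    by (intro sum.cong refl) (auto simp: mset_weight_split mset_partitions_def)
  also have "\<dots> = (\<Sum>A\<in>mset_partitions a. \<Sum>B\<in>mset_partitions (m - a). mset_weight A * mset_weight B * \<phi> A)"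
    using sum_mset_partitions_split[OF assms, of "\<lambda>A B. mset_weight A * mset_weight B * \<phi> A"] .
  also have "\<dots> = (\<Sum>B\<in>mset_partitions (m - a). mset_weight B) * (\<Sum>A\<in>mset_partitions a. mset_weight A * \<phi> A)"
    by (subst sum.swap) (simp add: sum_product mult_ac)
  finally show ?thesis by (simp add: sum_mset_weight)
qed

lemma fps_const_sum': "fps_const (\<Sum>i\<in>I. f i :: complex) = (\<Sum>i\<in>I. fps_const (f i))"
  by (induction I rule: infinite_finite_induct) (auto simp flip: fps_const_add)

lemma fps_const_minus_one_power: "fps_const ((-1) ^ k :: complex) = (-1) ^ k"
  by (induction k) (auto simp flip: fps_const_mult fps_const_neg)

lemma sum_submsets_by_sum:
  fixes f :: "nat multiset \<Rightarrow> nat \<Rightarrow> 'r::comm_monoid_add"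
  shows "(\<Sum>A | A \<subseteq># M \<and> 0 < sum_mset A \<and> sum_mset A < m. f A (sum_mset A))
    = (\<Sum>a\<in>{1..<m}. \<Sum>A | A \<subseteq># M \<and> sum_mset A = a. f A a)"
proof -
  have fin: "finite {A. A \<subseteq># M \<and> P A}" for P
    by (rule finite_subset[OF _ finite_submsets[of M]]) auto
  have "{A. A \<subseteq># M \<and> 0 < sum_mset A \<and> sum_mset A < m}
    = (\<Union>a\<in>{1..<m}. {A. A \<subseteq># M \<and> sum_mset A = a})" by auto
  then have "(\<Sum>A | A \<subseteq># M \<and> 0 < sum_mset A \<and> sum_mset A < m. f A (sum_mset A))
    = (\<Sum>A\<in>(\<Union>a\<in>{1..<m}. {A. A \<subseteq># M \<and> sum_mset A = a}). f A (sum_mset A))" by simp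
  also have "\<dots> = (\<Sum>a\<in>{1..<m}. \<Sum>A | A \<subseteq># M \<and> sum_mset A = a. f A (sum_mset A))"
    using fin by (intro sum.UNION_disjoint) auto
  also have "\<dots> = (\<Sum>a\<in>{1..<m}. \<Sum>A | A \<subseteq># M \<and> sum_mset A = a. f A a)"
    by (intro sum.cong refl) auto
  finally show ?thesis .
qed

text \<open>\<open>sum_mset_weight_choose\<close> is applied once in each coordinate. Both
  applications yield the same factor, whence the square in \<open>segre_series\<close>; the rest is
  reordering of sums.\<close>

lemma sum_weight_fixed_chain_sum:
  "(\<Sum>M\<in>mset_partitions m. \<Sum>N\<in>mset_partitions m.
      mset_weight M * mset_weight N * fps_const (fixed_chain_sum M N)) = segre_series m"
proof (induction m rule: less_induct)
  case (less m)
  let ?P = mset_partitions and ?w = mset_weight and ?h = "\<lambda>m. inverse (qpoch m)"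
  let ?c = "\<lambda>M A. of_nat (mset_choose M A) :: complex fps"
  let ?X = "\<lambda>A B. fps_const (fixed_chain_sum A B)"
  let ?t = "\<lambda>a M N A B. (?c M A * ?w M) * ((-1) ^ (m + a + 1) * (?c N B * ?w N * ?X A B))"
  have X: "?w M * ?w N * ?X M N = (-1) ^ (m + 1) * (?w M * ?w N) +
      (\<Sum>a\<in>{1..<m}. \<Sum>A | A \<subseteq># M \<and> sum_mset A = a. \<Sum>B | B \<subseteq># N \<and> sum_mset B = a. ?t a M N A B)"
    if M: "M \<in> ?P m" for M N
  proof -
    have m: "sum_mset M = m" using M by (simp add: mset_partitions_def)
    have "?X M N = (-1) ^ (m + 1) + (\<Sum>A | A \<subseteq># M \<and> 0 < sum_mset A \<and> sum_mset A < m.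
        \<Sum>B | B \<subseteq># N \<and> sum_mset B = sum_mset A. (-1) ^ (m + sum_mset A + 1) * (?c M A * ?c N B) * ?X A B)"
      unfolding fixed_chain_sum.simps[of M N] m
      by (simp only: fps_const_add[symmetric] fps_const_sum' fps_const_mult[symmetric]
          fps_const_minus_one_power fps_of_nat)
    also have "(\<Sum>A | A \<subseteq># M \<and> 0 < sum_mset A \<and> sum_mset A < m.
        \<Sum>B | B \<subseteq># N \<and> sum_mset B = sum_mset A. (-1) ^ (m + sum_mset A + 1) * (?c M A * ?c N B) * ?X A B)
      = (\<Sum>a\<in>{1..<m}. \<Sum>A | A \<subseteq># M \<and> sum_mset A = a.
        \<Sum>B | B \<subseteq># N \<and> sum_mset B = a. (-1) ^ (m + a + 1) * (?c M A * ?c N B) * ?X A B)"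
      using sum_submsets_by_sum[of "\<lambda>A a. \<Sum>B | B \<subseteq># N \<and> sum_mset B = a.
          (-1) ^ (m + a + 1) * (?c M A * ?c N B) * ?X A B" M m] .
    finally have "?w M * ?w N * ?X M N = ?w M * ?w N * ((-1) ^ (m + 1) + (\<Sum>a\<in>{1..<m}. \<Sum>A | A \<subseteq># M \<and> sum_mset A = a.
        \<Sum>B | B \<subseteq># N \<and> sum_mset B = a. (-1) ^ (m + a + 1) * (?c M A * ?c N B) * ?X A B))" by simp
    also have "\<dots> = (-1) ^ (m + 1) * (?w M * ?w N) + (\<Sum>a\<in>{1..<m}. \<Sum>A | A \<subseteq># M \<and> sum_mset A = a.
        \<Sum>B | B \<subseteq># N \<and> sum_mset B = a. ?w M * ?w N * ((-1) ^ (m + a + 1) * (?c M A * ?c N B) * ?X A B))"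
      unfolding distrib_left sum_distrib_left by (simp only: mult.commute)
    also have "(\<Sum>a\<in>{1..<m}. \<Sum>A | A \<subseteq># M \<and> sum_mset A = a.
        \<Sum>B | B \<subseteq># N \<and> sum_mset B = a. ?w M * ?w N * ((-1) ^ (m + a + 1) * (?c M A * ?c N B) * ?X A B))
      = (\<Sum>a\<in>{1..<m}. \<Sum>A | A \<subseteq># M \<and> sum_mset A = a. \<Sum>B | B \<subseteq># N \<and> sum_mset B = a. ?t a M N A B)"
      by (intro sum.cong refl) (simp only: mult_ac)
    finally show ?thesis .
  qed
  have inner: "(\<Sum>M\<in>?P m. \<Sum>N\<in>?P m. \<Sum>A | A \<subseteq># M \<and> sum_mset A = a. \<Sum>B | B \<subseteq># N \<and> sum_mset B = a. ?t a M N A B)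
      = (-1) ^ (m + a + 1) * (?h (m - a))\<^sup>2 * segre_series a" if a: "a \<in> {1..<m}" for a
  proof -
    have le: "a \<le> m" using a by simp
    let ?\<phi> = "\<lambda>A. (-1) ^ (m + a + 1) * (?h (m - a) * (\<Sum>B\<in>?P a. ?w B * ?X A B))"
    have "(\<Sum>M\<in>?P m. \<Sum>N\<in>?P m. \<Sum>A | A \<subseteq># M \<and> sum_mset A = a. \<Sum>B | B \<subseteq># N \<and> sum_mset B = a. ?t a M N A B)
      = (\<Sum>M\<in>?P m. \<Sum>A | A \<subseteq># M \<and> sum_mset A = a. \<Sum>N\<in>?P m. \<Sum>B | B \<subseteq># N \<and> sum_mset B = a. ?t a M N A B)"
      by (intro sum.cong refl sum.swap)
    also have "\<dots> = (\<Sum>M\<in>?P m. \<Sum>A | A \<subseteq># M \<and> sum_mset A = a. ?c M A * ?w M * ((-1) ^ (m + a + 1) *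
        (\<Sum>N\<in>?P m. \<Sum>B | B \<subseteq># N \<and> sum_mset B = a. ?c N B * ?w N * ?X A B)))"
      by (simp only: sum_distrib_left)
    also have "\<dots> = (\<Sum>M\<in>?P m. \<Sum>A | A \<subseteq># M \<and> sum_mset A = a. ?c M A * ?w M * ?\<phi> A)"
      by (simp only: sum_mset_weight_choose[OF le])
    also have "\<dots> = ?h (m - a) * (\<Sum>A\<in>?P a. ?w A * ?\<phi> A)"
      by (rule sum_mset_weight_choose[OF le])
    also have "(\<Sum>A\<in>?P a. ?w A * ?\<phi> A)
      = (-1) ^ (m + a + 1) * ?h (m - a) * (\<Sum>A\<in>?P a. \<Sum>B\<in>?P a. ?w A * ?w B * ?X A B)"
      unfolding sum_distrib_left by (intro sum.cong refl) (simp only: mult_ac)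
    also have "(\<Sum>A\<in>?P a. \<Sum>B\<in>?P a. ?w A * ?w B * ?X A B) = segre_series a"
      using less[of a] a by simp
    finally show ?thesis by (simp add: power2_eq_square mult_ac)
  qed
  have "(\<Sum>M\<in>?P m. \<Sum>N\<in>?P m. ?w M * ?w N * ?X M N)
    = (\<Sum>M\<in>?P m. \<Sum>N\<in>?P m. (-1) ^ (m + 1) * (?w M * ?w N))
     + (\<Sum>M\<in>?P m. \<Sum>N\<in>?P m. \<Sum>a\<in>{1..<m}. \<Sum>A | A \<subseteq># M \<and> sum_mset A = a. \<Sum>B | B \<subseteq># N \<and> sum_mset B = a. ?t a M N A B)"
    unfolding sum.distrib[symmetric] by (intro sum.cong refl X)
  also have "(\<Sum>M\<in>?P m. \<Sum>N\<in>?P m. (-1) ^ (m + 1) * (?w M * ?w N)) = (-1) ^ (m + 1) * (?h m)\<^sup>2"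
    by (simp only: sum_distrib_left[symmetric] sum_distrib_right[symmetric] sum_mset_weight power2_eq_square)
  also have "(\<Sum>M\<in>?P m. \<Sum>N\<in>?P m. \<Sum>a\<in>{1..<m}. \<Sum>A | A \<subseteq># M \<and> sum_mset A = a. \<Sum>B | B \<subseteq># N \<and> sum_mset B = a. ?t a M N A B)
    = (\<Sum>M\<in>?P m. \<Sum>a\<in>{1..<m}. \<Sum>N\<in>?P m. \<Sum>A | A \<subseteq># M \<and> sum_mset A = a. \<Sum>B | B \<subseteq># N \<and> sum_mset B = a. ?t a M N A B)"
    by (intro sum.cong refl sum.swap)
  also have "\<dots> = (\<Sum>a\<in>{1..<m}. \<Sum>M\<in>?P m. \<Sum>N\<in>?P m. \<Sum>A | A \<subseteq># M \<and> sum_mset A = a. \<Sum>B | B \<subseteq># N \<and> sum_mset B = a. ?t a M N A B)"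
    by (rule sum.swap)
  also have "\<dots> = (\<Sum>a\<in>{1..<m}. (-1) ^ (m + a + 1) * (?h (m - a))\<^sup>2 * segre_series a)"
    by (intro sum.cong refl inner)
  finally show ?case by (simp only: segre_series.simps[of m])
qed

lemma segre_action_fixed:
  "segre_action \<sigma> \<tau> x = x \<longleftrightarrow> \<sigma> ` fst x = fst x \<and> \<tau> ` snd x = snd x"
  by (cases x) (auto simp: segre_action_def)

text \<open>The action is entrywise, so a chain is fixed iff all its members are, and a member is
  fixed iff both its sets are invariant. Grouping the invariant last members by cycle type gives the
  recursion.\<close>

lemma fixed_chain_sum_eq:
  assumes \<sigma>: "permutation \<sigma>" and \<tau>: "permutation \<tau>"
    and "finite A" "finite B" "card A = card B" "\<sigma> ` A = A" "\<tau> ` B = B"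
  shows "(\<Sum>c | c \<in> segre_chains A B \<and> map (segre_action \<sigma> \<tau>) c = c. (-1) ^ (card A + 1 + length c))
    = fixed_chain_sum (cycle_mset \<sigma> A) (cycle_mset \<tau> B)"
  using assms(3-)
proof (induction "card A" arbitrary: A B rule: less_induct)
  case less
  note fin = less.prems(1,2)
  let ?m = "card A" and ?act = "segre_action \<sigma> \<tau>"
  let ?M = "cycle_mset \<sigma> A" and ?N = "cycle_mset \<tau> B" and ?X = fixed_chain_sum
  define f where "f c = (if map ?act c = c then (-1) ^ (?m + 1 + length c) else 0 :: complex)" for c
  \<comment> \<open>Extended by 0 outside the admissible sizes, so that \<open>S\<close> and
    \<open>T\<close> can range independently over all invariant subsets.\<close>
  define g where "g M' N' = (if 0 < sum_mset M' \<and> sum_mset M' < ?m \<and> sum_mset N' = sum_mset M'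
     then (-1) ^ (?m + sum_mset M' + 1) * ?X M' N' else 0)" for M' N'
  have sM: "sum_mset ?M = ?m" using sum_cycle_mset[OF \<sigma>, of A] less.prems by simp
  have cS: "sum_mset (cycle_mset \<sigma> S) = card S" if "S \<subseteq> A" "\<sigma> ` S = S" for S
    using sum_cycle_mset[OF \<sigma>, of S] that finite_subset[OF that(1) fin(1)] by simp
  have cT: "sum_mset (cycle_mset \<tau> T) = card T" if "T \<subseteq> B" "\<tau> ` T = T" for T
    using sum_cycle_mset[OF \<tau>, of T] that finite_subset[OF that(1) fin(2)] by simp
  have "(\<Sum>c | c \<in> segre_chains A B \<and> map ?act c = c. (-1) ^ (?m + 1 + length c)) = (\<Sum>c\<in>segre_chains A B. f c)"
    unfolding f_def by (rule sum.inter_filter[OF finite_segre_chains[OF fin]])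
  also have "\<dots> = (-1) ^ (?m + 1) + (\<Sum>x\<in>segre_interior A B. \<Sum>c\<in>segre_chains (fst x) (snd x). f (c @ [x]))"
    unfolding sum_segre_chains_last[OF fin] by (simp add: f_def)
  also have "(\<Sum>x\<in>segre_interior A B. \<Sum>c\<in>segre_chains (fst x) (snd x). f (c @ [x]))
    = (\<Sum>x\<in>segre_interior A B. if \<sigma> ` fst x = fst x \<and> \<tau> ` snd x = snd x
         then g (cycle_mset \<sigma> (fst x)) (cycle_mset \<tau> (snd x)) else 0)"
  proof (rule sum.cong[OF refl])
    fix x assume x: "x \<in> segre_interior A B"
    note xD = segre_interiorD[OF x]
    have fx: "finite (fst x)" "finite (snd x)"
      using finite_subset[OF xD(1) fin(1)] finite_subset[OF xD(2) fin(2)] .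
    show "(\<Sum>c\<in>segre_chains (fst x) (snd x). f (c @ [x])) = (if \<sigma> ` fst x = fst x \<and> \<tau> ` snd x = snd x
         then g (cycle_mset \<sigma> (fst x)) (cycle_mset \<tau> (snd x)) else 0)"
    proof (cases "\<sigma> ` fst x = fst x \<and> \<tau> ` snd x = snd x")
      case True
      then have ax: "?act x = x" by (simp add: segre_action_fixed)
      have "(\<Sum>c\<in>segre_chains (fst x) (snd x). f (c @ [x]))
        = (\<Sum>c\<in>segre_chains (fst x) (snd x). if map ?act c = c
            then (-1) ^ (?m + card (fst x) + 1) * (-1) ^ (card (fst x) + 1 + length c) else 0)"
      proof (rule sum.cong[OF refl])
        fix c
        have "f (c @ [x]) = (if map ?act c = c then (-1) ^ (?m + 1 + (length c + 1)) else 0)"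
          by (simp add: f_def ax)
        then show "f (c @ [x]) = (if map ?act c = c
            then (-1) ^ (?m + card (fst x) + 1) * (-1) ^ (card (fst x) + 1 + length c) else 0)"
          by (simp only: sign_append[of ?m "length c" "card (fst x)"])
      qed
      also have "\<dots> = (\<Sum>c | c \<in> segre_chains (fst x) (snd x) \<and> map ?act c = c.
          (-1) ^ (?m + card (fst x) + 1) * (-1) ^ (card (fst x) + 1 + length c))"
        by (rule sum.inter_filter[OF finite_segre_chains[OF fx], symmetric])
      also have "\<dots> = (-1) ^ (?m + card (fst x) + 1) * ?X (cycle_mset \<sigma> (fst x)) (cycle_mset \<tau> (snd x))"
        using less.hyps[of "fst x" "snd x"] xD fx True by (simp only: sum_distrib_left[symmetric])
      also have "\<dots> = g (cycle_mset \<sigma> (fst x)) (cycle_mset \<tau> (snd x))"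
        using xD True cS cT by (simp add: g_def)
      finally show ?thesis using True by simp
    next
      case False
      then have "f (c @ [x]) = 0" for c by (simp add: f_def segre_action_fixed)
      then show ?thesis using False by auto
    qed
  qed
  also have "\<dots> = (\<Sum>S | S \<subseteq> A \<and> \<sigma> ` S = S. \<Sum>T | T \<subseteq> B \<and> \<tau> ` T = T. g (cycle_mset \<sigma> S) (cycle_mset \<tau> T))"
  proof -
    let ?G = "\<lambda>S T. if \<sigma> ` S = S \<and> \<tau> ` T = T then g (cycle_mset \<sigma> S) (cycle_mset \<tau> T) else 0"
    have "(\<Sum>x\<in>segre_interior A B. ?G (fst x) (snd x)) = (\<Sum>x\<in>Pow A \<times> Pow B. ?G (fst x) (snd x))"
    proof (rule sum.mono_neutral_left)
      show "\<forall>x\<in>Pow A \<times> Pow B - segre_interior A B. ?G (fst x) (snd x) = 0"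
      proof
        fix x assume x: "x \<in> Pow A \<times> Pow B - segre_interior A B"
        show "?G (fst x) (snd x) = 0"
        proof (cases "\<sigma> ` fst x = fst x \<and> \<tau> ` snd x = snd x")
          case True
          have sub: "fst x \<subseteq> A" "snd x \<subseteq> B" using x by auto
          have "\<not> (0 < card (fst x) \<and> card (fst x) < ?m \<and> card (snd x) = card (fst x))"
            using x sub segre_interiorI[of x A B] by auto
          then have "g (cycle_mset \<sigma> (fst x)) (cycle_mset \<tau> (snd x)) = 0"
            unfolding g_def cS[OF sub(1) conjunct1[OF True]] cT[OF sub(2) conjunct2[OF True]]
            by (rule if_not_P)
          then show ?thesis by simp
        qed auto
      qed
    qed (use fin in \<open>auto simp: segre_interior_def\<close>)
    also have "\<dots> = (\<Sum>S\<in>Pow A. \<Sum>T\<in>Pow B. ?G S T)" by (simp add: sum.cartesian_product split_beta)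
    also have "\<dots> = (\<Sum>S\<in>Pow A. if \<sigma> ` S = S then
        (\<Sum>T\<in>Pow B. if \<tau> ` T = T then g (cycle_mset \<sigma> S) (cycle_mset \<tau> T) else 0) else 0)"
      by (intro sum.cong refl) simp
    also have "\<dots> = (\<Sum>S\<in>{S \<in> Pow A. \<sigma> ` S = S}. \<Sum>T\<in>{T \<in> Pow B. \<tau> ` T = T}. g (cycle_mset \<sigma> S) (cycle_mset \<tau> T))"
      using fin by (simp only: sum.inter_filter finite_Pow_iff)
    finally show ?thesis by simp
  qed
  also have "\<dots> = (\<Sum>S | S \<subseteq> A \<and> \<sigma> ` S = S. \<Sum>N' | N' \<subseteq># ?N. of_nat (mset_choose ?N N') * g (cycle_mset \<sigma> S) N')"
    using less.prems by (intro sum.cong refl sum_invariant_subsets[OF \<tau>]) auto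
  also have "\<dots> = (\<Sum>M' | M' \<subseteq># ?M. of_nat (mset_choose ?M M') *
      (\<Sum>N' | N' \<subseteq># ?N. of_nat (mset_choose ?N N') * g M' N'))"
    using less.prems sum_invariant_subsets[OF \<sigma>, of A "\<lambda>M'. \<Sum>N' | N' \<subseteq># ?N. of_nat (mset_choose ?N N') * g M' N'"]
    by auto
  also have "\<dots> = (\<Sum>M'\<in>{M'. M' \<subseteq># ?M}. if 0 < sum_mset M' \<and> sum_mset M' < ?m then
      (\<Sum>N'\<in>{N'. N' \<subseteq># ?N}. if sum_mset N' = sum_mset M' then (-1) ^ (?m + sum_mset M' + 1) *
        (of_nat (mset_choose ?M M') * of_nat (mset_choose ?N N')) * ?X M' N' else 0) else 0)"
  proof (rule sum.cong[OF refl])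
    fix M'
    show "of_nat (mset_choose ?M M') * (\<Sum>N' | N' \<subseteq># ?N. of_nat (mset_choose ?N N') * g M' N')
      = (if 0 < sum_mset M' \<and> sum_mset M' < ?m then
      (\<Sum>N'\<in>{N'. N' \<subseteq># ?N}. if sum_mset N' = sum_mset M' then (-1) ^ (?m + sum_mset M' + 1) *
        (of_nat (mset_choose ?M M') * of_nat (mset_choose ?N N')) * ?X M' N' else 0) else 0)"
    proof (cases "0 < sum_mset M' \<and> sum_mset M' < ?m")
      case True
      have gT: "g M' N' = (if sum_mset N' = sum_mset M' then (-1) ^ (?m + sum_mset M' + 1) * ?X M' N' else 0)" for N'
        unfolding g_def by (simp only: conjunct1[OF True] conjunct2[OF True] simp_thms)
      show ?thesis unfolding if_P[OF True] sum_distrib_left gT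
        by (rule sum.cong[OF refl]) simp
    next
      case False
      have "g M' N' = 0" for N' unfolding g_def by (rule if_not_P) (use False in blast)
      then show ?thesis unfolding if_not_P[OF False] by simp
    qed
  qed
  also have "\<dots> = (\<Sum>M'\<in>{M' \<in> {M'. M' \<subseteq># ?M}. 0 < sum_mset M' \<and> sum_mset M' < ?m}.
      \<Sum>N'\<in>{N' \<in> {N'. N' \<subseteq># ?N}. sum_mset N' = sum_mset M'}. (-1) ^ (?m + sum_mset M' + 1) *
        (of_nat (mset_choose ?M M') * of_nat (mset_choose ?N N')) * ?X M' N')"
    by (simp only: sum.inter_filter[OF finite_submsets])
  also have "(-1) ^ (?m + 1) + \<dots> = ?X ?M ?N"
    unfolding fixed_chain_sum.simps[of ?M ?N] sM by simp
  finally show ?case .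
qed

section \<open>Critical chains and pairs of permutations\<close>

lemma sum_sign_reversing_involution:
  fixes f :: "'c \<Rightarrow> complex fps"
  assumes "\<And>c. c \<in> K \<Longrightarrow> \<iota> c \<in> K" "\<And>c. c \<in> K \<Longrightarrow> \<iota> (\<iota> c) = c" "\<And>c. c \<in> K \<Longrightarrow> f (\<iota> c) = - f c"
  shows "(\<Sum>c\<in>K. f c) = 0"
proof -
  have "(\<Sum>c\<in>K. f c) = (\<Sum>c\<in>K. f (\<iota> c))"
    by (rule sum.reindex_bij_witness[of _ \<iota> \<iota>]) (use assms in auto)
  also have "\<dots> = - (\<Sum>c\<in>K. f c)" using assms by (simp add: sum_negf)
  finally have "2 * (\<Sum>c\<in>K. f c) = 0" by simp
  then show ?thesis by simp
qed

definition critical_chains :: "nat set \<Rightarrow> nat set \<Rightarrow> (nat set \<times> nat set) list set" where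
  "critical_chains A B = {c \<in> segre_chains A B. free_elems A B (set c) = {}}"

lemma length_critical_chain:
  assumes "finite A" "finite B" "card A = card B" "c \<in> critical_chains A B"
  shows "length c = card A - 1"
proof -
  have c: "c \<in> segre_chains A B" "free_elems A B (set c) = {}" using assms(4) by (auto simp: critical_chains_def)
  have "\<not> Suc (length c) < card A" using free_elems_nonempty_short[OF assms(1-3) c(1)] c(2) by blast
  then show ?thesis using length_segre_chain[OF assms(1,2) c(1)] by linarith
qed

lemma inv_series_critical:
  assumes fin: "finite A" "finite B" "card A = card B" and pos: "0 < card A"
  shows "inv_series A B = (\<Sum>c\<in>critical_chains A B. fps_X ^ card (chain_inv A B (set c)))"
proof -
  let ?f = "\<lambda>c. (-1) ^ (card A + 1 + length c) * fps_X ^ card (chain_inv A B (set c)) :: complex fps"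
  define K where "K = {c \<in> segre_chains A B. free_elems A B (set c) \<noteq> {}}"
  define p where "p c = pivot A B (set c)" for c
  define \<iota> where "\<iota> c = chain_list (if p c \<in> set c then set c - {p c} else insert (p c) (set c))" for c
  have "?f (\<iota> c) = - ?f c \<and> \<iota> c \<in> K \<and> \<iota> (\<iota> c) = c" if c: "c \<in> K" for c
  proof -
    have srt: "sorted_wrt (<) c" "set c \<subseteq> segre_interior A B" "is_chain (set c)"
      using c is_chain_set_sorted[of c] by (auto simp: K_def segre_chains_def)
    have pf: "p c \<in> free_elems A B (set c)"
      using c by (auto simp: K_def p_def pivot_def intro: someI)
    have chi: "is_chain (insert (p c) (set c))" "p c \<in> segre_interior A B"
      using pf by (auto simp: free_elems_def)
    let ?d = "if p c \<in> set c then set c - {p c} else insert (p c) (set c)"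
    have sub: "?d \<subseteq> insert (p c) (set c)" by auto
    have d: "is_chain ?d" "?d \<subseteq> segre_interior A B" "finite ?d"
      using is_chain_subset[OF chi(1) sub] chi(2) srt(2) by auto
    note cl = chain_list[OF d(3,1), folded \<iota>_def]
    have free: "free_elems A B ?d = free_elems A B (set c)"
      using free_elems_toggle[OF fin(1,2) srt(2) pf] free_elems_remove[OF fin(1,2) srt(2,3) pf] by simp
    have inv: "chain_inv A B ?d = chain_inv A B (set c)"
      using chain_inv_toggle[OF pf] by simp
    \<comment> \<open>Equal free elements give equal pivots, so a second toggle undoes the
      first.\<close>
    have pd: "p (\<iota> c) = p c" using free cl(2) by (simp add: p_def pivot_def)
    have K: "\<iota> c \<in> K" using cl free d(2) c unfolding K_def segre_chains_def by simp
    have card: "card (set c) = length c" using sorted_wrt_less_distinct[OF srt(1)] by (simp add: distinct_card)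
    have "\<iota> (\<iota> c) = chain_list (set c)"
    proof (cases "p c \<in> set c")
      case True
      then show ?thesis unfolding \<iota>_def[of "\<iota> c"] pd cl(2) by (simp add: insert_absorb)
    next
      case False
      then show ?thesis unfolding \<iota>_def[of "\<iota> c"] pd cl(2) by simp
    qed
    then have inv2: "\<iota> (\<iota> c) = c" using chain_list_set[OF srt(1)] by simp
    have "(-1) ^ length (\<iota> c) = - ((-1) ^ length c :: complex fps)"
    proof (cases "p c \<in> set c")
      case True
      then have "length c = Suc (length (\<iota> c))"
        using cl(3) card card_Suc_Diff1[of "set c" "p c"] by simp
      then show ?thesis by simp
    next
      case False
      then have "length (\<iota> c) = Suc (length c)" using cl(3) card by simp
      then show ?thesis by simp
    qed
    then have "?f (\<iota> c) = - ?f c" using cl(2) inv by (simp add: power_add)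
    then show ?thesis using K inv2 by blast
  qed
  then have zero: "(\<Sum>c\<in>K. ?f c) = 0" by (intro sum_sign_reversing_involution[of K \<iota>]) auto
  have "segre_chains A B = critical_chains A B \<union> K" by (auto simp: critical_chains_def K_def)
  then have "inv_series A B = (\<Sum>c\<in>critical_chains A B. ?f c) + (\<Sum>c\<in>K. ?f c)"
    unfolding inv_series_def using finite_segre_chains[OF fin(1,2)]
    by (subst sum.union_disjoint[symmetric]) (auto simp: critical_chains_def K_def)
  also have "(\<Sum>c\<in>critical_chains A B. ?f c) = (\<Sum>c\<in>critical_chains A B. fps_X ^ card (chain_inv A B (set c)))"
  proof (rule sum.cong[OF refl])
    fix c assume "c \<in> critical_chains A B"
    \<comment> \<open>A critical chain has \<open>card A - 1\<close> members, so the exponent of the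
      sign is even; \<open>pos\<close> rules out truncation.\<close>
    then have e: "card A + 1 + length c = 2 * card A" using length_critical_chain[OF fin] pos by simp
    show "?f c = fps_X ^ card (chain_inv A B (set c))" unfolding e power_minus1_even by (rule mult_1_left)
  qed
  finally show ?thesis unfolding zero by simp
qed

section \<open>Maximal chains as pairs of permutations\<close>

definition prefix_cut :: "(nat \<Rightarrow> nat) \<Rightarrow> nat \<Rightarrow> nat set" where
  "prefix_cut \<sigma> i = \<sigma> ` {1..i}"

lemma prefix_cut_props:
  assumes "\<sigma> permutes {1..n}" "i \<le> n"
  shows "prefix_cut \<sigma> i \<subseteq> {1..n}" "card (prefix_cut \<sigma> i) = i" "finite (prefix_cut \<sigma> i)"
proof -
  have "\<sigma> ` {1..i} \<subseteq> \<sigma> ` {1..n}" using assms(2) by auto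
  then show "prefix_cut \<sigma> i \<subseteq> {1..n}" using permutes_image[OF assms(1)] by (simp add: prefix_cut_def)
  have "inj_on \<sigma> {1..i}" using permutes_inj[OF assms(1)] inj_on_subset by blast
  then show "card (prefix_cut \<sigma> i) = i" by (simp add: prefix_cut_def card_image)
  show "finite (prefix_cut \<sigma> i)" by (simp add: prefix_cut_def)
qed

lemma prefix_cut_mem:
  assumes "\<sigma> permutes {1..n}"
  shows "\<sigma> a \<in> prefix_cut \<sigma> i \<longleftrightarrow> a \<in> {1..i}"
  using permutes_inj[OF assms] by (auto simp: prefix_cut_def inj_image_mem_iff)

lemma cut_inv_prefix:
  assumes "\<sigma> permutes {1..n}"
  shows "cut_inv {1..n} (prefix_cut \<sigma> i) = (\<lambda>(a, b). (\<sigma> a, \<sigma> b)) ` {(a, b). 1 \<le> a \<and> a \<le> i \<and> i < b \<and> b \<le> n \<and> \<sigma> b < \<sigma> a}"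
proof (intro equalityI subsetI)
  fix q assume "q \<in> cut_inv {1..n} (prefix_cut \<sigma> i)"
  then obtain x y where q: "q = (x, y)" "x \<in> prefix_cut \<sigma> i" "y \<in> {1..n}" "y \<notin> prefix_cut \<sigma> i" "y < x"
    by (auto simp: cut_inv_def)
  obtain a where a: "x = \<sigma> a" "a \<in> {1..i}" using q by (auto simp: prefix_cut_def)
  have "y \<in> \<sigma> ` {1..n}" using q permutes_image[OF assms] by simp
  then obtain b where b: "y = \<sigma> b" "b \<in> {1..n}" by blast
  have "b \<notin> {1..i}" using q b prefix_cut_mem[OF assms] by simp
  then show "q \<in> (\<lambda>(a, b). (\<sigma> a, \<sigma> b)) ` {(a, b). 1 \<le> a \<and> a \<le> i \<and> i < b \<and> b \<le> n \<and> \<sigma> b < \<sigma> a}"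
    using q a b by (intro image_eqI[of _ _ "(a, b)"]) auto
next
  fix q assume "q \<in> (\<lambda>(a, b). (\<sigma> a, \<sigma> b)) ` {(a, b). 1 \<le> a \<and> a \<le> i \<and> i < b \<and> b \<le> n \<and> \<sigma> b < \<sigma> a}"
  then obtain a b where q: "q = (\<sigma> a, \<sigma> b)" "1 \<le> a" "a \<le> i" "i < b" "b \<le> n" "\<sigma> b < \<sigma> a" by auto
  have "\<sigma> b \<in> {1..n}" using q permutes_in_image[OF assms, of b] by simp
  then show "q \<in> cut_inv {1..n} (prefix_cut \<sigma> i)"
    using q prefix_cut_mem[OF assms] by (simp add: cut_inv_def)
qed

text \<open>An inversion at positions \<open>a < b\<close> is separated by the prefix of length
  \<open>i\<close> iff \<open>a \<le> i < b\<close>, and \<open>i = a\<close> always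
  qualifies.\<close>

lemma card_Union_cut_inv_prefix:
  assumes "\<sigma> permutes {1..n}"
  shows "card (\<Union>i\<in>{1..<n}. cut_inv {1..n} (prefix_cut \<sigma> i)) = inversions n \<sigma>"
proof -
  let ?g = "\<lambda>(a, b). (\<sigma> a, \<sigma> b)"
  let ?I = "{(i, j). 1 \<le> i \<and> i < j \<and> j \<le> n \<and> \<sigma> i > \<sigma> j}"
  have "(\<Union>i\<in>{1..<n}. {(a, b). 1 \<le> a \<and> a \<le> i \<and> i < b \<and> b \<le> n \<and> \<sigma> b < \<sigma> a}) = ?I"
  proof (intro equalityI subsetI)
    fix q assume "q \<in> ?I"
    then show "q \<in> (\<Union>i\<in>{1..<n}. {(a, b). 1 \<le> a \<and> a \<le> i \<and> i < b \<and> b \<le> n \<and> \<sigma> b < \<sigma> a})"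
      by (intro UN_I[of "fst q"]) auto
  qed auto
  then have "(\<Union>i\<in>{1..<n}. cut_inv {1..n} (prefix_cut \<sigma> i)) = ?g ` ?I"
    unfolding cut_inv_prefix[OF assms] image_UN[symmetric] by simp
  moreover have "inj_on ?g ?I"
    using permutes_inj[OF assms] by (auto simp: inj_on_def dest: injD)
  ultimately show ?thesis by (simp add: card_image inversions_def)
qed

text \<open>At a descent, the values at \<open>i\<close> and \<open>i + 1\<close> form an inversion
  that no other prefix separates. At an ascent, an inversion across the cut has positions other than
  \<open>(i, i + 1)\<close>, so a neighbouring prefix separates it too.\<close>

lemma ascent_iff_redundant:
  assumes \<sigma>: "\<sigma> permutes {1..n}" and i: "i \<in> {1..<n}"
  shows "cut_inv {1..n} (prefix_cut \<sigma> i) \<subseteq> (\<Union>j\<in>{1..<n} - {i}. cut_inv {1..n} (prefix_cut \<sigma> j))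
    \<longleftrightarrow> i \<in> ascents n \<sigma>"
proof
  assume sub: "cut_inv {1..n} (prefix_cut \<sigma> i) \<subseteq> (\<Union>j\<in>{1..<n} - {i}. cut_inv {1..n} (prefix_cut \<sigma> j))"
  show "i \<in> ascents n \<sigma>"
  proof (rule ccontr)
    assume "i \<notin> ascents n \<sigma>"
    moreover have "\<sigma> i \<noteq> \<sigma> (i + 1)" by (simp add: inj_eq[OF permutes_inj[OF \<sigma>]])
    ultimately have "\<sigma> (i + 1) < \<sigma> i" using i by (auto simp: ascents_def)
    then have "(\<sigma> i, \<sigma> (i + 1)) \<in> cut_inv {1..n} (prefix_cut \<sigma> i)"
      unfolding cut_inv_prefix[OF \<sigma>] using i by (intro image_eqI[of _ _ "(i, i + 1)"]) auto
    then obtain j where "j \<noteq> i" "\<sigma> i \<in> prefix_cut \<sigma> j" "\<sigma> (i + 1) \<notin> prefix_cut \<sigma> j"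
      using sub by (auto simp: cut_inv_def)
    then show False unfolding prefix_cut_mem[OF \<sigma>] by auto
  qed
next
  assume asc: "i \<in> ascents n \<sigma>"
  show "cut_inv {1..n} (prefix_cut \<sigma> i) \<subseteq> (\<Union>j\<in>{1..<n} - {i}. cut_inv {1..n} (prefix_cut \<sigma> j))"
  proof
    fix q assume "q \<in> cut_inv {1..n} (prefix_cut \<sigma> i)"
    then obtain a b where q: "q = (\<sigma> a, \<sigma> b)" "1 \<le> a" "a \<le> i" "i < b" "b \<le> n" "\<sigma> b < \<sigma> a"
      unfolding cut_inv_prefix[OF \<sigma>] by auto
    define j where "j = (if a < i then i - 1 else i + 1)"
    have "a < i \<or> i + 1 < b" using asc q by (cases "a = i \<and> b = i + 1") (auto simp: ascents_def)
    then have j: "j \<in> {1..<n} - {i}" "a \<le> j" "j < b" using q i by (auto simp: j_def)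
    have "q \<in> cut_inv {1..n} (prefix_cut \<sigma> j)"
      unfolding cut_inv_prefix[OF \<sigma>] using q j by (intro image_eqI[of _ _ "(a, b)"]) auto
    then show "q \<in> (\<Union>j\<in>{1..<n} - {i}. cut_inv {1..n} (prefix_cut \<sigma> j))" using j by blast
  qed
qed

definition perm_chain :: "nat \<Rightarrow> (nat \<Rightarrow> nat) \<times> (nat \<Rightarrow> nat) \<Rightarrow> (nat set \<times> nat set) list" where
  "perm_chain n = (\<lambda>(\<sigma>, \<omega>). map (\<lambda>i. (prefix_cut \<sigma> i, prefix_cut \<omega> i)) [1..<n])"

lemma prefix_cut_mono: "i \<le> j \<Longrightarrow> prefix_cut \<sigma> i \<subseteq> prefix_cut \<sigma> j"
  by (auto simp: prefix_cut_def)

lemma set_perm_chain: "set (perm_chain n (\<sigma>, \<omega>)) = (\<lambda>i. (prefix_cut \<sigma> i, prefix_cut \<omega> i)) ` {1..<n}"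
  by (simp add: perm_chain_def)

lemma perm_chain_in_segre_chains:
  assumes "\<sigma> permutes {1..n}" "\<omega> permutes {1..n}"
  shows "perm_chain n (\<sigma>, \<omega>) \<in> segre_chains {1..n} {1..n}"
proof -
  have lt: "(prefix_cut \<sigma> i, prefix_cut \<omega> i) < (prefix_cut \<sigma> j, prefix_cut \<omega> j)" if "i < j" "j < n" for i j
  proof -
    have "prefix_cut \<sigma> i \<noteq> prefix_cut \<sigma> j"
      using that prefix_cut_props(2)[OF assms(1), of i] prefix_cut_props(2)[OF assms(1), of j] by auto
    then show ?thesis using that prefix_cut_mono[of i j] by (auto simp: less_le less_eq_prod_def)
  qed
  have "sorted_wrt (<) (perm_chain n (\<sigma>, \<omega>))"
    unfolding sorted_wrt_iff_nth_less
  proof (intro allI impI)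
    fix i j assume "i < j" "j < length (perm_chain n (\<sigma>, \<omega>))"
    then show "perm_chain n (\<sigma>, \<omega>) ! i < perm_chain n (\<sigma>, \<omega>) ! j"
      using lt[of "Suc i" "Suc j"] by (simp add: perm_chain_def)
  qed
  moreover have "set (perm_chain n (\<sigma>, \<omega>)) \<subseteq> segre_interior {1..n} {1..n}"
  proof
    fix x assume "x \<in> set (perm_chain n (\<sigma>, \<omega>))"
    then obtain i where i: "i \<in> {1..<n}" "x = (prefix_cut \<sigma> i, prefix_cut \<omega> i)"
      unfolding set_perm_chain by blast
    then have "i \<le> n" by simp
    note props = prefix_cut_props[OF assms(1) this] prefix_cut_props[OF assms(2) this]
    show "x \<in> segre_interior {1..n} {1..n}"
      by (rule segre_interiorI) (use i props in simp_all)
  qed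
  ultimately show ?thesis by (simp add: segre_chains_def)
qed

text \<open>The chain occupies every rank, so an element comparable to all of it is a member. A
  member is redundant iff it is so in both coordinates, that is, iff its rank is a common
  ascent.\<close>

lemma free_elems_perm_chain:
  assumes \<sigma>: "\<sigma> permutes {1..n}" and \<omega>: "\<omega> permutes {1..n}"
  shows "free_elems {1..n} {1..n} (set (perm_chain n (\<sigma>, \<omega>))) = {}
    \<longleftrightarrow> ascents n \<sigma> \<inter> ascents n \<omega> = {}"
proof -
  let ?A = "{1..n}" and ?c = "set (perm_chain n (\<sigma>, \<omega>))"
  let ?x = "\<lambda>i. (prefix_cut \<sigma> i, prefix_cut \<omega> i)"
  have ch: "?c \<subseteq> segre_interior ?A ?A" "is_chain ?c"
    using perm_chain_in_segre_chains[OF assms] is_chain_set_sorted by (auto simp: segre_chains_def)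
  have cx: "card (fst (?x i)) = i" if "i \<in> {1..<n}" for i
    using prefix_cut_props(2)[OF \<sigma>, of i] that by simp
  have mem: "y \<in> ?c" if y: "y \<in> free_elems ?A ?A ?c" for y
  proof -
    have yi: "y \<in> segre_interior ?A ?A" "is_chain (insert y ?c)" using y by (auto simp: free_elems_def)
    define i where "i = card (fst y)"
    have i: "i \<in> {1..<n}" using segre_interiorD[OF yi(1)] by (simp add: i_def)
    then have xi: "?x i \<in> ?c" by (auto simp: set_perm_chain)
    have "y = ?x i"
      by (rule inj_onD[OF card_fst_inj_on_chain(1)[of ?A ?A "insert y ?c"]])
        (use yi ch xi cx[OF i] in \<open>auto simp: i_def\<close>)
    then show ?thesis using xi by simp
  qed
  have fr: "?x i \<in> free_elems ?A ?A ?c \<longleftrightarrow> i \<in> ascents n \<sigma> \<inter> ascents n \<omega>" if i: "i \<in> {1..<n}" for i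
  proof -
    have xi: "?x i \<in> ?c" using i by (auto simp: set_perm_chain)
    have inj: "inj_on ?x {1..<n}" using cx by (metis (no_types, lifting) inj_onI)
    have diff: "?c - {?x i} = ?x ` ({1..<n} - {i})"
      unfolding set_perm_chain using inj_on_image_set_diff[OF inj, of "{1..<n}" "{i}"] i by auto
    have "?x i \<in> free_elems ?A ?A ?c \<longleftrightarrow> sep_inv ?A ?A (?x i) \<subseteq> chain_inv ?A ?A (?c - {?x i})"
      using xi ch by (auto simp: free_elems_def insert_absorb)
    also have "\<dots> \<longleftrightarrow> cut_inv ?A (prefix_cut \<sigma> i) \<subseteq> (\<Union>j\<in>{1..<n} - {i}. cut_inv ?A (prefix_cut \<sigma> j)) \<and>
        cut_inv ?A (prefix_cut \<omega> i) \<subseteq> (\<Union>j\<in>{1..<n} - {i}. cut_inv ?A (prefix_cut \<omega> j))"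
    proof -
      have "chain_inv ?A ?A (?c - {?x i}) = (\<Union>j\<in>{1..<n} - {i}. cut_inv ?A (prefix_cut \<sigma> j))
        <+> (\<Union>j\<in>{1..<n} - {i}. cut_inv ?A (prefix_cut \<omega> j))"
        unfolding diff chain_inv_def sep_inv_def by auto
      then show ?thesis by (auto simp: sep_inv_def)
    qed
    finally show ?thesis using ascent_iff_redundant[OF \<sigma> i] ascent_iff_redundant[OF \<omega> i] by simp
  qed
  show ?thesis
  proof
    assume "free_elems ?A ?A ?c = {}"
    then have "i \<notin> ascents n \<sigma> \<inter> ascents n \<omega>" if "i \<in> {1..<n}" for i using fr[OF that] by auto
    moreover have "ascents n \<sigma> \<subseteq> {1..<n}" by (auto simp: ascents_def)
    ultimately show "ascents n \<sigma> \<inter> ascents n \<omega> = {}" by blast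
  next
    assume e: "ascents n \<sigma> \<inter> ascents n \<omega> = {}"
    show "free_elems ?A ?A ?c = {}"
    proof (rule ccontr)
      assume "free_elems ?A ?A ?c \<noteq> {}"
      then obtain y where y: "y \<in> free_elems ?A ?A ?c" by blast
      then obtain i where "i \<in> {1..<n}" "y = ?x i" using mem[OF y] by (auto simp: set_perm_chain)
      then show False using fr y e by blast
    qed
  qed
qed

lemma card_chain_inv_perm_chain:
  assumes "\<sigma> permutes {1..n}" "\<omega> permutes {1..n}"
  shows "card (chain_inv {1..n} {1..n} (set (perm_chain n (\<sigma>, \<omega>)))) = inversions n \<sigma> + inversions n \<omega>"
proof -
  have fin: "finite (\<Union>i\<in>{1..<n}. cut_inv {1..n} (prefix_cut \<rho> i))" if "\<rho> permutes {1..n}" for \<rho>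
  proof (rule finite_UN_I)
    fix i assume "i \<in> {1..<n}"
    then show "finite (cut_inv {1..n} (prefix_cut \<rho> i))"
      using prefix_cut_props(1)[OF that, of i] by (intro finite_cut_inv) auto
  qed simp
  have "chain_inv {1..n} {1..n} (set (perm_chain n (\<sigma>, \<omega>)))
    = (\<Union>i\<in>{1..<n}. cut_inv {1..n} (prefix_cut \<sigma> i)) <+> (\<Union>i\<in>{1..<n}. cut_inv {1..n} (prefix_cut \<omega> i))"
    unfolding set_perm_chain chain_inv_def sep_inv_def by auto
  then show ?thesis
    by (simp only: card_Plus[OF fin[OF assms(1)] fin[OF assms(2)]]
        card_Union_cut_inv_prefix[OF assms(1)] card_Union_cut_inv_prefix[OF assms(2)])
qed

text \<open>The value at \<open>k\<close> is the single element by which the prefixes of lengths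
  \<open>k - 1\<close> and \<open>k\<close> differ; the prefixes of lengths 0 and \<open>n\<close>
  agree for all permutations.\<close>

lemma prefix_cut_inject:
  assumes "\<sigma> permutes {1..n}" "\<rho> permutes {1..n}" "\<And>i. i \<in> {1..<n} \<Longrightarrow> prefix_cut \<sigma> i = prefix_cut \<rho> i"
  shows "\<sigma> = \<rho>"
proof
  fix k
  show "\<sigma> k = \<rho> k"
  proof (cases "k \<in> {1..n}")
    case True
    have eq: "prefix_cut \<sigma> i = prefix_cut \<rho> i" if "i \<le> n" for i
    proof -
      have "i = 0 \<or> i = n \<or> i \<in> {1..<n}" using that by auto
      then consider "i = 0" | "i = n" | "i \<in> {1..<n}" by blast
      then show ?thesis
        using assms(3) permutes_image[OF assms(1)] permutes_image[OF assms(2)]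
        by cases (auto simp: prefix_cut_def)
    qed
    have diff: "prefix_cut \<pi> k - prefix_cut \<pi> (k - 1) = {\<pi> k}" if "\<pi> permutes {1..n}" for \<pi>
    proof -
      have "{1..k} - {1..k - 1} = {k}" using True by auto
      then show ?thesis
        using image_set_diff[OF permutes_inj[OF that], of "{1..k}" "{1..k - 1}"] by (simp add: prefix_cut_def)
    qed
    have "k \<le> n" "k - 1 \<le> n" using True by auto
    then have "{\<sigma> k} = {\<rho> k}" using diff[OF assms(1)] diff[OF assms(2)] eq by metis
    then show ?thesis by simp
  next
    case False
    then show ?thesis using permutes_not_in[OF assms(1)] permutes_not_in[OF assms(2)] by simp
  qed
qed

lemma ex_permutes_prefix_cut:
  assumes "S n = {1..n}" "\<And>i. i \<le> n \<Longrightarrow> card (S i) = i \<and> finite (S i)" "\<And>i. i < n \<Longrightarrow> S i \<subseteq> S (Suc i)"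
  shows "\<exists>\<sigma>. \<sigma> permutes {1..n} \<and> (\<forall>i\<le>n. prefix_cut \<sigma> i = S i)"
proof -
  have "\<exists>x. S (Suc i) = insert x (S i)" if "i < n" for i
  proof -
    have "card (S (Suc i) - S i) = 1"
      using assms(2)[of i] assms(2)[of "Suc i"] assms(3)[OF that] that by (simp add: card_Diff_subset)
    then obtain x where "S (Suc i) - S i = {x}" by (auto simp: card_1_singleton_iff)
    then show ?thesis using assms(3)[OF that] by blast
  qed
  then obtain x where x: "\<And>i. i < n \<Longrightarrow> S (Suc i) = insert (x i) (S i)" by metis
  \<comment> \<open>The value at \<open>k\<close> is the element added in passing from
    \<open>S (k - 1)\<close> to \<open>S k\<close>.\<close>
  define \<sigma> where "\<sigma> k = (if k \<in> {1..n} then x (k - 1) else k)" for k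
  have pre: "prefix_cut \<sigma> i = S i" if "i \<le> n" for i
    using that
  proof (induction i)
    case 0
    then show ?case using assms(2)[of 0] by (auto simp: prefix_cut_def)
  next
    case (Suc i)
    have "prefix_cut \<sigma> (Suc i) = insert (\<sigma> (Suc i)) (prefix_cut \<sigma> i)"
      by (simp add: prefix_cut_def atLeastAtMostSuc_conv)
    moreover have "\<sigma> (Suc i) = x i" using Suc.prems by (simp add: \<sigma>_def)
    ultimately show ?case using Suc x[of i] by simp
  qed
  have im: "\<sigma> ` {1..n} = {1..n}" using pre[of n] assms(1) by (simp add: prefix_cut_def)
  then have "inj_on \<sigma> {1..n}" by (simp add: finite_surj_inj eq_card_imp_inj_on)
  then have "bij_betw \<sigma> {1..n} {1..n}" using im by (simp add: bij_betw_def)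
  then have "\<sigma> permutes {1..n}" by (rule bij_imp_permutes) (auto simp: \<sigma>_def)
  then show ?thesis using pre by blast
qed

lemma ex_perm_chain:
  assumes n: "1 \<le> n" and c: "c \<in> segre_chains {1..n} {1..n}" "length c = n - 1"
  shows "\<exists>\<sigma> \<omega>. \<sigma> permutes {1..n} \<and> \<omega> permutes {1..n} \<and> c = perm_chain n (\<sigma>, \<omega>)"
proof -
  let ?A = "{1..n}"
  have srt: "sorted_wrt (<) c" "set c \<subseteq> segre_interior ?A ?A" "is_chain (set c)"
    using c is_chain_set_sorted[of c] by (auto simp: segre_chains_def)
  \<comment> \<open>The \<open>n - 1\<close> distinct ranks fill \<open>{1..<n}\<close>, so the
    member at list index \<open>i - 1\<close> has rank \<open>i\<close>.\<close>
  have cardc: "map (\<lambda>x. card (fst x)) c = [1..<n]"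
  proof (rule sorted_wrt_less_set_inject)
    show "sorted_wrt (<) (map (\<lambda>x. card (fst x)) c)"
      unfolding sorted_wrt_map
      by (rule sorted_wrt_mono_rel[OF _ srt(1)],
          rule segre_interior_less(3)[of ?A ?A, OF finite_atLeastAtMost finite_atLeastAtMost])
        (use srt(2) in blast)+
    have "(\<lambda>x. card (fst x)) ` set c = {1..<n}"
    proof (rule card_subset_eq)
      show "(\<lambda>x. card (fst x)) ` set c \<subseteq> {1..<n}"
        using card_fst_inj_on_chain(2)[of ?A ?A "set c"] srt by simp
      show "card ((\<lambda>x. card (fst x)) ` set c) = card {1..<n}"
        using card_fst_inj_on_chain(1)[of ?A ?A "set c"] srt c(2) sorted_wrt_less_distinct[OF srt(1)]
        by (simp add: card_image distinct_card)
    qed simp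
    then show "set (map (\<lambda>x. card (fst x)) c) = set [1..<n]" by simp
  qed simp
  have cj: "card (fst (c ! (i - 1))) = i" "c ! (i - 1) \<in> segre_interior ?A ?A" if "i \<in> {1..<n}" for i
  proof -
    have l: "i - 1 < length c" using that c(2) by auto
    then have "map (\<lambda>x. card (fst x)) c ! (i - 1) = card (fst (c ! (i - 1)))" by simp
    then show "card (fst (c ! (i - 1))) = i" unfolding cardc using that by simp
    show "c ! (i - 1) \<in> segre_interior ?A ?A" using srt(2) nth_mem[OF l] by blast
  qed
  have inc: "c ! (i - 1) \<le> c ! i" if "i \<in> {1..<n}" "Suc i < n" for i
  proof -
    have "c ! (i - 1) < c ! i" using that c(2) by (intro sorted_wrt_nth_less[OF srt(1)]) auto
    then show ?thesis by simp
  qed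
  \<comment> \<open>Stated for a monotone \<open>f\<close> to serve both coordinates; the empty and
    the full set complete the flag at ranks 0 and \<open>n\<close>.\<close>
  have key: "\<exists>\<sigma>. \<sigma> permutes ?A \<and> (\<forall>i\<le>n. prefix_cut \<sigma> i = (if i = 0 then {} else if i = n then ?A else f (c ! (i - 1))))"
    if f: "\<And>i. i \<in> {1..<n} \<Longrightarrow> card (f (c ! (i - 1))) = i" "\<And>i. i \<in> {1..<n} \<Longrightarrow> f (c ! (i - 1)) \<subseteq> ?A"
      "\<And>x y. x \<le> y \<Longrightarrow> f x \<subseteq> f y" for f :: "nat set \<times> nat set \<Rightarrow> nat set"
  proof (rule ex_permutes_prefix_cut[of "\<lambda>i. if i = 0 then {} else if i = n then ?A else f (c ! (i - 1))"])
    let ?S = "\<lambda>i. if i = 0 then {} else if i = n then ?A else f (c ! (i - 1))"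
    show "?S n = ?A" using n by simp
    show "card (?S i) = i \<and> finite (?S i)" if "i \<le> n" for i
      using that f(1)[of i] f(2)[of i] by (auto dest: finite_subset)
    show "?S i \<subseteq> ?S (Suc i)" if "i < n" for i
      using that f(2)[of i] f(3)[OF inc[of i]] by auto
  qed
  have "\<exists>\<sigma>. \<sigma> permutes ?A \<and> (\<forall>i\<le>n. prefix_cut \<sigma> i = (if i = 0 then {} else if i = n then ?A else fst (c ! (i - 1))))"
    by (rule key) (use cj(1) segre_interiorD(1)[OF cj(2)] in \<open>simp_all add: less_eq_prod_def\<close>)
  then obtain \<sigma> where \<sigma>: "\<sigma> permutes ?A" "\<And>i. i \<le> n \<Longrightarrow> prefix_cut \<sigma> i = (if i = 0 then {} else if i = n then ?A else fst (c ! (i - 1)))"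
    by blast
  have "\<exists>\<omega>. \<omega> permutes ?A \<and> (\<forall>i\<le>n. prefix_cut \<omega> i = (if i = 0 then {} else if i = n then ?A else snd (c ! (i - 1))))"
    by (rule key) (use cj(1) segre_interiorD(2,3)[OF cj(2)] in \<open>simp_all add: less_eq_prod_def\<close>)
  then obtain \<omega> where \<omega>: "\<omega> permutes ?A" "\<And>i. i \<le> n \<Longrightarrow> prefix_cut \<omega> i = (if i = 0 then {} else if i = n then ?A else snd (c ! (i - 1)))"
    by blast
  have "c = perm_chain n (\<sigma>, \<omega>)"
  proof (rule nth_equalityI)
    show "length c = length (perm_chain n (\<sigma>, \<omega>))" using c(2) by (simp add: perm_chain_def)
    fix i assume "i < length c"
    then have i: "Suc i < n" using c(2) by simp
    then have "prefix_cut \<sigma> (Suc i) = fst (c ! i)" "prefix_cut \<omega> (Suc i) = snd (c ! i)"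
      using \<sigma>(2)[of "Suc i"] \<omega>(2)[of "Suc i"] by simp_all
    moreover have "[1..<n] ! i = Suc i" using i by (subst nth_upt) auto
    ultimately show "c ! i = perm_chain n (\<sigma>, \<omega>) ! i" using i by (simp add: perm_chain_def)
  qed
  then show ?thesis using \<sigma>(1) \<omega>(1) by blast
qed

lemma inv_series_W_poly:
  assumes n: "1 \<le> n"
  shows "inv_series {1..n} {1..n} = W_poly n"
proof -
  let ?A = "{1..n}"
  have bij: "bij_betw (perm_chain n) (no_common_ascent n) (critical_chains ?A ?A)"
    unfolding bij_betw_def
  proof
    show "inj_on (perm_chain n) (no_common_ascent n)"
    proof (rule inj_onI)
      fix p p' assume "p \<in> no_common_ascent n" "p' \<in> no_common_ascent n" and eq: "perm_chain n p = perm_chain n p'"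
      then obtain \<sigma> \<omega> \<sigma>' \<omega>' where p: "p = (\<sigma>, \<omega>)" "p' = (\<sigma>', \<omega>')"
        "\<sigma> permutes ?A" "\<omega> permutes ?A" "\<sigma>' permutes ?A" "\<omega>' permutes ?A"
        by (auto simp: no_common_ascent_def)
      have "prefix_cut \<sigma> i = prefix_cut \<sigma>' i \<and> prefix_cut \<omega> i = prefix_cut \<omega>' i" if "i \<in> {1..<n}" for i
        using eq that by (simp add: p perm_chain_def)
      then show "p = p'" using prefix_cut_inject p by blast
    qed
    show "perm_chain n ` no_common_ascent n = critical_chains ?A ?A"
    proof (intro equalityI subsetI)
      fix c assume "c \<in> perm_chain n ` no_common_ascent n"
      then obtain \<sigma> \<omega> where p: "\<sigma> permutes ?A" "\<omega> permutes ?A" "ascents n \<sigma> \<inter> ascents n \<omega> = {}"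
        "c = perm_chain n (\<sigma>, \<omega>)" by (auto simp: no_common_ascent_def)
      then show "c \<in> critical_chains ?A ?A"
        using perm_chain_in_segre_chains[OF p(1,2)] free_elems_perm_chain[OF p(1,2)]
        by (simp add: critical_chains_def)
    next
      fix c assume c: "c \<in> critical_chains ?A ?A"
      then have "length c = n - 1" using length_critical_chain[of ?A ?A c] by simp
      then obtain \<sigma> \<omega> where p: "\<sigma> permutes ?A" "\<omega> permutes ?A" "c = perm_chain n (\<sigma>, \<omega>)"
        using ex_perm_chain[OF n, of c] c by (auto simp: critical_chains_def)
      then have "(\<sigma>, \<omega>) \<in> no_common_ascent n"
        using c free_elems_perm_chain[OF p(1,2)] by (simp add: critical_chains_def no_common_ascent_def)
      then show "c \<in> perm_chain n ` no_common_ascent n" using p by blast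
    qed
  qed
  have "inv_series ?A ?A = (\<Sum>c\<in>critical_chains ?A ?A. fps_X ^ card (chain_inv ?A ?A (set c)))"
    using n by (intro inv_series_critical) auto
  also have "\<dots> = (\<Sum>p\<in>no_common_ascent n. fps_X ^ card (chain_inv ?A ?A (set (perm_chain n p))))"
    by (rule sum.reindex_bij_betw[OF bij, symmetric])
  also have "\<dots> = W_poly n"
    unfolding W_poly_def
  proof (rule sum.cong[OF refl])
    fix p assume "p \<in> no_common_ascent n"
    then obtain \<sigma> \<omega> where p: "p = (\<sigma>, \<omega>)" "\<sigma> permutes ?A" "\<omega> permutes ?A"
      by (auto simp: no_common_ascent_def)
    show "fps_X ^ card (chain_inv ?A ?A (set (perm_chain n p)))
      = (case p of (\<sigma>, \<omega>) \<Rightarrow> fps_X ^ (inversions n \<sigma> + inversions n \<omega>))"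
      unfolding p(1) card_chain_inv_perm_chain[OF p(2,3)] by simp
  qed
  finally show ?thesis .
qed

section \<open>The character of the top homology\<close>

lemma segre_proper_part_eq:
  assumes "1 \<le> n"
  shows "segre_proper_part n = segre_interior {1..n} {1..n}"
proof (intro equalityI subsetI)
  fix x assume x: "x \<in> segre_proper_part n"
  then obtain S T where ST: "x = (S, T)" "S \<subseteq> {1..n}" "T \<subseteq> {1..n}" "card S = card T"
    "(S, T) \<noteq> ({}, {})" "(S, T) \<noteq> ({1..n}, {1..n})"
    by (auto simp: segre_proper_part_def segre_poset_def)
  have fin: "finite S" "finite T" using ST finite_subset by auto
  have "card S \<noteq> 0" using ST fin by auto
  moreover have "card S \<noteq> n"
    using ST card_subset_eq[of "{1..n}" S] card_subset_eq[of "{1..n}" T] by auto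
  moreover have "card S \<le> n" using card_mono[of "{1..n}" S] ST by simp
  ultimately show "x \<in> segre_interior {1..n} {1..n}" using ST by (simp add: segre_interior_def)
next
  fix x assume x: "x \<in> segre_interior {1..n} {1..n}"
  then show "x \<in> segre_proper_part n"
    by (auto simp: segre_interior_def segre_proper_part_def segre_poset_def)
qed

lemma order_simplices_eq:
  assumes "1 \<le> n"
  shows "order_simplices (segre_proper_part n) (int l - 1) = ranked_chains {1..n} {1..n} l"
  unfolding segre_proper_part_eq[OF assms]
  by (auto simp: order_simplices_def ranked_chains_def segre_chains_def)

lemma boundary_eq_face_coeff:
  assumes "finite X" "\<And>x. x \<notin> X \<Longrightarrow> c x = 0"
  shows "boundary c w = (\<Sum>x\<in>X. c x * face_coeff x w)"
proof -
  have "boundary c w = (\<Sum>x | c x \<noteq> 0. c x * face_coeff x w)"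
    unfolding boundary_def face_coeff_def delete_nth_def
    by (intro sum.cong refl) (auto simp: sum_distrib_left intro!: sum.cong)
  also have "\<dots> = (\<Sum>x\<in>X. c x * face_coeff x w)"
    using assms by (intro sum.mono_neutral_left) auto
  finally show ?thesis .
qed

definition top_cycles :: "nat \<Rightarrow> ((nat set \<times> nat set) list \<Rightarrow> complex) set" where
  "top_cycles n = {z. (\<forall>y. y \<notin> ranked_chains {1..n} {1..n} (n - 1) \<longrightarrow> z y = 0) \<and>
     (\<forall>w. (\<Sum>y\<in>ranked_chains {1..n} {1..n} (n - 1). z y * face_coeff y w) = 0)}"

lemma finite_ranked_chains: "finite A \<Longrightarrow> finite B \<Longrightarrow> finite (ranked_chains A B l)"
  using finite_segre_chains by (auto simp: ranked_chains_def)

lemma cycle_module_eq: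
  assumes "1 \<le> n"
  shows "cycle_module (segre_proper_part n) (int n - 2) = fun_module (top_cycles n)"
proof -
  let ?X = "ranked_chains {1..n} {1..n} (n - 1)"
  have fin: "finite ?X" by (simp add: finite_ranked_chains)
  have os: "order_simplices (segre_proper_part n) (int n - 2) = ?X"
    using order_simplices_eq[OF assms, of "n - 1"] assms by (simp add: of_nat_diff)
  have "{c \<in> poset_chains (segre_proper_part n) (int n - 2). boundary c = (\<lambda>_. 0)} = top_cycles n"
  proof (rule Set.set_eqI)
    fix z
    have "z \<in> poset_chains (segre_proper_part n) (int n - 2) \<longleftrightarrow> (\<forall>y. y \<notin> ?X \<longrightarrow> z y = 0)"
      unfolding poset_chains_def os mem_Collect_eq
      using finite_subset[OF _ fin, of "{xs. z xs \<noteq> 0}"] by blast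
    moreover have "boundary z = (\<lambda>_. 0) \<longleftrightarrow> (\<forall>w. (\<Sum>y\<in>?X. z y * face_coeff y w) = 0)"
      if "\<forall>y. y \<notin> ?X \<longrightarrow> z y = 0"
      using boundary_eq_face_coeff[OF fin, of z] that by (auto simp: fun_eq_iff)
    ultimately show "z \<in> {c \<in> poset_chains (segre_proper_part n) (int n - 2). boundary c = (\<lambda>_. 0)}
      \<longleftrightarrow> z \<in> top_cycles n"
      unfolding top_cycles_def by blast
  qed
  then show ?thesis by (simp add: cycle_module_def fun_module_def)
qed

text \<open>No chain has \<open>n\<close> members, so 0 is the only boundary. For
  \<open>n = 1\<close> the empty chain is the only simplex and the space is one-dimensional.\<close>

lemma reduced_homology_eq:
  assumes "1 \<le> n"
  shows "reduced_homology (segre_proper_part n) (int n - 2)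
    = quotient_module (fun_module (top_cycles n)) {\<lambda>_. 0}"
proof -
  have "ranked_chains {1..n} {1..n} n = {}"
    using length_segre_chain[of "{1..n}" "{1..n}"] assms by (force simp: ranked_chains_def)
  then have "order_simplices (segre_proper_part n) (int n - 2 + 1) = {}"
    using order_simplices_eq[OF assms, of n] by (simp add: algebra_simps)
  then have "poset_chains (segre_proper_part n) (int n - 2 + 1) = {\<lambda>_. 0}"
    unfolding poset_chains_def by (auto simp: fun_eq_iff)
  moreover have "boundary (\<lambda>_. 0) = (\<lambda>_ :: (nat set \<times> nat set) list. 0)"
    by (simp add: boundary_def)
  ultimately show ?thesis
    by (simp add: reduced_homology_def cycle_module_eq[OF assms])
qed

lemma fun_subspace_top_cycles: "fun_subspace (ranked_chains {1..n} {1..n} (n - 1)) (top_cycles n)"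
proof
  fix u v a
  show "(\<lambda>x. u x + v x) \<in> top_cycles n" if "u \<in> top_cycles n" "v \<in> top_cycles n"
    using that by (simp add: top_cycles_def distrib_right sum.distrib)
  show "(\<lambda>x. a * v x) \<in> top_cycles n" if "v \<in> top_cycles n"
    using that by (simp add: top_cycles_def mult.assoc sum_distrib_left[symmetric])
qed (auto simp: top_cycles_def finite_ranked_chains)

lemma bij_segre_action:
  assumes "\<sigma> permutes A" "\<tau> permutes B"
  shows "bij (segre_action \<sigma> \<tau>)"
proof (rule bijI)
  show "inj (segre_action \<sigma> \<tau>)"
  proof (rule injI)
    fix x y assume "segre_action \<sigma> \<tau> x = segre_action \<sigma> \<tau> y"
    then have "\<sigma> ` fst x = \<sigma> ` fst y" "\<tau> ` snd x = \<tau> ` snd y"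
      by (simp_all add: segre_action_def split_beta)
    then show "x = y"
      using inj_image_eq_iff[OF permutes_inj[OF assms(1)]] inj_image_eq_iff[OF permutes_inj[OF assms(2)]]
      by (simp add: prod_eq_iff)
  qed
  show "surj (segre_action \<sigma> \<tau>)"
  proof (rule surjI)
    fix x
    show "segre_action \<sigma> \<tau> (\<sigma> -` fst x, \<tau> -` snd x) = x"
      using permutes_surj[OF assms(1)] permutes_surj[OF assms(2)]
      by (simp add: segre_action_def surj_image_vimage_eq)
  qed
qed

lemma segre_action_interior:
  assumes "\<sigma> permutes A" "\<tau> permutes B" "x \<in> segre_interior A B"
  shows "segre_action \<sigma> \<tau> x \<in> segre_interior A B"
proof -
  note xD = segre_interiorD[OF assms(3)]
  have inj: "inj_on \<sigma> S" "inj_on \<tau> S" for S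
    using permutes_inj[OF assms(1)] permutes_inj[OF assms(2)] inj_on_subset by blast+
  have "\<sigma> ` fst x \<subseteq> A" "\<tau> ` snd x \<subseteq> B"
    using xD permutes_image[OF assms(1)] permutes_image[OF assms(2)] by blast+
  then show ?thesis using xD card_image[OF inj(1), of "fst x"] card_image[OF inj(2), of "snd x"]
    by (cases x) (simp add: segre_action_def segre_interior_def)
qed

lemma segre_action_less:
  assumes "\<sigma> permutes A" "\<tau> permutes B" "x < y"
  shows "segre_action \<sigma> \<tau> x < segre_action \<sigma> \<tau> y"
proof -
  have "segre_action \<sigma> \<tau> x \<noteq> segre_action \<sigma> \<tau> y"
    using bij_segre_action[OF assms(1,2)] assms(3) by (auto dest: bij_is_inj injD)
  moreover have "segre_action \<sigma> \<tau> x \<le> segre_action \<sigma> \<tau> y"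
    using assms(3) by (cases x; cases y) (auto simp: segre_action_def less_eq_prod_def less_le)
  ultimately show ?thesis by simp
qed

lemma bij_betw_segre_action_chains:
  assumes "\<sigma> permutes A" "\<tau> permutes B" "finite A" "finite B"
  shows "bij_betw (map (segre_action \<sigma> \<tau>)) (ranked_chains A B l) (ranked_chains A B l)"
proof -
  let ?X = "ranked_chains A B l" and ?f = "segre_action \<sigma> \<tau>"
  have inj: "inj_on (map ?f) ?X"
    using bij_segre_action[OF assms(1,2)] bij_is_inj inj_mapI inj_on_subset by blast
  have "map ?f ` ?X \<subseteq> ?X"
  proof
    fix y assume "y \<in> map ?f ` ?X"
    then obtain x where x: "y = map ?f x" "sorted_wrt (<) x" "set x \<subseteq> segre_interior A B" "length x = l"
      by (auto simp: ranked_chains_def segre_chains_def)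
    have "sorted_wrt (<) y" unfolding x(1) sorted_wrt_map
      by (rule sorted_wrt_mono_rel[OF _ x(2)]) (rule segre_action_less[OF assms(1,2)])
    moreover have "set y \<subseteq> segre_interior A B"
      using x segre_action_interior[OF assms(1,2)] by auto
    ultimately show "y \<in> ?X" using x by (simp add: ranked_chains_def segre_chains_def)
  qed
  then show ?thesis
    using inj endo_inj_surj[OF finite_ranked_chains[OF assms(3,4)]] by (simp add: bij_betw_def)
qed

lemma chain_map_apply:
  assumes "inj f"
  shows "chain_map f c (map f x) = c x"
proof -
  have "{xs. c xs \<noteq> 0 \<and> map f xs = map f x} = (if c x = 0 then {} else {x})"
    using inj_map_eq_map[OF assms] by auto
  then show ?thesis by (simp add: chain_map_def)
qed

lemma top_homology_character_eq:
  assumes n: "1 \<le> n" and \<sigma>: "\<sigma> permutes {1..n}" and \<tau>: "\<tau> permutes {1..n}"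
  shows "top_homology_character n \<sigma> \<tau> = fixed_chain_sum (cycle_mset \<sigma> {1..n}) (cycle_mset \<tau> {1..n})"
proof -
  let ?A = "{1..n}" and ?f = "segre_action \<sigma> \<tau>" and ?R = "ranked_chains {1..n} {1..n}"
  let ?X = "?R (n - 1)"
  have bij: "bij ?f" using bij_segre_action[OF \<sigma> \<tau>] .
  have inj: "inj ?f" using bij by (rule bij_is_inj)
  have g: "bij_betw (map ?f) (?R l) (?R l)" for l
    using bij_betw_segre_action_chains[OF \<sigma> \<tau>] by simp
  obtain E where E: "cycle_projection ?A ?A (n - 1) E"
    and tr: "(\<Sum>x\<in>?X. E (map ?f x) x) =
        (\<Sum>j\<le>n - 1. (-1) ^ (n - 1 + j) * of_nat (card {x \<in> ?R j. map ?f x = x}))"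
    using cycle_projection_trace[of ?A ?A ?f "n - 1", OF _ _ _ inj g] n by auto
  interpret fun_subspace ?X "top_cycles n" by (rule fun_subspace_top_cycles)
  have "top_homology_character n \<sigma> \<tau> = linear_trace Q (\<lambda>C. chain_map ?f ` C)"
    unfolding top_homology_character_def reduced_homology_eq[OF n] homology_map_def ..
  also have "\<dots> = (\<Sum>x\<in>?X. E (map ?f x) x)"
  proof (rule linear_trace_Q[OF _ _ g])
    show "E x \<in> top_cycles n" if "x \<in> ?X" for x
      using E that unfolding cycle_projection_def top_cycles_def by blast
    show "z y = (\<Sum>x\<in>?X. z x * E x y)" if "z \<in> top_cycles n" for z y
      using E that unfolding cycle_projection_def top_cycles_def by blast
    show "chain_map ?f z (map ?f x) = z x" for z x by (rule chain_map_apply[OF inj])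
    show "chain_map ?f z \<in> top_cycles n" if z: "z \<in> top_cycles n" for z
      unfolding top_cycles_def mem_Collect_eq
    proof (intro conjI allI impI)
      fix y assume y: "y \<notin> ?X"
      have "{xs. z xs \<noteq> 0 \<and> map ?f xs = y} = {}"
      proof -
        have "map ?f xs \<in> ?X" if "z xs \<noteq> 0" for xs
        proof -
          have "xs \<in> ?X" using z that unfolding top_cycles_def by blast
          then show ?thesis using bij_betwE[OF g] by blast
        qed
        then show ?thesis using y by blast
      qed
      then show "chain_map ?f z y = 0" unfolding chain_map_def by (simp only: sum.empty)
    next
      fix w
      \<comment> \<open>The action is onto, so the boundary coefficient at \<open>w\<close> of the
        image chain is one of \<open>z\<close> at a preimage \<open>w'\<close>.\<close>
      obtain w' where w: "w = map ?f w'" using bij_is_surj[OF bij] ex_map_conv[of w ?f] by (metis surjD)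
      have "(\<Sum>y\<in>?X. chain_map ?f z y * face_coeff y w)
        = (\<Sum>x\<in>?X. chain_map ?f z (map ?f x) * face_coeff (map ?f x) w)"
        by (rule sum.reindex_bij_betw[OF g, symmetric])
      also have "\<dots> = (\<Sum>x\<in>?X. z x * face_coeff x w')"
        unfolding w chain_map_apply[OF inj] face_coeff_map[OF inj] ..
      also have "\<dots> = 0" using z unfolding top_cycles_def by blast
      finally show "(\<Sum>y\<in>?X. chain_map ?f z y * face_coeff y w) = 0" .
    qed
  qed
  also have "\<dots> = (\<Sum>j\<le>n - 1. \<Sum>c | c \<in> ?R j \<and> map ?f c = c. (-1) ^ (card ?A + 1 + length c))"
    unfolding tr
  proof (rule sum.cong[OF refl])
    fix j
    \<comment> \<open>Shifting the exponent by 2 reconciles the sign of the trace formula with that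
      of \<open>fixed_chain_sum_eq\<close>.\<close>
    have e: "card ?A + 1 + j = n - 1 + j + 2" using n by simp
    have "(\<Sum>c | c \<in> ?R j \<and> map ?f c = c. (-1) ^ (card ?A + 1 + length c))
      = (\<Sum>c | c \<in> ?R j \<and> map ?f c = c. (-1) ^ (card ?A + 1 + j) :: complex)"
      by (rule sum.cong) (auto simp: ranked_chains_def)
    also have "\<dots> = (-1) ^ (n - 1 + j) * of_nat (card {x \<in> ?R j. map ?f x = x})"
      unfolding e by (simp add: power_add)
    finally show "(-1) ^ (n - 1 + j) * of_nat (card {x \<in> ?R j. map ?f x = x})
      = (\<Sum>c | c \<in> ?R j \<and> map ?f c = c. (-1) ^ (card ?A + 1 + length c) :: complex)" by simp
  qed
  also have "\<dots> = (\<Sum>c | c \<in> segre_chains ?A ?A \<and> map ?f c = c. (-1) ^ (card ?A + 1 + length c))"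
  proof -
    have fin: "finite {c \<in> ?R j. map ?f c = c}" for j
      using finite_ranked_chains[of ?A ?A j] by simp
    have "{c. c \<in> segre_chains ?A ?A \<and> map ?f c = c} = (\<Union>j\<in>{..n - 1}. {c \<in> ?R j. map ?f c = c})"
      using length_segre_chain[of ?A ?A] by (auto simp: ranked_chains_def)
    then show ?thesis
      using fin by (simp only:) (subst sum.UNION_disjoint, auto simp: ranked_chains_def)
  qed
  also have "\<dots> = fixed_chain_sum (cycle_mset \<sigma> ?A) (cycle_mset \<tau> ?A)"
    by (rule fixed_chain_sum_eq)
      (use \<sigma> \<tau> in \<open>auto simp: permutes_image permutation_permutes intro: exI[of _ ?A]\<close>)
  finally show ?thesis .
qed

section \<open>Partitions as decreasing lists and as multisets\<close>

lemma sorted_wrt_ge_mset: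
  assumes "sorted_wrt (\<ge>) (\<mu> :: nat list)"
  shows "rev (sorted_list_of_multiset (mset \<mu>)) = \<mu>"
proof -
  have "sorted (rev \<mu>)" using assms by (simp add: sorted_wrt_rev)
  then have "sort \<mu> = rev \<mu>" by (intro properties_for_sort) auto
  then show ?thesis by simp
qed

lemma bij_betw_mset_partitions: "bij_betw mset (partitions n) (mset_partitions n)"
proof (rule bij_betw_byWitness[where f' = "\<lambda>M. rev (sorted_list_of_multiset M)"])
  show "\<forall>\<mu>\<in>partitions n. rev (sorted_list_of_multiset (mset \<mu>)) = \<mu>"
    using sorted_wrt_ge_mset by (simp add: partitions_def)
  show "(\<lambda>M. rev (sorted_list_of_multiset M)) ` mset_partitions n \<subseteq> partitions n"
  proof
    fix \<mu> assume "\<mu> \<in> (\<lambda>M. rev (sorted_list_of_multiset M)) ` mset_partitions n"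
    then obtain M where M: "M \<in> mset_partitions n" "\<mu> = rev (sorted_list_of_multiset M)" by blast
    have "sorted_wrt (\<ge>) \<mu>" using M by (simp add: sorted_wrt_rev)
    moreover have "mset \<mu> = M" using M by simp
    then have "sum_list \<mu> = n" "0 \<notin> set \<mu>"
      using M(1) by (auto simp: mset_partitions_def sum_mset_sum_list simp flip: set_mset_mset)
    ultimately show "\<mu> \<in> partitions n" by (simp add: partitions_def)
  qed
qed (auto simp: partitions_def mset_partitions_def sum_mset_sum_list)

lemma z_partition_eq: "z_partition \<mu> = z_mset (mset \<mu>)"
  by (simp add: z_partition_def z_mset_def count_mset)

text \<open>The choice is justified by \<open>ex_permutes_cycle_mset\<close>; applying
  \<open>mset\<close> undoes the sorting in \<open>cycle_type\<close>.\<close>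

lemma perm_of_type_props:
  assumes "\<mu> \<in> partitions n"
  shows "perm_of_type n \<mu> permutes {1..n}" "cycle_mset (perm_of_type n \<mu>) {1..n} = mset \<mu>"
proof -
  have \<mu>: "0 \<notin># mset \<mu>" "sum_mset (mset \<mu>) = n" "sorted_wrt (\<ge>) \<mu>"
    using assms by (auto simp: partitions_def sum_mset_sum_list)
  obtain \<sigma> where \<sigma>: "\<sigma> permutes {1..n}" "cycle_mset \<sigma> {1..n} = mset \<mu>"
    using ex_permutes_cycle_mset[OF \<mu>(1), of "{1..n}"] \<mu>(2) by auto
  have ct: "cycle_type n \<rho> = rev (sorted_list_of_multiset (cycle_mset \<rho> {1..n}))" for \<rho>
    by (simp add: cycle_type_def cycle_mset_def)
  have "\<exists>\<sigma>. \<sigma> permutes {1..n} \<and> cycle_type n \<sigma> = \<mu>"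
    using \<sigma> sorted_wrt_ge_mset[OF \<mu>(3)] by (auto simp: ct)
  from someI_ex[OF this] have p: "perm_of_type n \<mu> permutes {1..n}" "cycle_type n (perm_of_type n \<mu>) = \<mu>"
    by (auto simp: perm_of_type_def)
  show "perm_of_type n \<mu> permutes {1..n}" by (rule p)
  have "mset (cycle_type n (perm_of_type n \<mu>)) = mset \<mu>" using p(2) by simp
  then show "cycle_mset (perm_of_type n \<mu>) {1..n} = mset \<mu>" unfolding ct by simp
qed

theorem theorem4p9:
  fixes n :: nat
  assumes "n \<ge> 1"
  shows "principal_specialization (frobenius_char n n (top_homology_character n))
    = W_poly n / (\<Prod>i=1..n. (1 - fps_X ^ i)\<^sup>2)"
proof -
  let ?P = "partitions n" and ?w = mset_weight and ?X = "\<lambda>M N. fps_const (fixed_chain_sum M N)"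
  let ?\<chi> = "\<lambda>\<mu> \<nu>. top_homology_character n (perm_of_type n \<mu>) (perm_of_type n \<nu>)
     / (of_nat (z_partition \<mu>) * of_nat (z_partition \<nu>))"
  let ?s = "\<lambda>\<mu> \<nu>. series_mult (power_sum_partition XVar \<mu>) (power_sum_partition YVar \<nu>)"
  have finP: "finite ?P"
    using bij_betw_finite[OF bij_betw_mset_partitions] finite_mset_partitions by blast
  have sum: "sum_list \<mu> = n" "0 \<notin> set \<mu>" if "\<mu> \<in> ?P" for \<mu>
    using that by (auto simp: partitions_def)
  have deg: "degree_le (n + n) (?s \<mu> \<nu>)" if "\<mu> \<in> ?P" "\<nu> \<in> ?P" for \<mu> \<nu>
    using degree_le_mult[OF degree_le_power_sum_partition[of \<mu>] degree_le_power_sum_partition[of \<nu>]]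
      sum that by simp
  \<comment> \<open>The double sum is flattened to one over pairs, so that \<open>ps_sum\<close>
    gives linearity in one step.\<close>
  have "principal_specialization (frobenius_char n n (top_homology_character n))
    = principal_specialization (\<lambda>M. \<Sum>p\<in>?P \<times> ?P. ?\<chi> (fst p) (snd p) * ?s (fst p) (snd p) M)"
    unfolding frobenius_char_def by (simp add: sum.cartesian_product split_beta)
  also have "\<dots> = (\<Sum>p\<in>?P \<times> ?P. fps_const (?\<chi> (fst p) (snd p)) * principal_specialization (?s (fst p) (snd p)))"
    using finP deg by (intro ps_sum) auto
  also have "\<dots> = (\<Sum>p\<in>?P \<times> ?P. ?w (mset (fst p)) * ?w (mset (snd p)) * ?X (mset (fst p)) (mset (snd p)))"
  proof (rule sum.cong[OF refl])
    fix p assume "p \<in> ?P \<times> ?P"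
    then obtain \<mu> \<nu> where p: "p = (\<mu>, \<nu>)" "\<mu> \<in> ?P" "\<nu> \<in> ?P" by auto
    let ?w' = "\<lambda>\<mu>. \<Prod>k\<in>#mset \<mu>. inverse (1 - fps_X ^ k :: complex fps)"
    have "principal_specialization (?s \<mu> \<nu>) = ?w' \<mu> * ?w' \<nu>"
      using ps_mult[OF degree_le_power_sum_partition degree_le_power_sum_partition]
        ps_power_sum_partition[OF _ sum(2)[OF p(2)]] ps_power_sum_partition[OF _ sum(2)[OF p(3)]] by simp
    moreover have "top_homology_character n (perm_of_type n \<mu>) (perm_of_type n \<nu>)
      = fixed_chain_sum (mset \<mu>) (mset \<nu>)"
      using top_homology_character_eq[OF assms perm_of_type_props(1)[OF p(2)] perm_of_type_props(1)[OF p(3)]]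
      by (simp only: perm_of_type_props(2)[OF p(2)] perm_of_type_props(2)[OF p(3)])
    moreover have "fps_const (x / (a * b)) = fps_const (1 / a) * fps_const (1 / b) * fps_const x" for x a b :: complex
      by simp
    ultimately show "fps_const (?\<chi> (fst p) (snd p)) * principal_specialization (?s (fst p) (snd p))
      = ?w (mset (fst p)) * ?w (mset (snd p)) * ?X (mset (fst p)) (mset (snd p))"
      unfolding p fst_conv snd_conv mset_weight_def z_partition_eq by (simp only: mult_ac)
  qed
  also have "\<dots> = (\<Sum>\<mu>\<in>?P. \<Sum>\<nu>\<in>?P. ?w (mset \<mu>) * ?w (mset \<nu>) * ?X (mset \<mu>) (mset \<nu>))"
    by (simp add: sum.cartesian_product split_beta)
  \<comment> \<open>Decreasing lists are exchanged for multisets, on which the recursion was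
    solved.\<close>
  also have "\<dots> = (\<Sum>\<mu>\<in>?P. \<Sum>N\<in>mset_partitions n. ?w (mset \<mu>) * ?w N * ?X (mset \<mu>) N)"
    by (intro sum.cong refl sum.reindex_bij_betw[OF bij_betw_mset_partitions,
          where g = "\<lambda>N. ?w (mset \<mu>) * ?w N * ?X (mset \<mu>) N" for \<mu>])
  also have "\<dots> = (\<Sum>M\<in>mset_partitions n. \<Sum>N\<in>mset_partitions n. ?w M * ?w N * ?X M N)"
    by (rule sum.reindex_bij_betw[OF bij_betw_mset_partitions,
          where g = "\<lambda>M. \<Sum>N\<in>mset_partitions n. ?w M * ?w N * ?X M N"])
  also have "\<dots> = segre_series n" by (rule sum_weight_fixed_chain_sum)
  finally have lhs: "principal_specialization (frobenius_char n n (top_homology_character n)) = segre_series n" .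
  have W: "W_poly n = (qpoch n)\<^sup>2 * segre_series n"
    using inv_series_eq[of "{1..n}" "{1..n}"] inv_series_W_poly[OF assms] by simp
  \<comment> \<open>The constant term 1 makes the divisor nonzero, so the division of power series
    cancels it.\<close>
  have "fps_nth ((qpoch n)\<^sup>2) 0 = 1" by (simp add: qpoch_nth0 power2_eq_square)
  then have "(qpoch n)\<^sup>2 \<noteq> 0" by auto
  moreover have "(\<Prod>i=1..n. (1 - fps_X ^ i)\<^sup>2) = (qpoch n)\<^sup>2"
    by (simp add: qpoch_def prod_power_distrib)
  ultimately show ?thesis unfolding lhs W by simp
qed

end
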